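(* Let $k\in\{1,\dots,5\}$, and for a height function $h$ on the hypercube $H^5$ write $\nu_k(h)=\nu_k(D_h)\in E_k(\mathbb{C})$ for the image in the elliptic curve $E_k$ of the discrete Morse divisor $D_h$ of $h$. Let $h_1$ be the height function on $H^5$ obtained by lowering the top vertex $(1,1,1,1,1)$ of the fully extended height function, and let $h$ be any height function on $H^5$. Then $\nu_k(h)=a\,\nu_k(h_1)$ for some integer $a$ with $-8\le a\le 8$. Furthermore, if $h$ and $h'$ are two height functions on $H^5$ that differ by lowering (or raising) a single vertex, we may write $\nu_k(h)=a\,\nu_k(h_1)$ and $\nu_k(h')=a'\,\nu_k(h_1)$ with $a,a'\in\mathbb{Z}$ and $|a-a'|=1$.
   Context: **Hypercube.** Color indices are taken modulo 5 in $\{1,\dots,5\}$. $H^5$ is the graph on $\{0,1\}^5$ with two vertices adjacent iff they differ in exactly one coordinate; an edge flipping coordinate $j$ has color $j$; the rainbow is the cyclic order $(1,2,3,4,5)$. Put $\mathbf 1=(1,1,1,1,1)$. Vertices at even distance from $\mathbf 1$ are white, the others black. $v_j$ is the neighbor of $v$ along color $j$. $f_{j,j+1}(v)$ is the (formal) face center of the 4-cycle through $v$ with colors $j,j+1$; it depends only on the 4-cycle, so there are 8 face centers for each $j$. **Heights.** A height function is $h:\{0,1\}^5\to\mathbb{Z}$ with $|h(u)-h(v)|=1$ for adjacent $u,v$; heights differing by a constant are identified. If $v$ is a local maximum (resp. minimum) of $h$, lowering (resp. raising) $v$ replaces $h(v)$ by $h(v)-2$ (resp. $h(v)+2$) and leaves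 the other values unchanged. The fully extended height is $h_{\rm fe}(x)=\sum_i x_i$; so $h_1(\mathbf 1)=3$ and $h_1=h_{\rm fe}$ elsewhere. **Discrete Morse divisor.** Fill each 4-cycle with two consecutive colors $j,j+1$ by a 2-cell and triangulate: if $h$ takes three values on the cycle (diamond) join its maximum and minimum by an edge; if $h$ takes two values (bow-tie) add the face center as a new vertex joined to the four vertices, with height the average of the four heights. For a vertex $p$ of this mesh, let $\lambda_p$ be the number of sign changes of $h(u)-h(p)$ as $u$ runs once around the boundary of the star of $p$, and $\kappa_p=\lambda_p/2-1$. Then $D_h=\sum_p\kappa_p\,p$. Concretely, $\kappa_v=\tfrac12\#\{j: h(v_j)\ne h(v_{j+1})\}-1$ for a hypercube vertex $v$, and a face center has coefficient $1$ if its 4-cycle is a bow-tie and $0$ if it is a diamond. **Curve and embedded points.** $\phi=(1+\sqrt5)/2$, $\zeta=e^{2\pi i/10}$. $X^5_{\rm alg}\subset\mathbb{P}^4$ is given by $x_1^2+x_2^2+x_3^2=0$, $\phi x_1^2+x_2^2+x_4^2=0$, $(\phi+1)x_1^2+x_2^2+x_5^2=0$. The sign ${\rm sgn}_k(j)$ for $j=1,\dots,5$ is: $k=1$: $+,+,+,+,+$; $k=2$: $-,-,-,-,+$; $k=3$: $-,+,+,+,-$; $k=4$: $-,-,+,+,-$; $k=5$: $-,-,-,+,-$. The vertex $\mathbf 1$ is placed at $[1:\zeta^2\sqrt\phi:\zeta^9:i\zeta^6:\zeta^8\sqrt\phi]$, and the face centers at $\mathbf 1$ at: $f_{5,1}(\mathbf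 1)=[1:0:-i:-i\sqrt\phi:-i\sqrt{\phi+1}]$, $f_{1,2}(\mathbf 1)=[1:i:0:-i\sqrt{\phi-1}:-i\sqrt\phi]$, $f_{2,3}(\mathbf 1)=[1:i\sqrt\phi:\sqrt{\phi-1}:0:-i]$, $f_{3,4}(\mathbf 1)=[1:i\sqrt{\phi+1}:\sqrt\phi:1:0]$, $f_{4,5}(\mathbf 1)=[0:1:-i:-i:-i]$. If $v$ (resp. $f_{m,m+1}(v)$) is placed at $[x_1:\dots:x_5]$, then $v_j$ (resp. $f_{m,m+1}(v_j)$) is placed at $[{\rm sgn}_1(j)\overline{x_1}:\dots:{\rm sgn}_5(j)\overline{x_5}]$; this determines all positions consistently. **Elliptic curves and maps.** $E_1,E_4: y^2=x(x-1)(x-(\phi+1))$; $E_2,E_5: y^2=x(x-1)(x-\phi)$; $E_3: y^2=x(x-1)(x+\phi)$, with the point at infinity $O_k$ as identity. The product $E_1\times\cdots\times E_5$ is isogenous to ${\rm Jac}(X^5_{\rm alg})$. The morphisms $\nu_k:X^5_{\rm alg}\to E_k$ are $\nu_1=\big(-(2\phi+1)\tfrac{x_1^2}{x_5^2}-\phi,\ (2\phi+1)\tfrac{x_2x_3x_4}{x_5^3}\big)$, $\nu_2=\big(\tfrac{x_2^2}{x_1^2}+\phi+1,\ i\tfrac{x_3x_4x_5}{x_1^3}\big)$, $\nu_3=\big((2\phi+1)\tfrac{x_3^2}{x_2^2}+\phi+1,\ i(2\phi+1)\tfrac{x_1x_4x_5}{x_2^3}\big)$, $\nu_4=\big((\phi+1)\tfrac{x_4^2}{x_3^2}-\phi,\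 i\phi\tfrac{x_1x_2x_5}{x_3^3}\big)$, $\nu_5=\big(-\tfrac{x_5^2}{x_4^2}+\phi+1,\ i\tfrac{x_1x_2x_3}{x_4^3}\big)$, where points with vanishing denominator go to $O_k$. For a divisor $D=\sum\kappa_p p$, $\nu_k(D)=\sum\kappa_p\,\nu_k(p)$ in the group $E_k(\mathbb{C})$. *)

theory Defs
  imports "HOL-Analysis.Cartesian_Space" "HOL-Algebra.FiniteProduct"
begin

section \<open>The hypercube and its height functions\<close>

text \<open>Colors are the elements of the numeral type \<open>5\<close> (integers modulo 5), so that \<open>j + 1\<close> is the
  next color of the rainbow. Beware that the color called 5 is the element \<open>5 = 0\<close>.\<close>

type_synonym color = 5
type_synonym vertex = "color \<Rightarrow> bool"

lemma color_cases: "j = 1 \<or> j = 2 \<or> j = 3 \<or> j = 4 \<or> j = 5" for j :: color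
proof (induct j)
  case (of_int z)
  hence "z = 0 \<or> z = 1 \<or> z = 2 \<or> z = 3 \<or> z = 4" by (simp, linarith)
  thus ?case by auto
qed

lemma forall_color: "(\<forall>j::color. P j) \<longleftrightarrow> P 1 \<and> P 2 \<and> P 3 \<and> P 4 \<and> P 5"
  by (metis color_cases)

lemma UNIV_color: "(UNIV :: color set) = {1, 2, 3, 4, 5}"
  using color_cases by blast

definition adjacent :: "vertex \<Rightarrow> vertex \<Rightarrow> bool" where
  "adjacent u v \<longleftrightarrow> card {j. u j \<noteq> v j} = 1"

text \<open>The neighbor of \<open>v\<close> along color \<open>j\<close>.\<close>
definition nbr :: "color \<Rightarrow> vertex \<Rightarrow> vertex" where
  "nbr j v = v(j := \<not> v j)"

definition top_vertex :: vertex where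
  "top_vertex = (\<lambda>_. True)"

definition height_function :: "(vertex \<Rightarrow> int) \<Rightarrow> bool" where
  "height_function h \<longleftrightarrow> (\<forall>u v. adjacent u v \<longrightarrow> \<bar>h u - h v\<bar> = 1)"

definition same_height :: "(vertex \<Rightarrow> int) \<Rightarrow> (vertex \<Rightarrow> int) \<Rightarrow> bool" where
  "same_height h h' \<longleftrightarrow> (\<exists>c. \<forall>v. h' v = h v + c)"

definition is_local_max :: "(vertex \<Rightarrow> int) \<Rightarrow> vertex \<Rightarrow> bool" where
  "is_local_max h v \<longleftrightarrow> (\<forall>u. adjacent u v \<longrightarrow> h u < h v)"

definition is_local_min :: "(vertex \<Rightarrow> int) \<Rightarrow> vertex \<Rightarrow> bool" where
  "is_local_min h v \<longleftrightarrow> (\<forall>u. adjacent u v \<longrightarrow> h v < h u)"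

definition lower :: "vertex \<Rightarrow> (vertex \<Rightarrow> int) \<Rightarrow> vertex \<Rightarrow> int" where
  "lower v h = h(v := h v - 2)"

definition raise :: "vertex \<Rightarrow> (vertex \<Rightarrow> int) \<Rightarrow> vertex \<Rightarrow> int" where
  "raise v h = h(v := h v + 2)"

text \<open>Heights are only relevant up to a constant, hence \<^const>\<open>same_height\<close>.\<close>
definition differ_by_move :: "(vertex \<Rightarrow> int) \<Rightarrow> (vertex \<Rightarrow> int) \<Rightarrow> bool" where
  "differ_by_move h h' \<longleftrightarrow>
     (\<exists>v. is_local_max h v \<and> same_height (lower v h) h' \<or>
          is_local_min h v \<and> same_height (raise v h) h')"

definition h_fe :: "vertex \<Rightarrow> int" where
  "h_fe x = (\<Sum>i\<in>UNIV. of_bool (x i))"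

definition h_1 :: "vertex \<Rightarrow> int" where
  "h_1 = lower top_vertex h_fe"


section \<open>The mesh and the discrete Morse divisor\<close>

text \<open>\<open>Center j w\<close> is the center of the 4-cycle through \<open>w\<close> with colors \<open>j, j + 1\<close>. To name each
  4-cycle once, only the \<open>w\<close> with \<open>w j\<close> and \<open>w (j + 1)\<close> true are used, see \<open>face_center\<close>.\<close>

datatype mesh_vertex = Vertex vertex | Center color vertex

definition face_center :: "color \<Rightarrow> vertex \<Rightarrow> mesh_vertex" where
  "face_center j v = Center j (v(j := True, j + 1 := True))"

definition four_cycle :: "color \<Rightarrow> vertex \<Rightarrow> vertex set" where
  "four_cycle j v = {v, nbr j v, nbr (j + 1) v, nbr j (nbr (j + 1) v)}"

fun mesh_height :: "(vertex \<Rightarrow> int) \<Rightarrow> mesh_vertex \<Rightarrow> real" where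
  "mesh_height h (Vertex v) = of_int (h v)"
| "mesh_height h (Center j w) = (\<Sum>u\<in>four_cycle j w. of_int (h u)) / 4"

definition bow_tie :: "(vertex \<Rightarrow> int) \<Rightarrow> color \<Rightarrow> vertex \<Rightarrow> bool" where
  "bow_tie h j v \<longleftrightarrow> card (h ` four_cycle j v) = 2"

text \<open>A bow-tie is coned off from its center; a diamond is cut along the edge joining its maximum
  \<open>a\<close> and its minimum \<open>b\<close>.\<close>
definition face_triangles :: "(vertex \<Rightarrow> int) \<Rightarrow> color \<Rightarrow> vertex \<Rightarrow> mesh_vertex set set" where
  "face_triangles h j v =
     (if bow_tie h j v
      then {{face_center j v, Vertex a, Vertex b} | a b.
              a \<in> four_cycle j v \<and> b \<in> four_cycle j v \<and> adjacent a b}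
      else {{Vertex a, Vertex b, Vertex u} | a b u.
              a \<in> four_cycle j v \<and> b \<in> four_cycle j v \<and> u \<in> four_cycle j v - {a, b} \<and>
              h a = Max (h ` four_cycle j v) \<and> h b = Min (h ` four_cycle j v)})"

definition triangles :: "(vertex \<Rightarrow> int) \<Rightarrow> mesh_vertex set set" where
  "triangles h = (\<Union>j v. face_triangles h j v)"

definition mesh :: "(vertex \<Rightarrow> int) \<Rightarrow> mesh_vertex set" where
  "mesh h = \<Union> (triangles h)"

text \<open>The boundary of the star of \<open>p\<close> consists of the edges opposite to \<open>p\<close> in the triangles
  containing \<open>p\<close>; a sign change happens on the edges whose two ends lie on different sides of the
  height of \<open>p\<close>. No neighbor of \<open>p\<close> has the same height as \<open>p\<close>
  (\<open>mesh_height_neq\<close> below).\<close>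
definition sign_changes :: "(vertex \<Rightarrow> int) \<Rightarrow> mesh_vertex \<Rightarrow> nat" where
  "sign_changes h p = card {t \<in> triangles h. \<exists>u u'. t = {p, u, u'} \<and>
     mesh_height h u < mesh_height h p \<and> mesh_height h p < mesh_height h u'}"

text \<open>The number of sign changes is even, so the integer division is exact
  (\<open>morse_divisor_sign_changes\<close> below).\<close>
definition morse_divisor :: "(vertex \<Rightarrow> int) \<Rightarrow> mesh_vertex \<Rightarrow> int" where
  "morse_divisor h p = (if p \<in> mesh h then int (sign_changes h p) div 2 - 1 else 0)"


section \<open>The curve in projective 4-space and the position of the mesh\<close>

text \<open>Coordinate vectors are indexed by the type \<open>5\<close> as well; the coordinates of
  \<^term>\<open>vector [a, b, c, d, e] :: complex ^ 5\<close> have indices \<open>1, 2, 3, 4, 5\<close> in this order.\<close>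

lemma vector_5 [simp]:
  "(vector [a, b, c, d, e] :: 'a::zero ^ 5) $ 1 = a"
  "(vector [a, b, c, d, e] :: 'a ^ 5) $ 2 = b"
  "(vector [a, b, c, d, e] :: 'a ^ 5) $ 3 = c"
  "(vector [a, b, c, d, e] :: 'a ^ 5) $ 4 = d"
  "(vector [a, b, c, d, e] :: 'a ^ 5) $ 5 = e"
  "(vector [a, b, c, d, e] :: 'a ^ 5) $ 0 = e"
  by (simp_all add: vector_def)

definition proj_rel :: "complex ^ 5 \<Rightarrow> complex ^ 5 \<Rightarrow> bool" where
  "proj_rel x y \<longleftrightarrow> x \<noteq> 0 \<and> y \<noteq> 0 \<and> (\<exists>c. c \<noteq> 0 \<and> y = c *s x)"

quotient_type proj4 = "complex ^ 5" / partial: proj_rel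
proof (rule part_equivpI)
  have "(vector [1, 0, 0, 0, 0] :: complex ^ 5) \<noteq> 0"
    by (metis vector_5(1) zero_index zero_neq_one)
  moreover have "x = 1 *s x" for x :: "complex ^ 5" by simp
  ultimately show "\<exists>x. proj_rel x x" unfolding proj_rel_def by (metis zero_neq_one)
next
  show "symp proj_rel"
  proof (rule sympI)
    fix x y assume "proj_rel x y"
    then obtain c where c: "x \<noteq> 0" "y \<noteq> 0" "c \<noteq> 0" "y = c *s x" by (auto simp: proj_rel_def)
    hence "x = inverse c *s y" by (simp add: vector_smult_assoc)
    with c show "proj_rel y x" unfolding proj_rel_def by (metis inverse_nonzero_iff_nonzero)
  qed
next
  show "transp proj_rel"
  proof (rule transpI)
    fix x y z assume "proj_rel x y" "proj_rel y z"
    then obtain c d where "x \<noteq> 0" "z \<noteq> 0" "c \<noteq> 0" "d \<noteq> 0" "y = c *s x" "z = d *s y"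
      by (auto simp: proj_rel_def)
    hence "z = (d * c) *s x" "d * c \<noteq> 0" by (simp_all add: vector_smult_assoc)
    thus "proj_rel x z" using \<open>x \<noteq> 0\<close> \<open>z \<noteq> 0\<close> unfolding proj_rel_def by blast
  qed
qed

abbreviation proj :: "complex ^ 5 \<Rightarrow> proj4" where
  "proj \<equiv> abs_proj4"

definition gold :: real where
  "gold = (1 + sqrt 5) / 2"

abbreviation cgold :: complex where
  "cgold \<equiv> complex_of_real gold"

abbreviation csqrt_real :: "real \<Rightarrow> complex" where
  "csqrt_real r \<equiv> complex_of_real (sqrt r)"

definition zeta :: complex where
  "zeta = exp (2 * of_real pi * \<i> / 10)"

lift_definition X_alg :: "proj4 \<Rightarrow> bool" is
  "\<lambda>x. (x $ 1)\<^sup>2 + (x $ 2)\<^sup>2 + (x $ 3)\<^sup>2 = 0 \<and>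
       cgold * (x $ 1)\<^sup>2 + (x $ 2)\<^sup>2 + (x $ 4)\<^sup>2 = 0 \<and>
       (cgold + 1) * (x $ 1)\<^sup>2 + (x $ 2)\<^sup>2 + (x $ 5)\<^sup>2 = 0"
proof -
  fix x y :: "complex ^ 5" assume "proj_rel x y"
  then obtain c where c: "c \<noteq> 0" "y = c *s x" by (auto simp: proj_rel_def)
  have "a * (c * u)\<^sup>2 + (c * v)\<^sup>2 + (c * w)\<^sup>2 = c\<^sup>2 * (a * u\<^sup>2 + v\<^sup>2 + w\<^sup>2)" for a u v w :: complex
    by (simp add: algebra_simps power2_eq_square)
  from this[of 1] this c
  show "((x $ 1)\<^sup>2 + (x $ 2)\<^sup>2 + (x $ 3)\<^sup>2 = 0 \<and>
         cgold * (x $ 1)\<^sup>2 + (x $ 2)\<^sup>2 + (x $ 4)\<^sup>2 = 0 \<and>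
         (cgold + 1) * (x $ 1)\<^sup>2 + (x $ 2)\<^sup>2 + (x $ 5)\<^sup>2 = 0) =
        ((y $ 1)\<^sup>2 + (y $ 2)\<^sup>2 + (y $ 3)\<^sup>2 = 0 \<and>
         cgold * (y $ 1)\<^sup>2 + (y $ 2)\<^sup>2 + (y $ 4)\<^sup>2 = 0 \<and>
         (cgold + 1) * (y $ 1)\<^sup>2 + (y $ 2)\<^sup>2 + (y $ 5)\<^sup>2 = 0)"
    by simp
qed

text \<open>The sign \<open>sgn\<^sub>k(j)\<close>.\<close>
definition refl_sign :: "5 \<Rightarrow> color \<Rightarrow> complex" where
  "refl_sign k = (($) (
     if k = 1 then vector [ 1,  1,  1,  1,  1]
     else if k = 2 then vector [-1, -1, -1, -1,  1]
     else if k = 3 then vector [-1,  1,  1,  1, -1]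
     else if k = 4 then vector [-1, -1,  1,  1, -1]
     else vector [-1, -1, -1,  1, -1]))"

lemma refl_sign_square [simp]: "refl_sign k j * refl_sign k j = 1"
  using color_cases[of j] by (auto simp: refl_sign_def)

lemma cnj_refl_sign [simp]: "cnj (refl_sign k j) = refl_sign k j"
  using color_cases[of j] by (auto simp: refl_sign_def)

lift_definition reflect :: "color \<Rightarrow> proj4 \<Rightarrow> proj4" is
  "\<lambda>j x. \<chi> k. refl_sign k j * cnj (x $ k)"
proof -
  fix j and x y :: "complex ^ 5" assume "proj_rel x y"
  then obtain c where c: "x \<noteq> 0" "y \<noteq> 0" "c \<noteq> 0" "y = c *s x" by (auto simp: proj_rel_def)
  have nz: "(\<chi> k. refl_sign k j * cnj (z $ k)) \<noteq> 0" if "z \<noteq> 0" for z :: "complex ^ 5"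
  proof -
    have "refl_sign k j \<noteq> 0" for k using refl_sign_square[of k j] by force
    thus ?thesis using that by (auto simp: vec_eq_iff)
  qed
  have "(\<chi> k. refl_sign k j * cnj (y $ k)) = cnj c *s (\<chi> k. refl_sign k j * cnj (x $ k))"
    using c(4) by (simp add: vec_eq_iff)
  with nz c show "proj_rel (\<chi> k. refl_sign k j * cnj (x $ k)) (\<chi> k. refl_sign k j * cnj (y $ k))"
    unfolding proj_rel_def by (intro conjI exI[of _ "cnj c"]) simp_all
qed

definition top_position :: proj4 where
  "top_position = proj (vector
     [1, zeta ^ 2 * csqrt_real gold, zeta ^ 9, \<i> * zeta ^ 6, zeta ^ 8 * csqrt_real gold])"

text \<open>The position of the face center \<open>f\<^sub>j\<^sub>,\<^sub>j\<^sub>+\<^sub>1\<close> at the top vertex.\<close>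
definition top_center_position :: "color \<Rightarrow> proj4" where
  "top_center_position j = proj (
     if j = 5 then vector [1, 0, -\<i>, -\<i> * csqrt_real gold, -\<i> * csqrt_real (gold + 1)]
     else if j = 1 then vector [1, \<i>, 0, -\<i> * csqrt_real (gold - 1), -\<i> * csqrt_real gold]
     else if j = 2 then vector [1, \<i> * csqrt_real gold, csqrt_real (gold - 1), 0, -\<i>]
     else if j = 3 then vector [1, \<i> * csqrt_real (gold + 1), csqrt_real gold, 1, 0]
     else vector [0, 1, -\<i>, -\<i>, -\<i>])"

text \<open>Moving from the top vertex to \<open>v\<close>, one reflects once for each coordinate that is flipped. The
  order of the reflections is irrelevant, see \<open>position_nbr\<close> and \<open>position_face_center\<close> below.\<close>
definition transport :: "vertex \<Rightarrow> proj4 \<Rightarrow> proj4" where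
  "transport v = fold (\<lambda>j. if v j then id else reflect j) [1, 2, 3, 4, 5]"

fun position :: "mesh_vertex \<Rightarrow> proj4" where
  "position (Vertex v) = transport v top_position"
| "position (Center j w) = transport w (top_center_position j)"


section \<open>The elliptic curves and the maps to them\<close>

text \<open>The curve \<open>y\<^sup>2 = x (x - 1) (x - l)\<close> with the chord-tangent group law, written
  multiplicatively as usual in HOL-Algebra: multiples are powers \<open>[^]\<close>, sums are \<open>finprod\<close>.\<close>

datatype ec_point = Infinity | Affine complex complex

fun ec_add :: "complex \<Rightarrow> ec_point \<Rightarrow> ec_point \<Rightarrow> ec_point" where
  "ec_add l Infinity Q = Q"
| "ec_add l P Infinity = P"
| "ec_add l (Affine x y) (Affine x' y') =
     (if x = x' \<and> y = - y' then Infinity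
      else let m = (if x = x' then (3 * x\<^sup>2 - 2 * (1 + l) * x + l) / (2 * y)
                    else (y' - y) / (x' - x));
               x'' = m\<^sup>2 + (1 + l) - x - x'
           in Affine x'' (m * (x - x'') - y))"

definition ec_group :: "complex \<Rightarrow> ec_point monoid" where
  "ec_group l = \<lparr>carrier = insert Infinity {Affine x y | x y. y\<^sup>2 = x * (x - 1) * (x - l)},
     mult = ec_add l, one = Infinity\<rparr>"

definition ell_curve :: "5 \<Rightarrow> ec_point monoid" where
  "ell_curve k = ec_group (if k = 1 \<or> k = 4 then cgold + 1 else if k = 2 \<or> k = 5 then cgold else - cgold)"

definition nu_coords :: "5 \<Rightarrow> complex ^ 5 \<Rightarrow> ec_point" where
  "nu_coords k x =
     (if k = 1 then
        if x $ 5 = 0 then Infinity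
        else Affine (- (2 * cgold + 1) * ((x $ 1)\<^sup>2 / (x $ 5)\<^sup>2) - cgold)
                    ((2 * cgold + 1) * (x $ 2 * x $ 3 * x $ 4 / (x $ 5) ^ 3))
      else if k = 2 then
        if x $ 1 = 0 then Infinity
        else Affine ((x $ 2)\<^sup>2 / (x $ 1)\<^sup>2 + cgold + 1)
                    (\<i> * (x $ 3 * x $ 4 * x $ 5 / (x $ 1) ^ 3))
      else if k = 3 then
        if x $ 2 = 0 then Infinity
        else Affine ((2 * cgold + 1) * ((x $ 3)\<^sup>2 / (x $ 2)\<^sup>2) + cgold + 1)
                    (\<i> * (2 * cgold + 1) * (x $ 1 * x $ 4 * x $ 5 / (x $ 2) ^ 3))
      else if k = 4 then
        if x $ 3 = 0 then Infinity
        else Affine ((cgold + 1) * ((x $ 4)\<^sup>2 / (x $ 3)\<^sup>2) - cgold)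
                    (\<i> * cgold * (x $ 1 * x $ 2 * x $ 5 / (x $ 3) ^ 3))
      else
        if x $ 4 = 0 then Infinity
        else Affine (- ((x $ 5)\<^sup>2 / (x $ 4)\<^sup>2) + cgold + 1)
                    (\<i> * (x $ 1 * x $ 2 * x $ 3 / (x $ 4) ^ 3)))"

text \<open>Only the restriction of \<open>nu k\<close> to \<^const>\<open>X_alg\<close> is meaningful; there it takes values in
  \<open>ell_curve k\<close> (\<open>nu_in_E\<close> below).\<close>
lift_definition nu :: "5 \<Rightarrow> proj4 \<Rightarrow> ec_point" is nu_coords
proof -
  fix k and x y :: "complex ^ 5" assume "proj_rel x y"
  then obtain c where c: "c \<noteq> 0" "y = c *s x" by (auto simp: proj_rel_def)
  have *: "(c * u)\<^sup>2 / (c * v)\<^sup>2 = u\<^sup>2 / v\<^sup>2"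
    "c * u * (c * v) * (c * w) / (c * z) ^ 3 = u * v * w / z ^ 3" for u v w z
    using c(1) by (simp_all add: field_simps power2_eq_square power3_eq_cube)
  show "nu_coords k x = nu_coords k y"
    using c unfolding nu_coords_def by (simp add: *)
qed

definition nu_divisor :: "5 \<Rightarrow> (mesh_vertex \<Rightarrow> int) \<Rightarrow> ec_point" where
  "nu_divisor k D =
     (\<Otimes>\<^bsub>ell_curve k\<^esub>p\<in>{p. D p \<noteq> 0}. nu k (position p) [^]\<^bsub>ell_curve k\<^esub> D p)"

definition nu_height :: "5 \<Rightarrow> (vertex \<Rightarrow> int) \<Rightarrow> ec_point" where
  "nu_height k h = nu_divisor k (morse_divisor h)"


section \<open>The concrete form of the discrete Morse divisor\<close>

lemma adjacent_iff_nbr: "adjacent u v \<longleftrightarrow> (\<exists>j. u = nbr j v)"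
proof
  assume "adjacent u v"
  then obtain j where j: "{i. u i \<noteq> v i} = {j}"
    unfolding adjacent_def by (rule card_1_singletonE)
  have "u i = nbr j v i" for i
    using j by (cases "i = j") (auto simp: nbr_def)
  thus "\<exists>j. u = nbr j v" by blast
next
  assume "\<exists>j. u = nbr j v"
  then obtain j where j: "u = nbr j v" ..
  have "{i. u i \<noteq> v i} = {j}" unfolding j by (auto simp: nbr_def)
  thus "adjacent u v" by (simp add: adjacent_def)
qed

lemma nbr_nbr [simp]: "nbr j (nbr j v) = v"
  by (simp add: nbr_def)

lemma nbr_commute: "nbr i (nbr j v) = nbr j (nbr i v)"
  by (cases "i = j") (simp_all add: nbr_def fun_upd_twist)

lemma next_color [simp]: "j + 1 \<noteq> (j :: color)" "j \<noteq> j + 1"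
  by simp_all

lemma nbr_neq [simp]: "nbr j v \<noteq> v" "v \<noteq> nbr j v"
  by (metis fun_upd_same nbr_def)+

lemma nbr_eq_iff [simp]: "nbr i v = nbr j v \<longleftrightarrow> i = j"
  by (metis fun_upd_other fun_upd_same nbr_def)

lemma nbr_nbr_eq_iff [simp]: "nbr i (nbr j v) = v \<longleftrightarrow> i = j"
  by (metis nbr_eq_iff nbr_nbr)

lemma nbr_nbr_neq [simp]: "nbr i (nbr j v) \<noteq> nbr k v" "nbr k v \<noteq> nbr i (nbr j v)"
proof -
  show "nbr i (nbr j v) \<noteq> nbr k v"
  proof
  assume "nbr i (nbr j v) = nbr k v"
  from fun_cong[OF this, of i] fun_cong[OF this, of j] fun_cong[OF this, of k]
    show False by (auto simp: nbr_def split: if_splits)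
  qed
  thus "nbr k v \<noteq> nbr i (nbr j v)" by metis
qed

lemma four_cycle_nbr: "w \<in> four_cycle j v \<Longrightarrow> four_cycle j w = four_cycle j v"
  unfolding four_cycle_def by (auto simp: nbr_commute)

lemma face_center_nbr: "face_center j (nbr j v) = face_center j v"
  "face_center j (nbr (j + 1) v) = face_center j v"
  by (auto simp: face_center_def nbr_def fun_upd_twist)

lemma face_center_four_cycle: "w \<in> four_cycle j v \<Longrightarrow> face_center j w = face_center j v"
  unfolding four_cycle_def by (auto simp: face_center_nbr)

lemma face_triangles_nbr: "w \<in> four_cycle j v \<Longrightarrow> face_triangles h j w = face_triangles h j v"
  unfolding face_triangles_def bow_tie_def by (simp only: four_cycle_nbr face_center_four_cycle)

lemma adjacent_four_cycle:
  "adjacent v (nbr j v)" "adjacent v (nbr (j + 1) v)"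
  "adjacent (nbr j v) v" "adjacent (nbr (j + 1) v) v"
  "adjacent (nbr j v) (nbr j (nbr (j + 1) v))" "adjacent (nbr j (nbr (j + 1) v)) (nbr j v)"
  "adjacent (nbr (j + 1) v) (nbr j (nbr (j + 1) v))" "adjacent (nbr j (nbr (j + 1) v)) (nbr (j + 1) v)"
  "\<not> adjacent v (nbr j (nbr (j + 1) v))" "\<not> adjacent (nbr j (nbr (j + 1) v)) v"
  "\<not> adjacent (nbr j v) (nbr (j + 1) v)" "\<not> adjacent (nbr (j + 1) v) (nbr j v)"
  "\<not> adjacent u u"
proof -
  have sym: "adjacent a b \<longleftrightarrow> adjacent b a" for a b by (metis adjacent_iff_nbr nbr_nbr)
  show 1: "adjacent v (nbr j v)" "adjacent v (nbr (j + 1) v)"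
    "adjacent (nbr j v) (nbr j (nbr (j + 1) v))" "adjacent (nbr (j + 1) v) (nbr j (nbr (j + 1) v))"
    by (metis adjacent_iff_nbr nbr_nbr nbr_commute)+
  show 2: "\<not> adjacent (nbr j (nbr (j + 1) v)) v"
    unfolding adjacent_iff_nbr by simp
  show 3: "\<not> adjacent (nbr j v) (nbr (j + 1) v)"
    unfolding adjacent_iff_nbr by (metis nbr_nbr_neq)
  from 1 2 3 show "adjacent (nbr j v) v" "adjacent (nbr (j + 1) v) v"
    "adjacent (nbr j (nbr (j + 1) v)) (nbr j v)" "adjacent (nbr j (nbr (j + 1) v)) (nbr (j + 1) v)"
    "\<not> adjacent v (nbr j (nbr (j + 1) v))" "\<not> adjacent (nbr (j + 1) v) (nbr j v)"
    by (simp_all add: sym)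
  show "\<not> adjacent u u" by (simp add: adjacent_def)
qed

lemma height_four_cycle:
  assumes "height_function h"
  obtains "h (nbr j v) = h v + 1 \<or> h (nbr j v) = h v - 1"
    "h (nbr (j + 1) v) = h v + 1 \<or> h (nbr (j + 1) v) = h v - 1"
    "h (nbr j v) = h (nbr j (nbr (j + 1) v)) + 1 \<or> h (nbr j v) = h (nbr j (nbr (j + 1) v)) - 1"
    "h (nbr (j + 1) v) = h (nbr j (nbr (j + 1) v)) + 1 \<or>
     h (nbr (j + 1) v) = h (nbr j (nbr (j + 1) v)) - 1"
proof -
  have "adjacent a b \<Longrightarrow> h a = h b + 1 \<or> h a = h b - 1" for a b
    using assms unfolding height_function_def by (smt (verit))
  thus ?thesis using that adjacent_four_cycle by blast
qed

lemma height_values: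
  fixes a b c d :: int
  assumes "b = a + 1 \<or> b = a - 1" "c = a + 1 \<or> c = a - 1"
    "b = d + 1 \<or> b = d - 1" "c = d + 1 \<or> c = d - 1"
  shows "a = d \<and> b = c \<or> a = d \<and> b = a + 1 \<and> c = a - 1 \<or> a = d \<and> b = a - 1 \<and> c = a + 1 \<or>
    b = c \<and> a = b + 1 \<and> d = b - 1 \<or> b = c \<and> a = b - 1 \<and> d = b + 1"
  using assms by presburger

lemma bow_tie_iff:
  assumes "height_function h"
  shows "bow_tie h j v \<longleftrightarrow>
    h (nbr j (nbr (j + 1) v)) = h v \<and> h (nbr (j + 1) v) = h (nbr j v)"
proof (rule height_four_cycle[OF assms, of j v])
  define a b c d where abcd: "a = h v" "b = h (nbr j v)" "c = h (nbr (j + 1) v)"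
    "d = h (nbr j (nbr (j + 1) v))"
  assume *: "h (nbr j v) = h v + 1 \<or> h (nbr j v) = h v - 1"
    "h (nbr (j + 1) v) = h v + 1 \<or> h (nbr (j + 1) v) = h v - 1"
    "h (nbr j v) = h (nbr j (nbr (j + 1) v)) + 1 \<or> h (nbr j v) = h (nbr j (nbr (j + 1) v)) - 1"
    "h (nbr (j + 1) v) = h (nbr j (nbr (j + 1) v)) + 1 \<or>
     h (nbr (j + 1) v) = h (nbr j (nbr (j + 1) v)) - 1"
  have b: "b \<noteq> a" using *(1) unfolding abcd by linarith
  from height_values[OF *, folded abcd]
  have "card {a, b, c, d} = 2 \<longleftrightarrow> d = a \<and> c = b"
    using b by (elim disjE conjE) (simp_all add: card_insert_if)
  thus ?thesis by (simp add: bow_tie_def four_cycle_def flip: abcd)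
qed

lemma face_triangles_bow_tie:
  assumes "bow_tie h j v"
  shows "face_triangles h j v =
    {{face_center j v, Vertex v, Vertex (nbr j v)},
     {face_center j v, Vertex v, Vertex (nbr (j + 1) v)},
     {face_center j v, Vertex (nbr j (nbr (j + 1) v)), Vertex (nbr j v)},
     {face_center j v, Vertex (nbr j (nbr (j + 1) v)), Vertex (nbr (j + 1) v)}}" (is "_ = ?R")
proof -
  have *: "(\<exists>a\<in>{x, p, q, z}. \<exists>b\<in>{x, p, q, z}. A a b \<and> t = F a b) \<longleftrightarrow> t \<in> {F x p, F x q, F z p, F z q}"
    if "A x p" "A x q" "A p x" "A q x" "A p z" "A z p" "A q z" "A z q"
      "\<not> A x z" "\<not> A z x" "\<not> A p q" "\<not> A q p" "\<And>u. \<not> A u u"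
      "\<And>a b. F a b = F b a"
    for x p q z :: vertex and t :: "mesh_vertex set" and A F
    unfolding bex_simps using that(1-13) that(14)[of p x] that(14)[of q x] that(14)[of p z] that(14)[of q z]
    by simp blast
  have "t \<in> face_triangles h j v \<longleftrightarrow> t \<in> ?R" for t
  proof -
    have "t \<in> face_triangles h j v \<longleftrightarrow> (\<exists>a\<in>four_cycle j v. \<exists>b\<in>four_cycle j v.
        adjacent a b \<and> t = {face_center j v, Vertex a, Vertex b})"
      using assms unfolding face_triangles_def by auto
    also have "\<dots> \<longleftrightarrow> t \<in> ?R"
      unfolding four_cycle_def
      by (rule *) (assumption | rule adjacent_four_cycle | simp add: insert_commute)+
    finally show ?thesis .
  qed
  thus ?thesis by blast
qed

lemma face_triangles_diamond:
  assumes "height_function h" "\<not> bow_tie h j v"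
  shows "face_triangles h j v =
    (if h (nbr j v) = h (nbr (j + 1) v) then
      {{Vertex v, Vertex (nbr j (nbr (j + 1) v)), Vertex (nbr j v)},
       {Vertex v, Vertex (nbr j (nbr (j + 1) v)), Vertex (nbr (j + 1) v)}}
     else
      {{Vertex v, Vertex (nbr j v), Vertex (nbr (j + 1) v)},
       {Vertex (nbr j (nbr (j + 1) v)), Vertex (nbr j v), Vertex (nbr (j + 1) v)}})" (is "_ = ?R")
proof -
  define p q z where pqz: "p = nbr j v" "q = nbr (j + 1) v" "z = nbr j (nbr (j + 1) v)"
  have ne: "v \<noteq> p" "v \<noteq> q" "v \<noteq> z" "p \<noteq> q" "p \<noteq> z" "q \<noteq> z"
    unfolding pqz using nbr_nbr_eq_iff[of j "j+1" v] nbr_nbr_neq next_color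
    by (metis nbr_neq nbr_eq_iff)+
  note ne = ne ne[symmetric]
  define G where "G a b u = {Vertex a, Vertex b, Vertex u}" for a b u
  have G: "G a b u = G b a u" "G a b u = G a u b" for a b u unfolding G_def by blast+
  define m M where "m = Min (h ` {v, p, q, z})" "M = Max (h ` {v, p, q, z})"
  have eq: "t \<in> face_triangles h j v \<longleftrightarrow> (\<exists>a\<in>{v, p, q, z}. h a = M \<and>
        (\<exists>b\<in>{v, p, q, z}. h b = m \<and> (\<exists>u\<in>{v, p, q, z}. u \<noteq> a \<and> u \<noteq> b \<and> t = G a b u)))" for t
  proof -
    have "four_cycle j v = {v, p, q, z}" by (simp add: four_cycle_def pqz)
    hence "face_triangles h j v = {G a b u | a b u. a \<in> {v, p, q, z} \<and> b \<in> {v, p, q, z} \<and>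
        u \<in> {v, p, q, z} - {a, b} \<and> h a = M \<and> h b = m}"
      using assms(2) by (simp only: face_triangles_def G_def m_M_def if_False)
    moreover have "t \<in> {G a b u | a b u. a \<in> C \<and> b \<in> C \<and> u \<in> C - {a, b} \<and> h a = M \<and> h b = m} \<longleftrightarrow>
        (\<exists>a\<in>C. h a = M \<and> (\<exists>b\<in>C. h b = m \<and> (\<exists>u\<in>C. u \<noteq> a \<and> u \<noteq> b \<and> t = G a b u)))" for C
      by blast
    ultimately show ?thesis by (simp only:)
  qed
  have nbt: "\<not> (h z = h v \<and> h q = h p)"
    using assms(2) unfolding bow_tie_iff[OF assms(1)] pqz .
  have "(h v = h z \<and> h p = h q \<or> h v = h z \<and> h p = h v + 1 \<and> h q = h v - 1 \<or>
    h v = h z \<and> h p = h v - 1 \<and> h q = h v + 1 \<or>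
    h p = h q \<and> h v = h p + 1 \<and> h z = h p - 1 \<or> h p = h q \<and> h v = h p - 1 \<and> h z = h p + 1)"
    unfolding pqz by (rule height_four_cycle[OF assms(1), of j v], rule height_values)
  hence "t \<in> face_triangles h j v \<longleftrightarrow>
    t \<in> (if h p = h q then {G v z p, G v z q} else {G v p q, G z p q})" for t
  proof (elim disjE conjE)
    assume 1: "h v = h z" "h p = h v + 1" "h q = h v - 1"
    hence "M = h z + 1" "m = h z - 1" by (simp_all add: m_M_def)
    thus ?thesis unfolding eq using 1 ne G(1)[of q p] G(2)[of v p q] G(2)[of z p q]
      by (simp add: G)
  next
    assume 1: "h v = h z" "h p = h v - 1" "h q = h v + 1"
    hence "M = h z + 1" "m = h z - 1" by (simp_all add: m_M_def)
    thus ?thesis unfolding eq using 1 ne by (simp add: G)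
  next
    assume 1: "h p = h q" "h v = h p + 1" "h z = h p - 1"
    hence "M = h q + 1" "m = h q - 1" by (simp_all add: m_M_def)
    thus ?thesis unfolding eq using 1 ne by (simp add: G)
  next
    assume 1: "h p = h q" "h v = h p - 1" "h z = h p + 1"
    hence "M = h q + 1" "m = h q - 1" by (simp_all add: m_M_def)
    thus ?thesis unfolding eq using 1 ne by (simp add: G)
  qed (use nbt in simp)
  thus ?thesis unfolding G_def pqz by blast
qed

lemma face_center_eq_iff: "face_center j w = face_center j v \<longleftrightarrow> w \<in> four_cycle j v"
proof
  assume "face_center j w = face_center j v"
  hence *: "w(j := True, j + 1 := True) = v(j := True, j + 1 := True)"
    by (simp add: face_center_def)
  have off: "w i = v i" if "i \<noteq> j" "i \<noteq> j + 1" for i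
    using fun_cong[OF *, of i] that by simp
  define p where "p = (if w j = v j then id else nbr j) ((if w (j + 1) = v (j + 1) then id else nbr (j + 1)) v)"
  have "w i = p i" for i
    using off[of i] by (cases "i = j"; cases "i = j + 1") (auto simp: p_def nbr_def)
  hence "w = p" by blast
  moreover have "p \<in> four_cycle j v" by (simp add: p_def four_cycle_def)
  ultimately show "w \<in> four_cycle j v" by (simp only:)
qed (rule face_center_four_cycle)

lemma face_center_inj: "face_center i w = face_center j v \<Longrightarrow> i = j"
  by (simp add: face_center_def)

lemma face_center_neq [simp]: "face_center j v \<noteq> Vertex w" "Vertex w \<noteq> face_center j v"
  by (simp_all add: face_center_def)

lemma opposite_neq [simp]: "nbr j (nbr (j + 1) v) \<noteq> v" "v \<noteq> nbr j (nbr (j + 1) v)"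
  using nbr_nbr_eq_iff[of j "j + 1" v] next_color by metis+

lemma mesh_height_face_center:
  "mesh_height h (face_center j v) =
     (of_int (h v) + of_int (h (nbr j v)) + of_int (h (nbr (j + 1) v)) +
      of_int (h (nbr j (nbr (j + 1) v)))) / 4"
proof -
  have "v(j := True, j + 1 := True) \<in> four_cycle j v"
    by (simp add: face_center_def flip: face_center_eq_iff)
  from four_cycle_nbr[OF this]
  have "mesh_height h (face_center j v) = (\<Sum>u\<in>four_cycle j v. of_int (h u)) / 4"
    by (simp add: face_center_def)
  thus ?thesis
    by (simp add: four_cycle_def)
qed

lemma triangle_VertexE:
  assumes "t \<in> triangles h" "Vertex v \<in> t"
  obtains j where "t \<in> face_triangles h j v"
proof -
  from assms obtain j w where t: "t \<in> face_triangles h j w" by (auto simp: triangles_def)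
  have "v \<in> four_cycle j w"
    using t assms(2) unfolding face_triangles_def by (auto split: if_splits)
  from face_triangles_nbr[OF this] t that show ?thesis by metis
qed

lemma triangle_face_centerE:
  assumes "t \<in> triangles h" "face_center j v \<in> t"
  shows "bow_tie h j v" "t \<in> face_triangles h j v"
proof -
  from assms obtain i w where t: "t \<in> face_triangles h i w" by (auto simp: triangles_def)
  have "bow_tie h i w \<and> face_center j v = face_center i w"
    using t assms(2) unfolding face_triangles_def by (auto split: if_splits)
  hence 1: "bow_tie h i w" "face_center j v = face_center i w" by auto
  from face_center_inj[OF 1(2)] have ij: "i = j" by simp
  with 1(2) have v: "w \<in> four_cycle j v" by (simp flip: face_center_eq_iff)
  show "t \<in> face_triangles h j v" using face_triangles_nbr[OF v] t ij by metis
  show "bow_tie h j v" using 1(1) four_cycle_nbr[OF v] ij by (simp add: bow_tie_def)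
qed

lemma mesh_cases:
  assumes "p \<in> mesh h"
  obtains v where "p = Vertex v" | j v where "p = face_center j v" "bow_tie h j v"
proof -
  from assms obtain j w t where "t \<in> face_triangles h j w" "p \<in> t"
    by (auto simp: triangles_def mesh_def)
  thus ?thesis using that unfolding face_triangles_def by (auto split: if_splits)
qed

lemma mesh_height_neq:
  assumes "height_function h" "t \<in> triangles h" "p \<in> t" "u \<in> t" "p \<noteq> u"
  shows "mesh_height h p \<noteq> mesh_height h u"
proof -
  from assms(2) obtain j v where t: "t \<in> face_triangles h j v" by (auto simp: triangles_def)
  note H = mesh_height_face_center[of h j v]
  show ?thesis
  proof (rule height_four_cycle[OF assms(1), of j v])
    assume h: "h (nbr j v) = h v + 1 \<or> h (nbr j v) = h v - 1"
    "h (nbr (j + 1) v) = h v + 1 \<or> h (nbr (j + 1) v) = h v - 1"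
    "h (nbr j v) = h (nbr j (nbr (j + 1) v)) + 1 \<or> h (nbr j v) = h (nbr j (nbr (j + 1) v)) - 1"
    "h (nbr (j + 1) v) = h (nbr j (nbr (j + 1) v)) + 1 \<or>
     h (nbr (j + 1) v) = h (nbr j (nbr (j + 1) v)) - 1"
    define x a b z where d: "x = h v" "a = h (nbr j v)" "b = h (nbr (j + 1) v)" "z = h (nbr j (nbr (j + 1) v))"
    define X A B Z C where D: "X = Vertex v" "A = Vertex (nbr j v)" "B = Vertex (nbr (j + 1) v)"
      "Z = Vertex (nbr j (nbr (j + 1) v))" "C = face_center j v"
    have M: "mesh_height h X = x" "mesh_height h A = a" "mesh_height h B = b" "mesh_height h Z = z"
       "mesh_height h C = (x + a + b + z) / 4"
      by (simp_all add: d D H)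
    note h' = height_values[OF h, folded d]
    show ?thesis
    proof (cases "bow_tie h j v")
      case True
      hence "z = x" "b = a" by (simp_all add: d bow_tie_iff[OF assms(1)])
      moreover have "a \<noteq> x" using h(1) unfolding d by linarith
      moreover have "t \<in> {{C, X, A}, {C, X, B}, {C, Z, A}, {C, Z, B}}"
        using t face_triangles_bow_tie[OF True] unfolding D by simp
      ultimately show ?thesis using assms(3-5) M by auto
    next
      case False
      hence nb: "\<not> (z = x \<and> b = a)" by (simp add: d bow_tie_iff[OF assms(1)])
      have "t \<in> (if a = b then {{X, Z, A}, {X, Z, B}} else {{X, A, B}, {Z, A, B}})"
        using t face_triangles_diamond[OF assms(1) False] unfolding D d by simp
      thus ?thesis using assms(3-5) M nb h' by (auto split: if_splits)
    qed
  qed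
qed

lemma two_sided_iff:
  fixes H :: "'a \<Rightarrow> real"
  shows "(\<exists>u u'. {p, q, r} = {p, u, u'} \<and> H u < H p \<and> H p < H u') \<longleftrightarrow>
     H q < H p \<and> H p < H r \<or> H r < H p \<and> H p < H q"
  (is "?L \<longleftrightarrow> ?R")
proof
  assume ?L
  then obtain u u' where "{p, q, r} = {p, u, u'}" "H u < H p" "H p < H u'" by blast
  moreover from this have "u \<noteq> p" "u' \<noteq> p" "u \<noteq> u'" by auto
  ultimately have "q = u \<and> r = u' \<or> q = u' \<and> r = u" by blast
  with \<open>H u < H p\<close> \<open>H p < H u'\<close> show ?R by blast
next
  assume ?R
  thus ?L by (metis insert_commute)
qed

lemma sign_changes_Vertex:
  assumes "height_function h"
  shows "sign_changes h (Vertex v) = card {j. h (nbr j v) \<noteq> h (nbr (j + 1) v)}"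
proof -
  define T where "T j = {Vertex v, Vertex (nbr j v), Vertex (nbr (j + 1) v)}" for j
  define S where "S t \<longleftrightarrow> (\<exists>u u'. t = {Vertex v, u, u'} \<and>
     mesh_height h u < mesh_height h (Vertex v) \<and> mesh_height h (Vertex v) < mesh_height h u')" for t
  have S: "S {Vertex v, q, r} \<longleftrightarrow> mesh_height h q < h v \<and> h v < mesh_height h r \<or>
     mesh_height h r < h v \<and> h v < mesh_height h q" for q r
    unfolding S_def two_sided_iff by simp
  have inS: "Vertex v \<in> t" if "S t" for t using that unfolding S_def by blast
  have main: "t \<in> face_triangles h j v \<and> S t \<longleftrightarrow> t = T j \<and> h (nbr j v) \<noteq> h (nbr (j + 1) v)" for t j
  proof (rule height_four_cycle[OF assms, of j v])
    assume h: "h (nbr j v) = h v + 1 \<or> h (nbr j v) = h v - 1"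
    "h (nbr (j + 1) v) = h v + 1 \<or> h (nbr (j + 1) v) = h v - 1"
    "h (nbr j v) = h (nbr j (nbr (j + 1) v)) + 1 \<or> h (nbr j v) = h (nbr j (nbr (j + 1) v)) - 1"
    "h (nbr (j + 1) v) = h (nbr j (nbr (j + 1) v)) + 1 \<or>
     h (nbr (j + 1) v) = h (nbr j (nbr (j + 1) v)) - 1"
    define x a b z where d: "x = h v" "a = h (nbr j v)" "b = h (nbr (j + 1) v)" "z = h (nbr j (nbr (j + 1) v))"
    define X A B Z C where D: "X = Vertex v" "A = Vertex (nbr j v)" "B = Vertex (nbr (j + 1) v)"
      "Z = Vertex (nbr j (nbr (j + 1) v))" "C = face_center j v"
    have M: "mesh_height h A = a" "mesh_height h B = b" "mesh_height h Z = z"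
       "mesh_height h C = (x + a + b + z) / 4"
      by (simp_all add: d D mesh_height_face_center)
    have ne: "X \<noteq> A" "X \<noteq> B" "X \<noteq> Z" "X \<noteq> C"
      using nbr_neq opposite_neq by (simp_all add: D)
    note S = S[folded D d]
    note h' = height_values[OF h, folded d]
    show ?thesis
    proof (cases "bow_tie h j v")
      case True
      hence eq: "z = x" "b = a" by (simp_all add: d bow_tie_iff[OF assms(1)])
      have "face_triangles h j v = {{C, X, A}, {C, X, B}, {C, Z, A}, {C, Z, B}}"
        using face_triangles_bow_tie[OF True] unfolding D by simp
      moreover have "\<not> S {C, Z, A}" "\<not> S {C, Z, B}"
        using inS[folded D] ne by auto
      moreover have "\<not> S {C, X, A}" "\<not> S {C, X, B}"
        using S[of C A] S[of C B] eq M by (auto simp: insert_commute)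
      ultimately show ?thesis using eq by (auto simp: d)
    next
      case False
      hence nb: "\<not> (z = x \<and> b = a)" by (simp add: d bow_tie_iff[OF assms(1)])
      have eq: "face_triangles h j v = (if a = b then {{X, Z, A}, {X, Z, B}} else {{X, A, B}, {Z, A, B}})"
        using face_triangles_diamond[OF assms(1) False] unfolding D d by simp
      have "\<not> S {Z, A, B}" using inS[folded D] ne by auto
      moreover have "\<not> S {X, Z, A}" "\<not> S {X, Z, B}" if "a = b"
        using S[of Z A] S[of Z B] that h' nb by (auto simp: M)
      moreover have "S {X, A, B}" if "a \<noteq> b"
        using S[of A B] that h' nb by (auto simp: M)
      moreover have "T j = {X, A, B}" by (simp add: T_def D)
      ultimately show ?thesis using eq by (auto simp flip: d)
    qed
  qed
  have "{t \<in> triangles h. S t} = T ` {j. h (nbr j v) \<noteq> h (nbr (j + 1) v)}"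
  proof -
    have "t \<in> triangles h \<and> S t \<longleftrightarrow> (\<exists>j. t \<in> face_triangles h j v \<and> S t)" for t
      using inS triangle_VertexE unfolding triangles_def by (metis UN_iff UNIV_I triangles_def)
    thus ?thesis unfolding main by blast
  qed
  moreover have "inj T"
  proof (rule injI)
    fix i j assume "T i = T j"
    hence "Vertex ` {v, nbr i v, nbr (i + 1) v} = Vertex ` {v, nbr j v, nbr (j + 1) v}"
      by (simp add: T_def)
    hence "{v, nbr i v, nbr (i + 1) v} = {v, nbr j v, nbr (j + 1) v}"
      by (rule inj_image_eq_iff[THEN iffD1, rotated]) (simp add: inj_def)
    hence "nbr i v \<in> {nbr j v, nbr (j + 1) v}" "nbr (i + 1) v \<in> {nbr j v, nbr (j + 1) v}"
      by (metis insertI1 insertE insertI2 nbr_neq(1))+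
    hence "i = j \<or> i = j + 1 \<and> i + 1 = j" by auto
    moreover have "j + 1 + 1 \<noteq> j" by simp
    ultimately show "i = j" by blast
  qed
  ultimately show ?thesis
    unfolding sign_changes_def S_def by (simp add: card_image inj_on_subset)
qed

lemma sign_changes_face_center:
  assumes "height_function h" "bow_tie h j v"
  shows "sign_changes h (face_center j v) = 4"
proof -
  define X A B Z C where D: "X = Vertex v" "A = Vertex (nbr j v)" "B = Vertex (nbr (j + 1) v)"
    "Z = Vertex (nbr j (nbr (j + 1) v))" "C = face_center j v"
  define S where "S t \<longleftrightarrow> (\<exists>u u'. t = {C, u, u'} \<and>
     mesh_height h u < mesh_height h C \<and> mesh_height h C < mesh_height h u')" for t
  have tri: "face_triangles h j v = {{C, X, A}, {C, X, B}, {C, Z, A}, {C, Z, B}}"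
    using face_triangles_bow_tie[OF assms(2)] unfolding D by simp
  have eq: "mesh_height h Z = mesh_height h X" "mesh_height h A = mesh_height h B"
    using assms(2) by (simp_all add: D bow_tie_iff[OF assms(1)])
  hence C: "mesh_height h C = (mesh_height h X + mesh_height h A) / 2"
    by (simp add: D mesh_height_face_center)
  have "mesh_height h X \<noteq> mesh_height h A"
  proof (rule height_four_cycle[OF assms(1), of j v])
    assume "h (nbr j v) = h v + 1 \<or> h (nbr j v) = h v - 1"
    thus ?thesis unfolding D mesh_height.simps of_int_eq_iff by linarith
  qed
  hence S: "S t" if "t \<in> face_triangles h j v" for t
    using that eq C unfolding tri S_def
    by (elim insertE emptyE) (simp_all add: two_sided_iff, linarith+)
  have "{t \<in> triangles h. S t} = face_triangles h j v"
  proof -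
    have "C \<in> t" if "S t" for t using that unfolding S_def by blast
    hence "t \<in> face_triangles h j v" if "t \<in> triangles h" "S t" for t
      using triangle_face_centerE(2)[of t h j v] that unfolding D by blast
    thus ?thesis using S unfolding triangles_def by blast
  qed
  moreover have "card (face_triangles h j v) = 4"
  proof -
    have "distinct [X, A, B, Z, C]" by (simp add: D)
    hence "{C, X, A} \<noteq> {C, X, B}" "{C, X, A} \<noteq> {C, Z, A}" "{C, X, A} \<noteq> {C, Z, B}"
      "{C, X, B} \<noteq> {C, Z, A}" "{C, X, B} \<noteq> {C, Z, B}" "{C, Z, A} \<noteq> {C, Z, B}"
      unfolding distinct.simps set_simps by blast+
    thus ?thesis unfolding tri by simp
  qed
  ultimately show ?thesis unfolding sign_changes_def S_def D by simp
qed

lemma Vertex_in_mesh: "height_function h \<Longrightarrow> Vertex v \<in> mesh h"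
proof -
  assume h: "height_function h"
  have "\<exists>t \<in> face_triangles h 1 v. Vertex v \<in> t"
    using face_triangles_bow_tie[of h 1 v] face_triangles_diamond[OF h, of 1 v]
    by (cases "bow_tie h 1 v") auto
  thus ?thesis unfolding mesh_def triangles_def by blast
qed

lemma face_center_in_mesh_iff: "face_center j v \<in> mesh h \<longleftrightarrow> bow_tie h j v"
proof
  assume "face_center j v \<in> mesh h"
  thus "bow_tie h j v" using triangle_face_centerE(1) unfolding mesh_def by blast
next
  assume bt: "bow_tie h j v"
  show "face_center j v \<in> mesh h"
  proof -
    have "{face_center j v, Vertex v, Vertex (nbr j v)} \<in> face_triangles h j v"
      unfolding face_triangles_bow_tie[OF bt] by (rule insertI1)
    hence "{face_center j v, Vertex v, Vertex (nbr j v)} \<in> triangles h"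
      unfolding triangles_def by blast
    thus ?thesis unfolding mesh_def by (rule UnionI) (rule insertI1)
  qed
qed

lemma even_sign_changes:
  assumes "height_function h" "p \<in> mesh h"
  shows "even (sign_changes h p)"
  using assms(2)
proof (cases rule: mesh_cases)
  case (1 v)
  define P where "P j \<longleftrightarrow> h (nbr j v) = h v + 1" for j
  have "h (nbr j v) \<noteq> h (nbr (j + 1) v) \<longleftrightarrow> P j \<noteq> P (j + 1)" for j
    by (rule height_four_cycle[OF assms(1), of j v]) (unfold P_def, linarith)
  hence "sign_changes h p = card {j. P j \<noteq> P (j + 1)}"
    unfolding 1 sign_changes_Vertex[OF assms(1)] by simp
  also have "\<dots> = (\<Sum>j\<in>UNIV. of_bool (P j \<noteq> P (j + 1)))"
    by simp
  also have "\<dots> = of_bool (P 1 \<noteq> P 2) + of_bool (P 2 \<noteq> P 3) + of_bool (P 3 \<noteq> P 4) +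
     of_bool (P 4 \<noteq> P 5) + of_bool (P 5 \<noteq> P 1)"
  proof -
    have "sum f UNIV = f 1 + f 2 + f 3 + f 4 + f 5" for f :: "color \<Rightarrow> nat"
      unfolding UNIV_color by (simp add: add_ac)
    moreover have "(5 :: color) + 1 = 1" by simp
    ultimately show ?thesis by (simp only: one_add_one) simp
  qed
  finally show ?thesis
    by (cases "P 1"; cases "P 2"; cases "P 3"; cases "P 4"; cases "P 5") simp_all
next
  case (2 j v)
  thus ?thesis using sign_changes_face_center[OF assms(1)] by simp
qed

lemma morse_divisor_sign_changes:
  assumes "height_function h" "p \<in> mesh h"
  shows "of_int (morse_divisor h p) = real (sign_changes h p) / 2 - 1"
  using even_sign_changes[OF assms] assms(2) by (auto simp: morse_divisor_def elim!: evenE)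

lemma morse_divisor_Vertex:
  assumes "height_function h"
  shows "of_int (morse_divisor h (Vertex v)) =
    real (card {j. h (nbr j v) \<noteq> h (nbr (j + 1) v)}) / 2 - 1"
  using morse_divisor_sign_changes[OF assms Vertex_in_mesh[OF assms]]
  by (simp add: sign_changes_Vertex[OF assms])

lemma morse_divisor_face_center:
  assumes "height_function h"
  shows "morse_divisor h (face_center j v) = of_bool (bow_tie h j v)"
  by (simp add: morse_divisor_def face_center_in_mesh_iff sign_changes_face_center[OF assms])

lemma finite_morse_divisor_support: "finite {p. morse_divisor h p \<noteq> 0}"
proof (rule finite_subset)
  show "{p. morse_divisor h p \<noteq> 0} \<subseteq> range Vertex \<union> (\<Union>j. range (face_center j))"
  proof
    fix p assume "p \<in> {p. morse_divisor h p \<noteq> 0}"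
    hence "p \<in> mesh h" by (simp add: morse_divisor_def split: if_splits)
    thus "p \<in> range Vertex \<union> (\<Union>j. range (face_center j))"
      by (cases rule: mesh_cases) blast+
  qed
  show "finite (range Vertex \<union> (\<Union>j. range (face_center j)))"
    by simp
qed


section \<open>Consistency of the positions, and the target of the maps\<close>

lemma nz_vec1: "x $ i \<noteq> 0 \<Longrightarrow> x \<noteq> (0 :: complex ^ 5)"
  by auto

lemma proj_eqI:
  assumes "x \<noteq> 0" "c \<noteq> 0" "y = c *s x"
  shows "proj x = proj y"
proof -
  have "y \<noteq> 0" using assms by (simp add: vec_eq_iff)
  hence "proj_rel x y" using assms unfolding proj_rel_def by blast
  thus ?thesis by (simp add: quotient_def Quotient_rel_abs[OF Quotient_proj4])
qed

lemma proj_rel_refl [simp]: "proj_rel x x \<longleftrightarrow> x \<noteq> 0"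
  unfolding proj_rel_def by (auto intro!: exI[of _ 1])

lemma reflect_proj: "x \<noteq> 0 \<Longrightarrow> reflect j (proj x) = proj (\<chi> k. refl_sign k j * cnj (x $ k))"
  by (rule reflect.abs_eq) simp

lemma X_alg_proj: "x \<noteq> 0 \<Longrightarrow> X_alg (proj x) \<longleftrightarrow>
    (x $ 1)\<^sup>2 + (x $ 2)\<^sup>2 + (x $ 3)\<^sup>2 = 0 \<and>
    cgold * (x $ 1)\<^sup>2 + (x $ 2)\<^sup>2 + (x $ 4)\<^sup>2 = 0 \<and>
    (cgold + 1) * (x $ 1)\<^sup>2 + (x $ 2)\<^sup>2 + (x $ 5)\<^sup>2 = 0"
  by (rule X_alg.abs_eq) simp

lemma nu_proj: "x \<noteq> 0 \<Longrightarrow> nu k (proj x) = nu_coords k x"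
  by (rule nu.abs_eq) simp

lemma proj_cases:
  obtains x where "x \<noteq> 0" "p = proj x"
  by (metis Quotient_abs_rep Quotient_proj4 Quotient_rep_reflp proj_rel_refl)

lemma refl_sign_nonzero [simp]: "refl_sign k j \<noteq> 0"
  using refl_sign_square[of k j] by force

lemma reflect_vec_nonzero: "x \<noteq> 0 \<Longrightarrow> (\<chi> k. refl_sign k j * cnj (x $ k)) \<noteq> 0"
  by (auto simp: vec_eq_iff)

lemma reflect_reflect [simp]: "reflect j (reflect j p) = p"
proof (cases p rule: proj_cases)
  case (1 x)
  have "(\<chi> k. refl_sign k j * (refl_sign k j * x $ k)) = x"
    by (simp add: vec_eq_iff flip: mult.assoc)
  thus ?thesis using 1 by (simp add: reflect_proj reflect_vec_nonzero)
qed

lemma reflect_commute: "reflect i (reflect j p) = reflect j (reflect i p)"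
  by (cases p rule: proj_cases) (simp add: reflect_proj reflect_vec_nonzero mult.left_commute)

lemma X_alg_reflect [simp]: "X_alg (reflect j p) \<longleftrightarrow> X_alg p"
proof -
  have "X_alg (reflect j p)" if "X_alg p" for p
  proof (cases p rule: proj_cases)
    case (1 x)
    have sq: "(refl_sign k j * z)\<^sup>2 = z\<^sup>2" for k z
      by (simp add: power_mult_distrib) (simp add: power2_eq_square)
    from that 1 have *: "(x $ 1)\<^sup>2 + (x $ 2)\<^sup>2 + (x $ 3)\<^sup>2 = 0"
      "cgold * (x $ 1)\<^sup>2 + (x $ 2)\<^sup>2 + (x $ 4)\<^sup>2 = 0"
      "(cgold + 1) * (x $ 1)\<^sup>2 + (x $ 2)\<^sup>2 + (x $ 5)\<^sup>2 = 0" by (simp_all add: X_alg_proj)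
    from *[THEN arg_cong[of _ _ cnj]] show ?thesis
      using 1 by (simp add: reflect_proj X_alg_proj reflect_vec_nonzero sq)
  qed
  thus ?thesis by (metis reflect_reflect)
qed

lemma transport_nbr: "transport (nbr j v) p = reflect j (transport v p)"
  using color_cases[of j]
  by (elim disjE) (simp_all add: transport_def nbr_def reflect_commute)

lemma gold_square: "gold\<^sup>2 = gold + 1"
  by (simp add: gold_def power2_eq_square field_simps)

lemma gold_gt_1: "gold > 1"
  by (simp add: gold_def)

lemma cgold_square: "cgold\<^sup>2 = cgold + 1"
  by (metis gold_square of_real_1 of_real_add of_real_power)

lemma csqrt_real_square [simp]: "r \<ge> 0 \<Longrightarrow> (csqrt_real r)\<^sup>2 = complex_of_real r"
  by (metis of_real_power real_sqrt_pow2)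

lemma top_center_consistent:
  "reflect j (top_center_position j) = top_center_position j"
  "reflect (j + 1) (top_center_position j) = top_center_position j"
proof -
  have nz: "vector [1, a, b, c, d] \<noteq> (0 :: complex ^ 5)" "vector [0, 1, b, c, d] \<noteq> (0 :: complex ^ 5)" for a b c d
    using nz_vec1[of _ 1] nz_vec1[of _ 2] by (metis vector_5(1,2) zero_neq_one)+
  have *: "reflect i (proj x) = proj x" if "x \<noteq> 0" "c \<noteq> 0"
    "\<forall>k. x $ k = c * (refl_sign k i * cnj (x $ k))" for i x c
    unfolding reflect_proj[OF that(1)]
    by (rule proj_eqI[where c = c]) (use that reflect_vec_nonzero in \<open>auto simp: vec_eq_iff\<close>)
  note S = forall_color refl_sign_def top_center_position_def
  have six: "(6 :: 5) = 1" by simp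
  show "reflect j (top_center_position j) = top_center_position j"
  proof (cases "j = 4")
    case True
    show ?thesis unfolding True top_center_position_def
      by (simp, rule *[where c = "-1"]) (use nz in \<open>simp_all add: S\<close>)
  next
    case False
    with color_cases[of j] show ?thesis unfolding top_center_position_def
      by (elim disjE; simp; intro *[where c = 1]) (use nz in \<open>simp_all add: S\<close>)
  qed
  show "reflect (j + 1) (top_center_position j) = top_center_position j"
    using color_cases[of j] unfolding top_center_position_def
    by (elim disjE; simp add: six; intro *[where c = 1]) (use nz in \<open>simp_all add: S\<close>)
qed

lemma position_face_center_transport:
  "position (face_center j v) = transport v (top_center_position j)"
proof -
  have "transport (w(i := True)) q = transport w q" if "reflect i q = q" for i w q
  proof (cases "w i")
    case False
    hence "w(i := True) = nbr i w" by (simp add: nbr_def)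
    moreover have "reflect i (transport w q) = transport w (reflect i q)"
      by (simp add: transport_def reflect_commute[of i])
    ultimately show ?thesis using that by (simp add: transport_nbr)
  qed (simp add: fun_upd_idem)
  thus ?thesis by (simp add: face_center_def top_center_consistent)
qed

lemma position_nbr: "position (Vertex (nbr j v)) = reflect j (position (Vertex v))"
  by (simp add: transport_nbr)

lemma position_face_center:
  "position (face_center m (nbr j v)) = reflect j (position (face_center m v))"
  by (simp add: position_face_center_transport transport_nbr)

lemma position_top:
  "position (Vertex top_vertex) = top_position"
  "position (face_center j top_vertex) = top_center_position j"
  by (simp_all add: position_face_center_transport) (simp_all add: transport_def top_vertex_def)

lemma X_alg_transport: "X_alg (transport v p) \<longleftrightarrow> X_alg p"
  by (simp add: transport_def)

lemma zeta_power_5: "zeta ^ 5 = -1"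
proof -
  have "zeta ^ 5 = exp (of_real pi * \<i>)"
    unfolding zeta_def exp_of_nat_mult[symmetric] by (simp add: field_simps)
  thus ?thesis by (simp add: exp_pi_i)
qed

lemma zeta_cis: "zeta = cis (pi / 5)"
  by (simp add: zeta_def cis_conv_exp field_simps)

lemma zeta_cyclotomic: "zeta ^ 4 - zeta ^ 3 + zeta\<^sup>2 - zeta + 1 = 0"
proof -
  have "Im zeta > 0" unfolding zeta_cis using sin_gt_zero[of "pi / 5"] by simp
  hence "zeta + 1 \<noteq> 0" by (auto simp: complex_eq_iff)
  moreover have "(zeta + 1) * (zeta ^ 4 - zeta ^ 3 + zeta\<^sup>2 - zeta + 1) = zeta ^ 5 + 1"
    by (simp add: algebra_simps power_numeral_reduce)
  ultimately show ?thesis by (simp add: zeta_power_5)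
qed

lemma cgold_zeta: "cgold = zeta - zeta ^ 4"
proof -
  note cis = zeta_cis and c = zeta_cyclotomic
  have "zeta * (- (zeta ^ 4)) = 1" using zeta_power_5 by (simp add: power_numeral_reduce mult_ac)
  moreover have "zeta * cnj zeta = 1" by (simp add: cis cis_cnj cis_mult)
  ultimately have cnj: "- (zeta ^ 4) = cnj zeta" by (metis mult_cancel_left mult_zero_left zero_neq_one)
  define t where "t = zeta - zeta ^ 4"
  have "Re t > 0" using cos_gt_zero[of "pi / 5"] cnj by (simp add: t_def cis flip: add_uminus_conv_diff)
  moreover have "Im t = 0" using cnj by (simp add: t_def flip: add_uminus_conv_diff)
  ultimately obtain r where r: "t = complex_of_real r" "r > 0" by (metis complex_is_Real_iff Reals_cases Re_complex_of_real)
  have "t\<^sup>2 = t + 1" using c zeta_power_5 unfolding t_def by algebra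
  hence "r\<^sup>2 = r + 1" unfolding r by (metis of_real_1 of_real_add of_real_eq_iff of_real_power)
  hence "(r - gold) * (r + gold - 1) = 0" using gold_square by (simp add: algebra_simps power2_eq_square)
  hence "r = gold" using r(2) gold_gt_1 by auto
  thus ?thesis using r(1) by (simp add: t_def)
qed

lemma X_alg_top_position: "X_alg top_position"
proof -
  have nz: "vector [1, a, b, c, d] \<noteq> (0 :: complex ^ 5)" for a b c d
    using nz_vec1[of _ 1] by (metis vector_5(1) zero_neq_one)
  have g: "(csqrt_real gold)\<^sup>2 = zeta - zeta ^ 4"
    using gold_gt_1 cgold_zeta by simp
  have *: "1\<^sup>2 + (z ^ 2 * s)\<^sup>2 + (z ^ 9)\<^sup>2 = 0"
    "(z - z ^ 4) * 1\<^sup>2 + (z ^ 2 * s)\<^sup>2 + (\<i> * z ^ 6)\<^sup>2 = 0"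
    "(z - z ^ 4 + 1) * 1\<^sup>2 + (z ^ 2 * s)\<^sup>2 + (z ^ 8 * s)\<^sup>2 = 0"
    if z: "z ^ 5 = -1" and c: "z ^ 4 - z ^ 3 + z\<^sup>2 - z + 1 = 0" and s: "s\<^sup>2 = z - z ^ 4" for z s :: complex
  proof -
    have m: "z ^ 4 * z = z ^ 5" "z ^ 4 * z ^ 4 = z ^ 8" "z ^ 16 * z = z ^ 17" "z ^ 16 * z ^ 4 = z ^ 20"
      by (simp_all flip: power_add power_Suc2)
    have p: "z ^ (n + 5) = - (z ^ n)" for n by (simp add: power_add z)
    have q: "z ^ 8 = - (z ^ 3)" "z ^ 18 = - (z ^ 3)" "z ^ 12 = z\<^sup>2" "z ^ 17 = - (z\<^sup>2)" "z ^ 20 = 1"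
      using p[of 3] p[of 13] p[of 8] p[of 7] p[of 2] p[of 12] p[of 15] p[of 10] p[of 5] p[of 0] by simp_all
    have "1\<^sup>2 + (z ^ 2 * s)\<^sup>2 + (z ^ 9)\<^sup>2 = 1 + z ^ 4 * s\<^sup>2 + z ^ 18"
      by (simp add: power_mult_distrib flip: power_mult)
    also have "\<dots> = 1 + z ^ 5 - z ^ 8 + z ^ 18" by (simp add: s m right_diff_distrib)
    also have "\<dots> = 0" by (simp add: q z)
    finally show "1\<^sup>2 + (z ^ 2 * s)\<^sup>2 + (z ^ 9)\<^sup>2 = 0" .
    have "(z - z ^ 4) * 1\<^sup>2 + (z ^ 2 * s)\<^sup>2 + (\<i> * z ^ 6)\<^sup>2 = z - z ^ 4 + z ^ 4 * s\<^sup>2 - z ^ 12"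
      by (simp add: power_mult_distrib flip: power_mult)
    also have "\<dots> = z - z ^ 4 + z ^ 5 - z ^ 8 - z ^ 12" by (simp add: s m right_diff_distrib)
    also have "\<dots> = 0" unfolding q z using c by algebra
    finally show "(z - z ^ 4) * 1\<^sup>2 + (z ^ 2 * s)\<^sup>2 + (\<i> * z ^ 6)\<^sup>2 = 0" .
    have "(z - z ^ 4 + 1) * 1\<^sup>2 + (z ^ 2 * s)\<^sup>2 + (z ^ 8 * s)\<^sup>2 =
        z - z ^ 4 + 1 + z ^ 4 * s\<^sup>2 + z ^ 16 * s\<^sup>2"
      by (simp add: power_mult_distrib flip: power_mult)
    also have "\<dots> = z - z ^ 4 + 1 + z ^ 5 - z ^ 8 + z ^ 17 - z ^ 20" by (simp add: s m right_diff_distrib)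
    also have "\<dots> = 0" unfolding q z using c by algebra
    finally show "(z - z ^ 4 + 1) * 1\<^sup>2 + (z ^ 2 * s)\<^sup>2 + (z ^ 8 * s)\<^sup>2 = 0" .
  qed
  show ?thesis
    unfolding top_position_def X_alg_proj[OF nz] vector_5 cgold_zeta
    using *[OF zeta_power_5 zeta_cyclotomic g] by blast
qed

lemma X_alg_top_center_position: "X_alg (top_center_position j)"
proof -
  have nz: "vector [1, a, b, c, d] \<noteq> (0 :: complex ^ 5)" "vector [0, 1, b, c, d] \<noteq> (0 :: complex ^ 5)" for a b c d
    using nz_vec1[of _ 1] nz_vec1[of _ 2] by (metis vector_5(1,2) zero_neq_one)+
  show ?thesis
    using color_cases[of j] gold_gt_1 unfolding top_center_position_def
    by (elim disjE) (simp_all add: X_alg_proj nz power_mult_distrib algebra_simps)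
qed

lemma X_alg_position: "X_alg (position p)"
  by (cases p) (simp_all add: X_alg_transport X_alg_top_position X_alg_top_center_position)

lemma nu_in_E:
  assumes "X_alg p"
  shows "nu k p \<in> carrier (ell_curve k)"
proof (cases p rule: proj_cases)
  case (1 x)
  have "(x $ 1)\<^sup>2 + (x $ 2)\<^sup>2 + (x $ 3)\<^sup>2 = 0"
    "cgold * (x $ 1)\<^sup>2 + (x $ 2)\<^sup>2 + (x $ 4)\<^sup>2 = 0"
    "(cgold + 1) * (x $ 1)\<^sup>2 + (x $ 2)\<^sup>2 + (x $ 5)\<^sup>2 = 0"
    using assms 1 by (simp_all add: X_alg_proj)
  hence eqs: "(x $ 3)\<^sup>2 = - (x $ 1)\<^sup>2 - (x $ 2)\<^sup>2"
      "(x $ 4)\<^sup>2 = - cgold * (x $ 1)\<^sup>2 - (x $ 2)\<^sup>2"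
      "(x $ 5)\<^sup>2 = - (cgold + 1) * (x $ 1)\<^sup>2 - (x $ 2)\<^sup>2"
    by algebra+
  have curve: "Affine (X / d\<^sup>2) (c * (u * v * w / d ^ 3)) \<in> carrier (ec_group l)"
    if "d \<noteq> 0" "c\<^sup>2 * u\<^sup>2 * v\<^sup>2 * w\<^sup>2 = X * (X - d\<^sup>2) * (X - l * d\<^sup>2)" for X d c u v w l
  proof -
    have "(c * (u * v * w / d ^ 3))\<^sup>2 = c\<^sup>2 * u\<^sup>2 * v\<^sup>2 * w\<^sup>2 / (d\<^sup>2) ^ 3"
      by (simp add: power_mult_distrib power_divide mult.assoc flip: power_mult)
    also have "\<dots> = X / d\<^sup>2 * (X / d\<^sup>2 - 1) * (X / d\<^sup>2 - l)"
      unfolding that(2) using that(1) by (simp add: divide_simps power3_eq_cube)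
    finally show ?thesis by (simp add: ec_group_def)
  qed
  define A B C D F where ABC: "A = (x $ 1)\<^sup>2" "B = (x $ 2)\<^sup>2" "C = (x $ 3)\<^sup>2" "D = (x $ 4)\<^sup>2" "F = (x $ 5)\<^sup>2"
  note g = cgold_square
  note eqs = eqs[folded ABC]
  have i: "\<i>\<^sup>2 = -1" by simp
  have nu: "nu k p = nu_coords k x" using 1 by (simp add: nu_proj)
  have inf: "Infinity \<in> carrier (ell_curve k)" by (simp add: ell_curve_def ec_group_def)
  consider "k = 1" | "k = 2" | "k = 3" | "k = 4" | "k = 5" using color_cases[of k] by blast
  thus ?thesis
  proof cases
    case 1
    show ?thesis
    proof (cases "x $ 5 = 0")
      case False
      have "nu_coords 1 x = Affine ((- (2 * cgold + 1) * A - cgold * F) / (x $ 5)\<^sup>2)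
          ((2 * cgold + 1) * (x $ 2 * x $ 3 * x $ 4 / (x $ 5) ^ 3))"
        using False by (simp add: nu_coords_def ABC divide_simps) (simp add: algebra_simps)?
      also have "\<dots> \<in> carrier (ec_group (cgold + 1))"
        by (rule curve[OF False], fold ABC, use eqs g in algebra)
      finally show ?thesis by (simp add: nu[unfolded 1] 1 ell_curve_def)
    qed (use inf in \<open>simp add: nu[unfolded 1] nu_coords_def 1\<close>)
  next
    case 2
    show ?thesis
    proof (cases "x $ 1 = 0")
      case False
      have "nu_coords 2 x = Affine ((B + (cgold + 1) * A) / (x $ 1)\<^sup>2)
          (\<i> * (x $ 3 * x $ 4 * x $ 5 / (x $ 1) ^ 3))"
        using False by (simp add: nu_coords_def ABC divide_simps) (simp add: algebra_simps)?
      also have "\<dots> \<in> carrier (ec_group cgold)"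
        by (rule curve[OF False], fold ABC, use eqs g i in algebra)
      finally show ?thesis by (simp add: nu[unfolded 2] 2 ell_curve_def)
    qed (use inf in \<open>simp add: nu[unfolded 2] nu_coords_def 2\<close>)
  next
    case 3
    show ?thesis
    proof (cases "x $ 2 = 0")
      case False
      have "nu_coords 3 x = Affine (((2 * cgold + 1) * C + (cgold + 1) * B) / (x $ 2)\<^sup>2)
          ((\<i> * (2 * cgold + 1)) * (x $ 1 * x $ 4 * x $ 5 / (x $ 2) ^ 3))"
        using False by (simp add: nu_coords_def ABC divide_simps) (simp add: algebra_simps)?
      also have "\<dots> \<in> carrier (ec_group (- cgold))"
        by (rule curve[OF False], fold ABC, use eqs g i in algebra)
      finally show ?thesis by (simp add: nu[unfolded 3] 3 ell_curve_def)
    qed (use inf in \<open>simp add: nu[unfolded 3] nu_coords_def 3\<close>)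
  next
    case 4
    show ?thesis
    proof (cases "x $ 3 = 0")
      case False
      have "nu_coords 4 x = Affine (((cgold + 1) * D - cgold * C) / (x $ 3)\<^sup>2)
          ((\<i> * cgold) * (x $ 1 * x $ 2 * x $ 5 / (x $ 3) ^ 3))"
        using False by (simp add: nu_coords_def ABC divide_simps) (simp add: algebra_simps)?
      also have "\<dots> \<in> carrier (ec_group (cgold + 1))"
        by (rule curve[OF False], fold ABC, use eqs g i in algebra)
      finally show ?thesis by (simp add: nu[unfolded 4] 4 ell_curve_def)
    qed (use inf in \<open>simp add: nu[unfolded 4] nu_coords_def 4\<close>)
  next
    case 5
    show ?thesis
    proof (cases "x $ 4 = 0")
      case False
      have "nu_coords 5 x = Affine ((- F + (cgold + 1) * D) / (x $ 4)\<^sup>2)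
          (\<i> * (x $ 1 * x $ 2 * x $ 3 / (x $ 4) ^ 3))"
        using False by (simp add: nu_coords_def ABC divide_simps) (simp add: algebra_simps)?
      also have "\<dots> \<in> carrier (ec_group cgold)"
        by (rule curve[OF False], fold ABC, use eqs g i in algebra)
      finally show ?thesis by (simp add: nu[unfolded 5] 5 ell_curve_def)
    qed (use inf in \<open>simp add: nu[unfolded 5] nu_coords_def 5\<close>)
  qed
qed

end

theory Submission
  imports Defs "HOL-Computational_Algebra.Polynomial"
begin

text \<open>Lowering a local maximum \<open>v\<close> changes the Morse divisor by
  \<open>\<Sum>\<^sub>j s\<^sub>j (f\<^sub>j\<^sub>,\<^sub>j\<^sub>+\<^sub>1(v) - (v\<^sub>j + v\<^sub>j\<^sub>+\<^sub>1) / 2)\<close> with signs \<open>s\<^sub>j\<close> that record whether the face becomes a bow-tie.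
  On \<open>E\<^sub>k\<close> the points \<open>v\<^sub>j\<close> agree up to signs, which are opposite for \<open>v\<^sub>j\<close> and \<open>v\<^sub>j\<^sub>+\<^sub>1\<close> unless
  \<open>j = k + 3\<close>, and the face centers of the four colors \<open>j \<noteq> k + 3\<close> go to the four 2-torsion points,
  whose sum is 0. So only \<open>R(v) = f\<^sub>c\<^sub>,\<^sub>c\<^sub>+\<^sub>1(v) - v\<^sub>c\<close> with \<open>c = k + 3\<close> survives, with sign \<open>s\<^sub>c\<close>. It has
  real abscissa, hence complex conjugation maps it to plus or minus itself and all \<open>R(v)\<close> are
  \<open>\<plusminus>R(\<one>)\<close>. Consequently the image of the divisor of \<open>h\<close> is a multiple of \<open>R(\<one>)\<close>, where each of the
  eight faces of colors \<open>c, c + 1\<close> contributes 0 if it is a bow-tie, and \<open>1\<close> or \<open>-1\<close> if it is a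
  diamond. For \<open>h\<^sub>1\<close> the multiple is \<open>R(\<one>)\<close> itself.

  The group law on \<open>E\<^sub>k\<close> is associative because a point is determined by the class of its maximal
  ideal in the coordinate ring, and addition of points is multiplication of ideal classes.\<close>

section \<open>The group law\<close>

text \<open>Functions on the affine curve \<open>y\<^sup>2 = x (x - 1) (x - l)\<close> are pulled back to pairs of an abscissa
  and the choice of a square root.\<close>
type_synonym cfun = "complex \<times> bool \<Rightarrow> complex"

definition cubic :: "complex \<Rightarrow> complex \<Rightarrow> complex" where
  "cubic l x = x * (x - 1) * (x - l)"

definition yfun :: "complex \<Rightarrow> cfun" where
  "yfun l t = (if snd t then csqrt (cubic l (fst t)) else - csqrt (cubic l (fst t)))"

definition coord_ring :: "complex \<Rightarrow> cfun set" where
  "coord_ring l = {\<lambda>t. poly a (fst t) + poly b (fst t) * yfun l t | a b. True}"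


lemma yfun_square: "(yfun l t)\<^sup>2 = fst t * (fst t - 1) * (fst t - l)"
  by (simp add: yfun_def cubic_def)

lemma yfun_surj:
  assumes "y\<^sup>2 = x * (x - 1) * (x - l)"
  obtains t where "fst t = x" "yfun l t = y"
proof -
  have "(csqrt (cubic l x))\<^sup>2 = y\<^sup>2" by (simp add: assms cubic_def)
  hence "y = csqrt (cubic l x) \<or> y = - csqrt (cubic l x)" by (metis power2_eq_iff)
  thus ?thesis using that[of "(x, True)"] that[of "(x, False)"] by (auto simp: yfun_def)
qed

definition cubic_poly :: "complex \<Rightarrow> complex poly" where
  "cubic_poly l = [:0, 1:] * [:-1, 1:] * [:-l, 1:]"

lemma poly_cubic_poly: "poly (cubic_poly l) x = x * (x - 1) * (x - l)"
  by (simp add: cubic_poly_def algebra_simps)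

lemma coord_ringE:
  assumes "f \<in> coord_ring l"
  obtains a b where "f = (\<lambda>t. poly a (fst t) + poly b (fst t) * yfun l t)"
  using assms by (auto simp: coord_ring_def)

lemma coord_ring_add:
  assumes "f \<in> coord_ring l" "g \<in> coord_ring l"
  shows "(\<lambda>t. f t + g t) \<in> coord_ring l"
proof -
  from assms obtain a b c d where "f = (\<lambda>t. poly a (fst t) + poly b (fst t) * yfun l t)"
    "g = (\<lambda>t. poly c (fst t) + poly d (fst t) * yfun l t)" by (metis coord_ringE)
  hence "(\<lambda>t. f t + g t) = (\<lambda>t. poly (a + c) (fst t) + poly (b + d) (fst t) * yfun l t)"
    by (auto simp: algebra_simps)
  thus ?thesis unfolding coord_ring_def by blast
qed

lemma coord_ring_mult:
  assumes "f \<in> coord_ring l" "g \<in> coord_ring l"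
  shows "(\<lambda>t. f t * g t) \<in> coord_ring l"
proof -
  from assms obtain a b c d where fg: "f = (\<lambda>t. poly a (fst t) + poly b (fst t) * yfun l t)"
    "g = (\<lambda>t. poly c (fst t) + poly d (fst t) * yfun l t)" by (metis coord_ringE)
  have "f t * g t = poly (a * c + b * d * cubic_poly l) (fst t) + poly (a * d + b * c) (fst t) * yfun l t" for t
    using yfun_square[of l t] by (simp add: fg poly_cubic_poly power2_eq_square) algebra
  thus ?thesis unfolding coord_ring_def by blast
qed

lemma coord_ring_const: "(\<lambda>_. c) \<in> coord_ring l"
proof -
  have "(\<lambda>_. c) = (\<lambda>t. poly [:c:] (fst t) + poly 0 (fst t) * yfun l t)" by auto
  thus ?thesis unfolding coord_ring_def by blast
qed

lemma coord_ring_fst: "(\<lambda>t. fst t) \<in> coord_ring l"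
proof -
  have "(\<lambda>t. fst t) = (\<lambda>t. poly [:0, 1:] (fst t) + poly 0 (fst t) * yfun l t)" by auto
  thus ?thesis unfolding coord_ring_def by blast
qed

lemma coord_ring_yfun: "(\<lambda>t. yfun l t) \<in> coord_ring l"
proof -
  have "(\<lambda>t. yfun l t) = (\<lambda>t. poly 0 (fst t) + poly 1 (fst t) * yfun l t)" by auto
  thus ?thesis unfolding coord_ring_def by blast
qed

lemma coord_ring_diff:
  assumes "f \<in> coord_ring l" "g \<in> coord_ring l"
  shows "(\<lambda>t. f t - g t) \<in> coord_ring l"
  using coord_ring_add[OF assms(1) coord_ring_mult[OF coord_ring_const[of "-1"] assms(2)]] by simp

lemmas coord_ring_intros = coord_ring_const coord_ring_fst coord_ring_yfun coord_ring_add
  coord_ring_mult coord_ring_diff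

text \<open>The norm of \<open>a + b y\<close> is \<open>a\<^sup>2 - b\<^sup>2 g\<close> with \<open>g\<close> the cubic; its two terms have degrees of
  different parity, so they cannot cancel.\<close>
lemma norm_degree:
  fixes a b p :: "complex poly"
  assumes "degree p = 3" "b \<noteq> 0"
  shows "degree (a\<^sup>2 - b\<^sup>2 * p) \<ge> 3"
proof -
  have p: "p \<noteq> 0" using assms(1) by auto
  have b: "degree (b\<^sup>2 * p) = 2 * degree b + 3"
    using assms p by (simp add: degree_mult_eq degree_power_eq)
  show ?thesis
  proof (cases "a = 0")
    case True
    thus ?thesis using b by simp
  next
    case False
    hence a: "degree (a\<^sup>2) = 2 * degree a" by (simp add: degree_power_eq)
    hence "degree (a\<^sup>2) < degree (- (b\<^sup>2 * p)) \<or> degree (- (b\<^sup>2 * p)) < degree (a\<^sup>2)"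
      unfolding degree_minus a b by presburger
    hence "degree (a\<^sup>2 + - (b\<^sup>2 * p)) \<ge> degree (b\<^sup>2 * p)"
      using degree_add_eq_right[of "a\<^sup>2" "- (b\<^sup>2 * p)"] degree_add_eq_left[of "- (b\<^sup>2 * p)" "a\<^sup>2"]
      by auto
    thus ?thesis using b by simp
  qed
qed

lemma degree_cubic_poly: "degree (cubic_poly l) = 3"
  unfolding cubic_poly_def by (subst degree_mult_eq, simp, simp)+ simp

lemma yfun_conj: "fst (fst t, \<not> snd t) = fst t" "yfun l (fst t, \<not> snd t) = - yfun l t"
  by (simp_all add: yfun_def)

lemma coord_ring_unique:
  assumes "\<And>t. poly a (fst t) + poly b (fst t) * yfun l t = poly c (fst t) + poly d (fst t) * yfun l t"
  shows "a = c" "b = d"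
proof -
  have 1: "poly a (fst t) = poly c (fst t)" "(poly b (fst t) - poly d (fst t)) * yfun l t = 0" for t
    using assms[of t] assms[of "(fst t, \<not> snd t)"] unfolding yfun_conj by algebra+
  show "a = c" using 1(1)[of "(_, True)"] by (auto simp flip: poly_eq_poly_eq_iff)
  have "poly ((b - d)\<^sup>2 * cubic_poly l) x = 0" for x
    using 1(2)[of "(x, True)"] yfun_square[of l "(x, True)"] by (auto simp: poly_cubic_poly)
  hence "(b - d)\<^sup>2 * cubic_poly l = 0" by (metis poly_0 poly_eq_poly_eq_iff ext)
  thus "b = d" using degree_cubic_poly[of l] by auto
qed

lemma norm_mult:
  assumes "\<And>t. (poly a (fst t) + poly b (fst t) * yfun l t) * (poly c (fst t) + poly d (fst t) * yfun l t)
    = poly e (fst t)"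
  shows "(a\<^sup>2 - b\<^sup>2 * cubic_poly l) * (c\<^sup>2 - d\<^sup>2 * cubic_poly l) = e\<^sup>2"
proof -
  have *: "(A\<^sup>2 - B\<^sup>2 * G) * (C\<^sup>2 - D\<^sup>2 * G) = E\<^sup>2"
    if "(A + B * Y) * (C + D * Y) = E" "(A - B * Y) * (C - D * Y) = E" "Y\<^sup>2 = G" for A B C D E G Y :: complex
  proof -
    have "E\<^sup>2 = ((A + B * Y) * (C + D * Y)) * ((A - B * Y) * (C - D * Y))"
      using that by (simp add: power2_eq_square)
    thus ?thesis unfolding that(3)[symmetric] by algebra
  qed
  have "poly ((a\<^sup>2 - b\<^sup>2 * cubic_poly l) * (c\<^sup>2 - d\<^sup>2 * cubic_poly l)) x = poly (e\<^sup>2) x" for x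
    using *[OF _ _ yfun_square[of l "(x, True)", folded poly_cubic_poly]]
      assms[of "(x, True)"] assms[of "(x, False)"] yfun_conj(2)[of l "(x, True)"]
    by simp
  thus ?thesis by (metis poly_eq_poly_eq_iff ext)
qed

lemma coord_ring_domain:
  assumes "f \<in> coord_ring l" "g \<in> coord_ring l" "\<And>t. f t * g t = 0"
  shows "f = (\<lambda>_. 0) \<or> g = (\<lambda>_. 0)"
proof -
  from assms obtain a b c d where fg: "f = (\<lambda>t. poly a (fst t) + poly b (fst t) * yfun l t)"
    "g = (\<lambda>t. poly c (fst t) + poly d (fst t) * yfun l t)" by (metis coord_ringE)
  have "(a\<^sup>2 - b\<^sup>2 * cubic_poly l) * (c\<^sup>2 - d\<^sup>2 * cubic_poly l) = 0\<^sup>2"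
    by (rule norm_mult) (use assms(3) fg in simp)
  moreover have "a = 0 \<and> b = 0" if "a\<^sup>2 - b\<^sup>2 * cubic_poly l = 0" for a b
    using that norm_degree[OF degree_cubic_poly, of b a l] by (cases "b = 0") auto
  ultimately have "a = 0 \<and> b = 0 \<or> c = 0 \<and> d = 0" by auto
  thus ?thesis using fg by auto
qed

lemma coord_ring_cancel:
  assumes "f \<in> coord_ring l" "g \<in> coord_ring l" "h \<in> coord_ring l" "f \<noteq> (\<lambda>_. 0)"
    "\<And>t. f t * g t = f t * h t"
  shows "g = h"
proof -
  have "(\<lambda>t. g t - h t) = (\<lambda>_. 0)"
    using coord_ring_domain[OF assms(1) coord_ring_diff[OF assms(2,3)]] assms(4,5)
    by (auto simp: algebra_simps)
  hence "g t - h t = 0" for t by (rule fun_cong)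
  thus ?thesis by auto
qed

inductive_set ideal_gen :: "complex \<Rightarrow> cfun set \<Rightarrow> cfun set" for l A where
  zero: "(\<lambda>_. 0) \<in> ideal_gen l A"
| step: "r \<in> coord_ring l \<Longrightarrow> a \<in> A \<Longrightarrow> u \<in> ideal_gen l A \<Longrightarrow> (\<lambda>t. r t * a t + u t) \<in> ideal_gen l A"

lemma ideal_gen_add: "u \<in> ideal_gen l A \<Longrightarrow> v \<in> ideal_gen l A \<Longrightarrow> (\<lambda>t. u t + v t) \<in> ideal_gen l A"
proof (induction rule: ideal_gen.induct)
  case (step r a u)
  from ideal_gen.step[OF step(1,2) step.IH[OF step.prems]] show ?case by (simp add: add.assoc)
qed simp

lemma ideal_gen_mult: "u \<in> ideal_gen l A \<Longrightarrow> r \<in> coord_ring l \<Longrightarrow> (\<lambda>t. r t * u t) \<in> ideal_gen l A"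
proof (induction rule: ideal_gen.induct)
  case (step r' a u)
  from ideal_gen.step[OF coord_ring_mult[OF step.prems step(1)] step(2) step.IH[OF step.prems]]
  show ?case by (simp add: algebra_simps)
qed (simp add: ideal_gen.zero)

lemma ideal_gen_gen: "a \<in> A \<Longrightarrow> a \<in> ideal_gen l A"
  using ideal_gen.step[OF coord_ring_const[of 1] _ ideal_gen.zero] by simp

lemma ideal_gen_subset: "A \<subseteq> ideal_gen l B \<Longrightarrow> ideal_gen l A \<subseteq> ideal_gen l B"
proof
  fix u assume "u \<in> ideal_gen l A" "A \<subseteq> ideal_gen l B"
  thus "u \<in> ideal_gen l B"
  proof (induction rule: ideal_gen.induct)
    case (step r a u)
    hence "a \<in> ideal_gen l B" by blast
    with step show ?case by (intro ideal_gen_add ideal_gen_mult)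
  qed (rule ideal_gen.zero)
qed

lemma ideal_gen_eqI: "A \<subseteq> ideal_gen l B \<Longrightarrow> B \<subseteq> ideal_gen l A \<Longrightarrow> ideal_gen l A = ideal_gen l B"
  by (intro equalityI ideal_gen_subset)

definition set_mult :: "cfun set \<Rightarrow> cfun set \<Rightarrow> cfun set" where
  "set_mult A B = {\<lambda>t. a t * b t | a b. a \<in> A \<and> b \<in> B}"

lemma set_multI: "a \<in> A \<Longrightarrow> b \<in> B \<Longrightarrow> (\<lambda>t. a t * b t) \<in> set_mult A B"
  unfolding set_mult_def by blast

lemma set_multE:
  assumes "f \<in> set_mult A B"
  obtains a b where "a \<in> A" "b \<in> B" "f = (\<lambda>t. a t * b t)"
  using assms unfolding set_mult_def by blast

lemma set_mult_commute: "set_mult A B = set_mult B A"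
proof -
  have "set_mult A B \<subseteq> set_mult B A" for A B
  proof
    fix f assume "f \<in> set_mult A B"
    then obtain a b where ab: "a \<in> A" "b \<in> B" "f = (\<lambda>t. a t * b t)" by (rule set_multE)
    have "f = (\<lambda>t. b t * a t)" unfolding ab(3) by (simp only: mult.commute)
    thus "f \<in> set_mult B A" using set_multI[OF ab(2,1)] by simp
  qed
  thus ?thesis by blast
qed

lemma set_mult_assoc: "set_mult (set_mult A B) C = set_mult A (set_mult B C)"
proof -
  have "set_mult (set_mult A B) C \<subseteq> set_mult A (set_mult B C)" for A B C
  proof
    fix f assume "f \<in> set_mult (set_mult A B) C"
    then obtain a b c where abc: "a \<in> A" "b \<in> B" "c \<in> C" "f = (\<lambda>t. a t * b t * c t)"
      by (elim set_multE) simp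
    have "f = (\<lambda>t. a t * (b t * c t))" unfolding abc(4) by (simp only: mult.assoc)
    thus "f \<in> set_mult A (set_mult B C)" using set_multI[OF abc(1) set_multI[OF abc(2,3)]] by simp
  qed
  from this[of A B C] this[of C B A] show ?thesis by (simp add: set_mult_commute equalityI)
qed

lemma ideal_gen_set_mult_mono:
  assumes "ideal_gen l A \<subseteq> ideal_gen l A'"
  shows "ideal_gen l (set_mult A B) \<subseteq> ideal_gen l (set_mult A' B)"
proof (rule ideal_gen_subset, rule subsetI)
  fix f assume "f \<in> set_mult A B"
  then obtain a b where f: "f = (\<lambda>t. a t * b t)" "a \<in> A" "b \<in> B" by (rule set_multE)
  have "(\<lambda>t. u t * b t) \<in> ideal_gen l (set_mult A' B)" if "u \<in> ideal_gen l A'" for u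
    using that
  proof (induction rule: ideal_gen.induct)
    case (step r a u)
    have "(\<lambda>t. a t * b t) \<in> set_mult A' B" using step(2) f(3) by (rule set_multI)
    from ideal_gen.step[OF step(1) this step.IH] show ?case by (simp add: algebra_simps)
  qed (simp add: ideal_gen.zero)
  thus "f \<in> ideal_gen l (set_mult A' B)"
    using f assms ideal_gen_gen[of a A l] by auto
qed

lemma ideal_gen_set_mult_cong:
  "ideal_gen l A = ideal_gen l A' \<Longrightarrow> ideal_gen l (set_mult A B) = ideal_gen l (set_mult A' B)"
  by (simp add: ideal_gen_set_mult_mono equalityI)

text \<open>The ideals generated by \<open>A\<close> and \<open>B\<close> are in the same ideal class.\<close>
definition same_class :: "complex \<Rightarrow> cfun set \<Rightarrow> cfun set \<Rightarrow> bool" where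
  "same_class l A B \<longleftrightarrow> (\<exists>f g. f \<in> coord_ring l \<and> g \<in> coord_ring l \<and> f \<noteq> (\<lambda>_. 0) \<and> g \<noteq> (\<lambda>_. 0) \<and>
     ideal_gen l (set_mult {f} A) = ideal_gen l (set_mult {g} B))"

lemma same_class_refl: "same_class l A A"
proof -
  have "(\<lambda>_. 1) \<noteq> ((\<lambda>_. 0) :: cfun)" by (auto dest: fun_cong)
  thus ?thesis unfolding same_class_def by (blast intro: coord_ring_const)
qed

lemma same_class_sym: "same_class l A B \<Longrightarrow> same_class l B A"
  unfolding same_class_def by blast

lemma set_mult_singletons: "set_mult {f} (set_mult {g} A) = set_mult {\<lambda>t. f t * g t} A"
  unfolding set_mult_assoc[symmetric] by (simp add: set_mult_def)

lemma same_class_trans: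
  assumes "same_class l A B" "same_class l B C"
  shows "same_class l A C"
proof -
  from assms(1) obtain f g where fg: "f \<in> coord_ring l" "g \<in> coord_ring l"
    "f \<noteq> (\<lambda>_. 0)" "g \<noteq> (\<lambda>_. 0)"
    and eq1: "ideal_gen l (set_mult {f} A) = ideal_gen l (set_mult {g} B)"
    unfolding same_class_def by blast
  from assms(2) obtain f' g' where fg': "f' \<in> coord_ring l" "g' \<in> coord_ring l"
    "f' \<noteq> (\<lambda>_. 0)" "g' \<noteq> (\<lambda>_. 0)"
    and eq2: "ideal_gen l (set_mult {f'} B) = ideal_gen l (set_mult {g'} C)"
    unfolding same_class_def by blast
  have c: "set_mult (set_mult {u} A) {v} = set_mult {\<lambda>t. v t * u t} A" for u v A
    by (simp add: set_mult_singletons set_mult_commute[of _ "{v}"])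
  have "ideal_gen l (set_mult {\<lambda>t. f' t * f t} A) = ideal_gen l (set_mult {\<lambda>t. f' t * g t} B)"
    using ideal_gen_set_mult_cong[OF eq1, of "{f'}"] by (simp add: c)
  also have "\<dots> = ideal_gen l (set_mult {\<lambda>t. g t * g' t} C)"
    using ideal_gen_set_mult_cong[OF eq2, of "{g}"] by (simp add: c mult.commute)
  finally have "ideal_gen l (set_mult {\<lambda>t. f' t * f t} A) = ideal_gen l (set_mult {\<lambda>t. g t * g' t} C)" .
  moreover have "(\<lambda>t. u t * v t) \<noteq> (\<lambda>_. 0)"
    if "u \<in> coord_ring l" "v \<in> coord_ring l" "u \<noteq> (\<lambda>_. 0)" "v \<noteq> (\<lambda>_. 0)" for u v
  proof
    assume *: "(\<lambda>t. u t * v t) = (\<lambda>_. 0)"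
    have "u = (\<lambda>_. 0) \<or> v = (\<lambda>_. 0)"
      by (rule coord_ring_domain[OF that(1,2)]) (rule fun_cong[OF *])
    thus False using that(3,4) by blast
  qed
  ultimately show ?thesis
    unfolding same_class_def
    using coord_ring_mult[OF fg'(1) fg(1)] coord_ring_mult[OF fg(2) fg'(2)] fg fg'
    by (intro exI[of _ "\<lambda>t. f' t * f t"] exI[of _ "\<lambda>t. g t * g' t"]) simp
qed

lemma same_class_mult:
  assumes "same_class l A A'"
  shows "same_class l (set_mult A B) (set_mult A' B)"
proof -
  from assms obtain f g where fg: "f \<in> coord_ring l" "g \<in> coord_ring l" "f \<noteq> (\<lambda>_. 0)" "g \<noteq> (\<lambda>_. 0)"
    and eq: "ideal_gen l (set_mult {f} A) = ideal_gen l (set_mult {g} A')"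
    unfolding same_class_def by blast
  from ideal_gen_set_mult_cong[OF eq, of B] fg show ?thesis
    unfolding same_class_def set_mult_assoc by blast
qed

fun point_ideal :: "complex \<Rightarrow> ec_point \<Rightarrow> cfun set" where
  "point_ideal l Infinity = {\<lambda>_. 1}"
| "point_ideal l (Affine x y) = {\<lambda>t. fst t - x, \<lambda>t. yfun l t - y}"

fun ec_neg :: "ec_point \<Rightarrow> ec_point" where
  "ec_neg Infinity = Infinity"
| "ec_neg (Affine x y) = Affine x (- y)"

lemma set_mult_one [simp]: "set_mult {\<lambda>_. 1} A = A" "set_mult A {\<lambda>_. 1} = A"
  by (simp_all add: set_mult_def)

lemma fst_minus_nonzero: "(\<lambda>t::complex \<times> bool. fst t - x) \<noteq> (\<lambda>_. 0)"
proof
  assume "(\<lambda>t::complex \<times> bool. fst t - x) = (\<lambda>_. 0)"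
  from fun_cong[OF this, of "(x + 1, True)"] show False by simp
qed

text \<open>A generator \<open>f\<close> of the maximal ideal of an affine point would have norm of degree 1.\<close>
lemma point_ideal_not_principal:
  assumes "y\<^sup>2 = x * (x - 1) * (x - l)"
  shows "\<not> same_class l (point_ideal l (Affine x y)) {\<lambda>_. 1}"
proof
  define A where "A = {\<lambda>t. fst t - x, \<lambda>t. yfun l t - y}"
  assume "same_class l (point_ideal l (Affine x y)) {\<lambda>_. 1}"
  then obtain f g where fg: "f \<in> coord_ring l" "g \<in> coord_ring l" "f \<noteq> (\<lambda>_. 0)" "g \<noteq> (\<lambda>_. 0)"
    and eq: "ideal_gen l (set_mult {f} A) = ideal_gen l {g}"
    unfolding same_class_def by (auto simp: A_def)
  obtain t0 where t0: "fst t0 = x" "yfun l t0 = y" using yfun_surj[OF assms] .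
  have "\<exists>k. k \<in> coord_ring l \<and> k t0 = 0 \<and> u = (\<lambda>t. f t * k t)" if "u \<in> ideal_gen l (set_mult {f} A)" for u
    using that
  proof (induction rule: ideal_gen.induct)
    case (step r a u)
    from step(2) obtain b where b: "b \<in> A" "a = (\<lambda>t. f t * b t)" by (auto simp: set_mult_def)
    from step.IH obtain k where k: "k \<in> coord_ring l" "k t0 = 0" "u = (\<lambda>t. f t * k t)" by blast
    have "b \<in> coord_ring l" "b t0 = 0" using b(1) t0 by (auto simp: A_def intro: coord_ring_intros)
    thus ?case using k b step(1)
      by (intro exI[of _ "\<lambda>t. r t * b t + k t"]) (auto simp: algebra_simps intro: coord_ring_intros)
  qed (auto intro!: exI[of _ "\<lambda>_. 0"] coord_ring_const)
  from this[unfolded eq, OF ideal_gen_gen] obtain k where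
    k: "k \<in> coord_ring l" "k t0 = 0" "g = (\<lambda>t. f t * k t)" by auto
  have multiple: "\<exists>r. r \<in> coord_ring l \<and> u = (\<lambda>t. g t * r t)" if "u \<in> ideal_gen l {g}" for u
    using that
  proof (induction rule: ideal_gen.induct)
    case (step r a u)
    then obtain k where "k \<in> coord_ring l" "u = (\<lambda>t. g t * k t)" by blast
    thus ?case using step(1,2)
      by (intro exI[of _ "\<lambda>t. r t + k t"]) (auto simp: algebra_simps intro: coord_ring_intros)
  qed (auto intro!: exI[of _ "\<lambda>_. 0"] coord_ring_const)
  have div: "\<exists>r. r \<in> coord_ring l \<and> b = (\<lambda>t. k t * r t)" if "b \<in> A" for b
  proof -
    have b: "b \<in> coord_ring l" using that by (auto simp: A_def intro: coord_ring_intros)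
    have "(\<lambda>t. f t * b t) \<in> ideal_gen l (set_mult {f} A)"
      by (rule ideal_gen_gen) (use that in \<open>auto simp: set_mult_def\<close>)
    from multiple[OF this[unfolded eq]] obtain r where
      r: "r \<in> coord_ring l" "(\<lambda>t. f t * b t) = (\<lambda>t. g t * r t)" by blast
    hence "f t * b t = f t * (k t * r t)" for t using fun_cong[OF r(2), of t] by (simp add: k(3) mult.assoc)
    thus ?thesis using coord_ring_cancel[OF fg(1) b coord_ring_mult[OF k(1) r(1)] fg(3)] r(1) by auto
  qed
  obtain a b where ab: "k = (\<lambda>t. poly a (fst t) + poly b (fst t) * yfun l t)"
    using k(1) by (rule coord_ringE)
  obtain r where r: "r \<in> coord_ring l" "(\<lambda>t. fst t - x) = (\<lambda>t. k t * r t)"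
    using div by (auto simp: A_def)
  obtain c d where cd: "r = (\<lambda>t. poly c (fst t) + poly d (fst t) * yfun l t)"
    using r(1) by (rule coord_ringE)
  have norm: "(a\<^sup>2 - b\<^sup>2 * cubic_poly l) * (c\<^sup>2 - d\<^sup>2 * cubic_poly l) = [:-x, 1:]\<^sup>2"
    by (rule norm_mult) (use fun_cong[OF r(2)] ab cd in simp)
  have b0: "b = 0"
  proof (rule ccontr)
    assume "b \<noteq> 0"
    from norm_degree[OF degree_cubic_poly this, of a l]
    have "degree (a\<^sup>2 - b\<^sup>2 * cubic_poly l) \<ge> 3" .
    moreover have "[:-x, 1:]\<^sup>2 \<noteq> 0" by simp
    hence "degree (a\<^sup>2 - b\<^sup>2 * cubic_poly l) + degree (c\<^sup>2 - d\<^sup>2 * cubic_poly l) = degree ([:-x, 1:]\<^sup>2)"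
      unfolding norm[symmetric] by (subst degree_mult_eq) auto
    moreover have "degree ([:-x, 1:]\<^sup>2) = 2" by (simp add: degree_power_eq)
    ultimately show False by linarith
  qed
  obtain s where s: "s \<in> coord_ring l" "(\<lambda>t. yfun l t - y) = (\<lambda>t. k t * s t)"
    using div by (auto simp: A_def)
  obtain p q where pq: "s = (\<lambda>t. poly p (fst t) + poly q (fst t) * yfun l t)"
    using s(1) by (rule coord_ringE)
  have "1 = a * q"
  proof (rule coord_ring_unique(2))
    fix t
    show "poly [:-y:] (fst t) + poly 1 (fst t) * yfun l t =
      poly (a * p) (fst t) + poly (a * q) (fst t) * yfun l t"
      using fun_cong[OF s(2), of t] by (simp add: ab b0 pq algebra_simps)
  qed
  moreover have "poly a x = 0" using k(2) by (simp add: ab b0 t0)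
  ultimately show False by (metis mult_zero_left poly_1 poly_mult zero_neq_one)
qed
lemma div_lin:
  fixes r s u v c d :: complex
  assumes "s * r = c * u + d * v" "s \<noteq> 0"
  shows "r = 1 / s * c * u + 1 / s * d * v"
  using assms by (simp add: field_simps)

lemma ideal_gen_lin:
  assumes "a \<in> ideal_gen l A" "b \<in> ideal_gen l A" "r \<in> coord_ring l" "s \<in> coord_ring l"
    "\<And>t. u t = r t * a t + s t * b t"
  shows "u \<in> ideal_gen l A"
proof -
  have "u = (\<lambda>t. r t * a t + s t * b t)" using assms(5) by (rule ext)
  thus ?thesis using assms(1-4) by (simp add: ideal_gen_add ideal_gen_mult)
qed

lemma ideal_gen_principal:
  assumes "r \<in> coord_ring l" "\<And>t. u t = r t * a t"
  shows "u \<in> ideal_gen l {a}"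
  by (rule ideal_gen_lin[of a _ _ a r "\<lambda>_. 0"]) (use assms in \<open>simp_all add: ideal_gen_gen coord_ring_const\<close>)

lemma set_mult_pairs:
  "set_mult {a, b} {c, d} = {\<lambda>t. a t * c t, \<lambda>t. a t * d t, \<lambda>t. b t * c t, \<lambda>t. b t * d t}"
  unfolding set_mult_def by blast

lemma set_mult_singleton: "set_mult {f} A = (\<lambda>a t. f t * a t) ` A"
  unfolding set_mult_def by blast

lemma point_ideal_neg:
  assumes "y\<^sup>2 = x * (x - 1) * (x - l)" "l \<noteq> 0" "l \<noteq> 1"
  shows "same_class l (set_mult (point_ideal l (Affine x y)) (point_ideal l (Affine x (- y)))) {\<lambda>_. 1}"
proof -
  define a b c d where abcd: "a = (\<lambda>t::complex \<times> bool. (fst t - x) * (fst t - x))" "b = (\<lambda>t. (fst t - x) * (yfun l t - - y))"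
    "c = (\<lambda>t. (yfun l t - y) * (fst t - x))" "d = (\<lambda>t. (yfun l t - y) * (yfun l t - - y))"
  define g where "g = (\<lambda>t::complex \<times> bool. fst t - x)"
  define q where "q X = X\<^sup>2 + X * x + x\<^sup>2 - (1 + l) * (X + x) + l" for X
  have S: "set_mult (point_ideal l (Affine x y)) (point_ideal l (Affine x (- y))) = {a, b, c, d}"
    by (simp add: set_mult_pairs abcd)
  have d: "d t = (fst t - x) * q (fst t)" for t
    using assms(1) yfun_square[of l t] unfolding abcd q_def by algebra
  have "{a, b, c, d} \<subseteq> ideal_gen l {g}"
    unfolding insert_subset
  proof (intro conjI empty_subsetI)
    show "a \<in> ideal_gen l {g}" by (rule ideal_gen_principal[of "\<lambda>t. fst t - x"])
        (simp_all add: abcd g_def coord_ring_intros)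
    show "b \<in> ideal_gen l {g}" by (rule ideal_gen_principal[of "\<lambda>t. yfun l t - - y"])
        (simp_all add: abcd g_def, intro coord_ring_intros)
    show "c \<in> ideal_gen l {g}" by (rule ideal_gen_principal[of "\<lambda>t. yfun l t - y"])
        (simp_all add: abcd g_def, intro coord_ring_intros)
    have "(\<lambda>t. q (fst t)) \<in> coord_ring l"
      unfolding q_def power2_eq_square by (intro coord_ring_intros)
    thus "d \<in> ideal_gen l {g}" by (rule ideal_gen_principal) (simp add: d g_def)
  qed
  moreover have "g \<in> ideal_gen l {a, b, c, d}"
  proof (cases "y = 0")
    case False
    show ?thesis
      by (rule ideal_gen_lin[of b _ _ c "\<lambda>_. 1 / (2 * y)" "\<lambda>_. 1 / (2 * y) * (-1)"])
        (use False in \<open>simp_all add: ideal_gen_gen coord_ring_const\<close>, simp add: abcd g_def field_simps)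
  next
    case True
    have "x = 0 \<or> x = 1 \<or> x = l" using assms(1) True by simp
    moreover have "x = 0 \<Longrightarrow> q x = l" "x = 1 \<Longrightarrow> q x = 1 - l" "x = l \<Longrightarrow> q x = l * (l - 1)"
      by (simp_all add: q_def algebra_simps power2_eq_square)
    ultimately have c: "q x \<noteq> 0" using assms(2,3) by auto
    have *: "(X - x) * q x = (X - x) * q X - (X + 2 * x - (1 + l)) * ((X - x) * (X - x))" for X
      unfolding q_def by algebra
    show ?thesis
    proof (rule ideal_gen_lin[of d _ _ a "\<lambda>_. 1 / q x * 1" "\<lambda>t. 1 / q x * (1 + l - 2 * x - fst t)"])
      have "q x * g t = 1 * d t + (1 + l - 2 * x - fst t) * a t" for t
        using *[of "fst t"] unfolding d g_def abcd(1) by (simp add: algebra_simps)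
      thus "g t = 1 / q x * 1 * d t + 1 / q x * (1 + l - 2 * x - fst t) * a t" for t
        using c by (rule div_lin)
    qed (intro coord_ring_intros | rule ideal_gen_gen, simp)+
  qed
  ultimately have "ideal_gen l {a, b, c, d} = ideal_gen l {g}" by (intro ideal_gen_eqI) auto
  moreover have "g \<in> coord_ring l" unfolding g_def by (intro coord_ring_intros)
  moreover have "g \<noteq> (\<lambda>_. 0)" unfolding g_def by (rule fst_minus_nonzero)
  moreover have "(\<lambda>_. 1) \<noteq> ((\<lambda>_. 0) :: cfun)" by (auto dest: fun_cong)
  ultimately show ?thesis
    unfolding S same_class_def
    by (intro exI[of _ "\<lambda>_. 1"] exI[of _ g]) (simp add: coord_ring_const)
qed

lemma point_ideal_chord:
  assumes m: "y' - y = m * (x' - x)"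
    and id: "\<And>X. X * (X - 1) * (X - l) - (y + m * (X - x))\<^sup>2 = (X - x) * (X - x') * (X - z)"
    and ne: "x \<noteq> x' \<or> y = y' \<and> y \<noteq> 0"
  shows "same_class l (set_mult (point_ideal l (Affine x y)) (point_ideal l (Affine x' y')))
    (point_ideal l (Affine z (m * (x - z) - y)))"
proof -
  define L where "L t = yfun l t - y - m * (fst t - x)" for t
  define w where "w = m * (x - z) - y"
  define a b c d where abcd: "a = (\<lambda>t::complex \<times> bool. (fst t - z) * ((fst t - x) * (fst t - x')))"
    "b = (\<lambda>t. (fst t - z) * ((fst t - x) * (yfun l t - y')))"
    "c = (\<lambda>t. (fst t - z) * ((yfun l t - y) * (fst t - x')))"
    "d = (\<lambda>t. (fst t - z) * ((yfun l t - y) * (yfun l t - y')))"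
  define e f where ef: "e = (\<lambda>t. L t * (fst t - z))" "f = (\<lambda>t. L t * (yfun l t - w))"
  have S: "set_mult {\<lambda>t. fst t - z} (set_mult (point_ideal l (Affine x y)) (point_ideal l (Affine x' y'))) = {a, b, c, d}"
    by (simp add: set_mult_pairs abcd set_mult_singleton)
  have T: "set_mult {L} (point_ideal l (Affine z w)) = {e, f}"
    by (simp add: set_mult_singleton ef)
  have LL: "(yfun l t - y - m * (fst t - x)) * (yfun l t + y + m * (fst t - x)) = (fst t - x) * (fst t - x') * (fst t - z)" for t
    using id[of "fst t"] yfun_square[of l t] by algebra
  have L: "L \<in> coord_ring l" unfolding L_def by (intro coord_ring_intros)
  have "{a, b, c, d} \<subseteq> ideal_gen l {e, f}"
    unfolding insert_subset
  proof (intro conjI empty_subsetI)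
    show "a \<in> ideal_gen l {e, f}"
    proof (rule ideal_gen_lin[of f _ _ e "\<lambda>_. 1" "\<lambda>_. m"])
      show "a t = 1 * f t + m * e t" for t
        using LL[of t] unfolding abcd ef L_def w_def by algebra
    qed (intro coord_ring_intros | rule ideal_gen_gen, simp)+
    show "b \<in> ideal_gen l {e, f}"
    proof (rule ideal_gen_lin[of f _ _ e "\<lambda>_. m" "\<lambda>t. fst t - x + m * m"])
      show "b t = m * f t + (fst t - x + m * m) * e t" for t
        using LL[of t] m unfolding abcd ef L_def w_def by algebra
    qed (intro coord_ring_intros | rule ideal_gen_gen, simp)+
    show "c \<in> ideal_gen l {e, f}"
    proof (rule ideal_gen_lin[of f _ _ e "\<lambda>_. m" "\<lambda>t. fst t - x' + m * m"])
      show "c t = m * f t + (fst t - x' + m * m) * e t" for t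
        using LL[of t] m unfolding abcd ef L_def w_def by algebra
    qed (intro coord_ring_intros | rule ideal_gen_gen, simp)+
    show "d \<in> ideal_gen l {e, f}"
    proof (rule ideal_gen_lin[of f _ _ e "\<lambda>_. m * m"
          "\<lambda>t. L t + m * (fst t - x) + m * (fst t - x') + m * m * m"])
      show "d t = m * m * f t + (L t + m * (fst t - x) + m * (fst t - x') + m * m * m) * e t" for t
        using LL[of t] m unfolding abcd ef L_def w_def by algebra
      show "(\<lambda>t. L t + m * (fst t - x) + m * (fst t - x') + m * m * m) \<in> coord_ring l"
        unfolding L_def by (intro coord_ring_intros)
    qed (intro coord_ring_intros | rule ideal_gen_gen, simp)+
  qed
  moreover have e: "e \<in> ideal_gen l {a, b, c, d}"
  proof -
    have p: "(\<lambda>t. (fst t - z) * L t * (fst t - x)) \<in> ideal_gen l {a, b, c, d}"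
    proof (rule ideal_gen_lin[of b _ _ a "\<lambda>_. 1" "\<lambda>_. - m"])
      show "(fst t - z) * L t * (fst t - x) = 1 * b t + - m * a t" for t
        using m unfolding abcd L_def by algebra
    qed (intro coord_ring_intros | rule ideal_gen_gen, simp)+
    have q: "(\<lambda>t. (fst t - z) * L t * (fst t - x')) \<in> ideal_gen l {a, b, c, d}"
    proof (rule ideal_gen_lin[of c _ _ a "\<lambda>_. 1" "\<lambda>_. - m"])
      show "(fst t - z) * L t * (fst t - x') = 1 * c t + - m * a t" for t
        unfolding abcd L_def by (simp add: algebra_simps)
    qed (intro coord_ring_intros | rule ideal_gen_gen, simp)+
    show ?thesis
    proof (cases "x = x'")
      case False
      show ?thesis
      proof (rule ideal_gen_lin[OF p q, of "\<lambda>_. 1 / (x' - x) * 1" "\<lambda>_. 1 / (x' - x) * (-1)"])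
        have "(x' - x) * e t =
            1 * ((fst t - z) * L t * (fst t - x)) + (-1) * ((fst t - z) * L t * (fst t - x'))" for t
          unfolding ef by algebra
        thus "e t = 1 / (x' - x) * 1 * ((fst t - z) * L t * (fst t - x)) +
            1 / (x' - x) * (-1) * ((fst t - z) * L t * (fst t - x'))" for t
          by (rule div_lin) (use False in simp)
      qed (intro coord_ring_intros)+
    next
      case True
      hence y: "y' = y" "y \<noteq> 0" using ne by auto
      show ?thesis
      proof (rule ideal_gen_lin[of a _ _ d "\<lambda>t. 1 / (2 * y) * (fst t - z + m * m)" "\<lambda>_. 1 / (2 * y) * (-1)"])
        have "2 * y * e t = (fst t - z + m * m) * a t + (-1) * d t" for t
          using LL[of t] unfolding abcd ef L_def y(1) True[symmetric] by algebra
        thus "e t = 1 / (2 * y) * (fst t - z + m * m) * a t + 1 / (2 * y) * (-1) * d t" for t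
          by (rule div_lin) (use y(2) in simp)
      qed (intro coord_ring_intros | rule ideal_gen_gen, simp)+
    qed
  qed
  moreover have "f \<in> ideal_gen l {a, b, c, d}"
  proof (rule ideal_gen_lin[OF _ e, of a "\<lambda>_. 1" "\<lambda>_. - m"])
    show "f t = 1 * a t + - m * e t" for t
      using LL[of t] unfolding abcd ef L_def w_def by algebra
  qed (intro coord_ring_intros | rule ideal_gen_gen, simp)+
  ultimately have "ideal_gen l {a, b, c, d} = ideal_gen l {e, f}" by (intro ideal_gen_eqI) auto
  moreover have "L \<noteq> (\<lambda>_. 0)"
  proof
    assume "L = (\<lambda>_. 0)"
    hence L0: "L t = 0" for t by simp
    obtain X where "X \<notin> {x, x', z}" using ex_new_if_finite[of "{x, x', z}"] infinite_UNIV_char_0 by auto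
    moreover have "(X - x) * (X - x') * (X - z) = 0"
      using LL[of "(X, True)"] L0[of "(X, True)"] unfolding L_def by simp
    ultimately show False by simp
  qed
  moreover have "(\<lambda>t. fst t - z) \<in> coord_ring l" by (intro coord_ring_intros)
  ultimately show ?thesis
    unfolding same_class_def w_def[symmetric] using L fst_minus_nonzero[of z] S T
    by (intro exI[of _ "\<lambda>t. fst t - z"] exI[of _ L]) simp
qed

lemma carrier_ec_group_simps [simp]:
  "Infinity \<in> carrier (ec_group l)"
  "Affine x y \<in> carrier (ec_group l) \<longleftrightarrow> y\<^sup>2 = x * (x - 1) * (x - l)"
  by (simp_all add: ec_group_def)

lemma ec_group_sel [simp]: "monoid.mult (ec_group l) = ec_add l" "monoid.one (ec_group l) = Infinity"
  by (simp_all add: ec_group_def)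

lemma ec_add_Infinity [simp]: "ec_add l P Infinity = P"
  by (cases P) simp_all

lemma ec_add_chord:
  assumes P: "y\<^sup>2 = x * (x - 1) * (x - l)" and Q: "y'\<^sup>2 = x' * (x' - 1) * (x' - l)"
    and ne: "\<not> (x = x' \<and> y = - y')"
  obtains m z where "ec_add l (Affine x y) (Affine x' y') = Affine z (m * (x - z) - y)"
    "y' - y = m * (x' - x)" "x \<noteq> x' \<or> y = y' \<and> y \<noteq> 0"
    "\<And>X. X * (X - 1) * (X - l) - (y + m * (X - x))\<^sup>2 = (X - x) * (X - x') * (X - z)"
proof (cases "x = x'")
  case False
  define m where "m = (y' - y) / (x' - x)"
  have m: "y' - y = m * (x' - x)" using False by (simp add: m_def)
  define z where "z = m\<^sup>2 + (1 + l) - x - x'"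
  have "(x - x') * (X * (X - 1) * (X - l) - (y + m * (X - x))\<^sup>2) = (x - x') * ((X - x) * (X - x') * (X - z))" for X
    using P Q m unfolding z_def by algebra
  moreover have "ec_add l (Affine x y) (Affine x' y') = Affine z (m * (x - z) - y)"
    using False by (simp add: m_def z_def Let_def)
  ultimately show ?thesis using that[of z m] m False by simp
next
  case True
  hence y: "y = y'" "y \<noteq> 0" using P Q ne power2_eq_iff[of y y'] by auto
  define m where "m = (3 * x\<^sup>2 - 2 * (1 + l) * x + l) / (2 * y)"
  have m: "m * (2 * y) = 3 * x\<^sup>2 - 2 * (1 + l) * x + l" using y by (simp add: m_def)
  define z where "z = m\<^sup>2 + (1 + l) - x - x'"
  have "X * (X - 1) * (X - l) - (y + m * (X - x))\<^sup>2 = (X - x) * (X - x') * (X - z)" for X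
    using P m unfolding z_def True[symmetric] by algebra
  moreover have "ec_add l (Affine x y) (Affine x' y') = Affine z (m * (x - z) - y)"
    using True ne by (simp add: m_def z_def Let_def)
  ultimately show ?thesis using that[of z m] True y by simp
qed

lemma ec_add_closed:
  assumes "P \<in> carrier (ec_group l)" "Q \<in> carrier (ec_group l)"
  shows "ec_add l P Q \<in> carrier (ec_group l)"
proof (cases "P = Infinity \<or> Q = Infinity")
  case False
  then obtain x y x' y' where PQ: "P = Affine x y" "Q = Affine x' y'" by (metis ec_point.exhaust)
  show ?thesis
  proof (cases "x = x' \<and> y = - y'")
    case False
    from assms PQ have "y\<^sup>2 = x * (x - 1) * (x - l)" "y'\<^sup>2 = x' * (x' - 1) * (x' - l)" by simp_all
    from ec_add_chord[OF this False] obtain m z where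
      mz: "ec_add l (Affine x y) (Affine x' y') = Affine z (m * (x - z) - y)"
      "\<And>X. X * (X - 1) * (X - l) - (y + m * (X - x))\<^sup>2 = (X - x) * (X - x') * (X - z)" by metis
    have "(m * (x - z) - y)\<^sup>2 = z * (z - 1) * (z - l)" using mz(2)[of z] by algebra
    thus ?thesis by (simp only: PQ mz(1) carrier_ec_group_simps)
  qed (simp add: PQ)
qed (use assms in auto)

lemma same_class_add:
  assumes "P \<in> carrier (ec_group l)" "Q \<in> carrier (ec_group l)" "l \<noteq> 0" "l \<noteq> 1"
  shows "same_class l (set_mult (point_ideal l P) (point_ideal l Q)) (point_ideal l (ec_add l P Q))"
proof (cases "P = Infinity \<or> Q = Infinity")
  case True
  thus ?thesis by (auto simp: same_class_refl)
next
  case False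
  then obtain x y x' y' where PQ: "P = Affine x y" "Q = Affine x' y'" by (metis ec_point.exhaust)
  from assms PQ have eq: "y\<^sup>2 = x * (x - 1) * (x - l)" "y'\<^sup>2 = x' * (x' - 1) * (x' - l)" by simp_all
  show ?thesis
  proof (cases "x = x' \<and> y = - y'")
    case True
    thus ?thesis using point_ideal_neg[OF eq(1) assms(3,4)] by (simp add: PQ)
  next
    case False
    from ec_add_chord[OF eq False] show ?thesis unfolding PQ using point_ideal_chord by metis
  qed
qed

lemma ec_add_commute:
  assumes "P \<in> carrier (ec_group l)" "Q \<in> carrier (ec_group l)"
  shows "ec_add l P Q = ec_add l Q P"
proof (cases "P = Infinity \<or> Q = Infinity")
  case False
  then obtain x y x' y' where PQ: "P = Affine x y" "Q = Affine x' y'" by (metis ec_point.exhaust)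
  show ?thesis
  proof (cases "x = x'")
    case True
    hence "y = y' \<or> y = - y'" using assms PQ by (simp add: power2_eq_iff[symmetric])
    thus ?thesis using True by (auto simp: PQ)
  next
    case False
    define m where "m = (y' - y) / (x' - x)"
    have m': "m = (y - y') / (x - x')" using False by (simp add: m_def field_simps)
    have "m * (x' - x) = y' - y" using False by (simp add: m_def)
    hence "m * (x - z) - y = m * (x' - z) - y'" for z by algebra
    moreover define z where "z = m\<^sup>2 + (1 + l) - x - x'"
    have "ec_add l P Q = Affine z (m * (x - z) - y)"
      using False by (simp add: PQ z_def m_def Let_def)
    moreover have "z = m\<^sup>2 + (1 + l) - x' - x" by (simp add: z_def)
    hence "ec_add l Q P = Affine z (m * (x' - z) - y')"
      using False by (simp add: PQ m' Let_def)
    ultimately show ?thesis by simp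
  qed
qed auto

lemma same_class_imp_eq:
  assumes "P \<in> carrier (ec_group l)" "Q \<in> carrier (ec_group l)" "l \<noteq> 0" "l \<noteq> 1"
    "same_class l (point_ideal l P) (point_ideal l Q)"
  shows "P = Q"
proof -
  define N where "N = (case Q of Infinity \<Rightarrow> Infinity | Affine x y \<Rightarrow> Affine x (- y))"
  have N: "N \<in> carrier (ec_group l)" "ec_add l Q N = Infinity"
    using assms(2) by (auto simp: N_def split: ec_point.splits)
  have "same_class l (point_ideal l (ec_add l P N)) (set_mult (point_ideal l P) (point_ideal l N))"
    by (rule same_class_sym, rule same_class_add) (use N assms in simp_all)
  moreover have "same_class l (set_mult (point_ideal l P) (point_ideal l N)) (set_mult (point_ideal l Q) (point_ideal l N))"
    using assms(5) by (rule same_class_mult)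
  moreover have "same_class l (set_mult (point_ideal l Q) (point_ideal l N)) {\<lambda>_. 1}"
    using same_class_add[OF assms(2) N(1) assms(3,4)] by (simp add: N(2))
  ultimately have "same_class l (point_ideal l (ec_add l P N)) {\<lambda>_. 1}"
    by (blast intro: same_class_trans)
  hence "ec_add l P N = Infinity"
    using point_ideal_not_principal ec_add_closed[OF assms(1) N(1)]
    by (cases "ec_add l P N") auto
  thus "P = Q"
    by (cases P; cases Q) (auto simp: N_def Let_def split: if_splits)
qed

theorem comm_group_ec_group:
  assumes "l \<noteq> 0" "l \<noteq> 1"
  shows "comm_group (ec_group l)"
proof (rule comm_groupI)
  fix P Q R assume PQR: "P \<in> carrier (ec_group l)" "Q \<in> carrier (ec_group l)" "R \<in> carrier (ec_group l)"
  note cl = ec_add_closed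
  let ?I = "point_ideal l"
  have "same_class l (?I (ec_add l (ec_add l P Q) R)) (set_mult (set_mult (?I P) (?I Q)) (?I R))"
    by (rule same_class_sym, rule same_class_trans[OF same_class_mult[OF same_class_add] same_class_add])
      (use PQR cl assms in simp_all)
  moreover have "same_class l (set_mult (set_mult (?I P) (?I Q)) (?I R)) (?I (ec_add l P (ec_add l Q R)))"
    unfolding set_mult_assoc[of _ _ "?I R"] set_mult_commute[of "?I P" "set_mult _ _"]
      ec_add_commute[OF PQR(1) cl[OF PQR(2,3)]]
    by (rule same_class_trans[OF same_class_mult[OF same_class_add] same_class_add])
      (use PQR cl assms in simp_all)
  ultimately show "P \<otimes>\<^bsub>ec_group l\<^esub> Q \<otimes>\<^bsub>ec_group l\<^esub> R = P \<otimes>\<^bsub>ec_group l\<^esub> (Q \<otimes>\<^bsub>ec_group l\<^esub> R)"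
    unfolding ec_group_sel using PQR assms
    by (intro same_class_imp_eq) (auto intro: cl same_class_trans)
next
  fix P assume P: "P \<in> carrier (ec_group l)"
  show "\<exists>Q\<in>carrier (ec_group l). Q \<otimes>\<^bsub>ec_group l\<^esub> P = \<one>\<^bsub>ec_group l\<^esub>"
  proof (cases P)
    case (Affine x y)
    with P show ?thesis by (intro bexI[of _ "Affine x (- y)"]) auto
  qed (auto intro: bexI[of _ Infinity])
qed (auto simp: ec_add_closed ec_add_commute)


section \<open>Moves and the Morse divisor\<close>

lemma height_function_iff:
  "height_function h \<longleftrightarrow> (\<forall>v j. \<bar>h (nbr j v) - h v\<bar> = 1)"
  unfolding height_function_def adjacent_iff_nbr by blast

lemma is_local_max_iff: "is_local_max h v \<longleftrightarrow> (\<forall>j. h (nbr j v) < h v)"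
  unfolding is_local_max_def adjacent_iff_nbr by blast

lemma is_local_min_iff: "is_local_min h v \<longleftrightarrow> (\<forall>j. h v < h (nbr j v))"
  unfolding is_local_min_def adjacent_iff_nbr by blast

lemma height_local_max:
  "height_function h \<Longrightarrow> is_local_max h v \<Longrightarrow> h (nbr j v) = h v - 1"
  unfolding height_function_iff is_local_max_iff by (smt (verit))

lemma height_function_lower:
  assumes "height_function h" "is_local_max h v"
  shows "height_function (lower v h)"
  unfolding height_function_iff
proof (intro allI)
  fix u j
  show "\<bar>lower v h (nbr j u) - lower v h u\<bar> = 1"
    using height_local_max[OF assms, of j] assms(1)[unfolded height_function_iff, rule_format, of j u]
    by (cases "u = v"; cases "nbr j u = v") (auto simp: lower_def)
qed

lemma height_opposite:
  assumes "height_function h" "is_local_max h v"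
  shows "h (nbr i (nbr j v)) = h v \<or> h (nbr i (nbr j v)) = h v - 2"
  using height_local_max[OF assms, of j] assms(1)[unfolded height_function_iff, rule_format, of i "nbr j v"]
  by linarith

lemma vertex_induct [case_names top nbr]:
  assumes "P top_vertex" "\<And>v j. P v \<Longrightarrow> P (nbr j v)"
  shows "P v"
proof (induction "card {i. \<not> v i}" arbitrary: v)
  case 0
  hence "v = top_vertex" by (auto simp: top_vertex_def)
  thus ?case using assms(1) by simp
next
  case (Suc n)
  then obtain j where j: "\<not> v j" by (metis (mono_tags, lifting) Collect_empty_eq card.empty nat.distinct(1))
  have "{i. \<not> nbr j v i} = {i. \<not> v i} - {j}" using j by (auto simp: nbr_def)
  hence "n = card {i. \<not> nbr j v i}" using Suc(2) j by simp
  from assms(2)[OF Suc(1)[OF this], of j] show ?case by simp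
qed

lemma face_center_idem: "w j \<Longrightarrow> w (j + 1) \<Longrightarrow> face_center j w = Center j w"
  by (auto simp: face_center_def fun_eq_iff)

lemma morse_divisor_Center:
  assumes "height_function h"
  shows "morse_divisor h (Center j w) = of_bool (w j \<and> w (j + 1) \<and> bow_tie h j w)"
proof (cases "w j \<and> w (j + 1)")
  case True
  hence "face_center j w = Center j w" by (simp add: face_center_idem)
  with morse_divisor_face_center[OF assms, of j w] True show ?thesis by simp
next
  case False
  have "Center j w \<notin> mesh h"
  proof
    assume "Center j w \<in> mesh h"
    then obtain v where "Center j w = face_center j v"
      by (cases rule: mesh_cases) (auto simp: face_center_def)
    thus False using False by (simp add: face_center_def)
  qed
  thus ?thesis using False by (auto simp: morse_divisor_def)
qed

lemma morse_divisor_Vertex_sum: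
  assumes "height_function h"
  shows "2 * (morse_divisor h (Vertex v) + 1) =
    (\<Sum>j\<in>UNIV. of_bool (h (nbr j v) \<noteq> h (nbr (j + 1) v)))"
proof -
  have "even (int (sign_changes h (Vertex v)))"
    using even_sign_changes[OF assms Vertex_in_mesh[OF assms]] by simp
  hence "2 * (morse_divisor h (Vertex v) + 1) = int (sign_changes h (Vertex v))"
    using Vertex_in_mesh[OF assms] by (simp add: morse_divisor_def)
  thus ?thesis by (simp add: sign_changes_Vertex[OF assms])
qed

lemma bow_tie_lower_far: "v \<notin> four_cycle j u \<Longrightarrow> bow_tie (lower v h) j u \<longleftrightarrow> bow_tie h j u"
  unfolding bow_tie_def lower_def by (metis fun_upd_other image_cong)

lemma morse_divisor_lower:
  assumes "height_function h" "is_local_max h v"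
  defines "b j \<equiv> of_bool (h (nbr j (nbr (j + 1) v)) = h v - 2) :: int"
  shows "morse_divisor (lower v h) p = morse_divisor h p +
    (\<Sum>j\<in>UNIV. (2 * b j - 1) * of_bool (p = face_center j v) +
               (1 - b (j - 1) - b j) * of_bool (p = Vertex (nbr j v)))"
proof -
  note h' = height_function_lower[OF assms(1,2)]
  have below: "h (nbr j v) = h v - 1" for j using height_local_max[OF assms(1,2)] .
  have opp: "h (nbr i (nbr j v)) = h v \<or> h (nbr i (nbr j v)) = h v - 2" for i j
    using height_opposite[OF assms(1,2)] .
  have low: "lower v h v = h v - 2" "u \<noteq> v \<Longrightarrow> lower v h u = h u" for u by (simp_all add: lower_def)
  show ?thesis
  proof (cases p)
    case (Vertex u)
    have S: "(\<Sum>j\<in>UNIV. (2 * b j - 1) * of_bool (p = face_center j v) +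
        (1 - b (j - 1) - b j) * of_bool (p = Vertex (nbr j v))) =
        (\<Sum>j\<in>UNIV. (1 - b (j - 1) - b j) * of_bool (u = nbr j v))"
      by (simp add: Vertex)
    define T where "T h j = (of_bool (h (nbr j u) \<noteq> h (nbr (j + 1) u)) :: int)" for h :: "vertex \<Rightarrow> int" and j
    have D: "2 * (morse_divisor h p + 1) = (\<Sum>j\<in>UNIV. T h j)"
      "2 * (morse_divisor (lower v h) p + 1) = (\<Sum>j\<in>UNIV. T (lower v h) j)"
      using morse_divisor_Vertex_sum[OF assms(1), of u] morse_divisor_Vertex_sum[OF h', of u]
      by (simp_all add: Vertex T_def)
    show ?thesis
    proof (cases "\<exists>i. u = nbr i v")
      case True
      then obtain i where i: "u = nbr i v" ..
      have "(\<Sum>j\<in>UNIV. (1 - b (j - 1) - b j) * of_bool (u = nbr j v)) = 1 - b (i - 1) - b i"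
        unfolding i nbr_eq_iff by (simp add: of_bool_def if_distrib[of "(*) _"] cong: if_cong)
      moreover have sum: "(\<Sum>j\<in>UNIV. f j) = f i + f (i - 1) + (\<Sum>j\<in>UNIV - {i, i - 1}. f j)" for f :: "color \<Rightarrow> int"
      proof -
        have "i - 1 \<noteq> i" by simp
        hence "(\<Sum>j\<in>UNIV. f j) = (\<Sum>j\<in>{i, i - 1}. f j) + (\<Sum>j\<in>UNIV - {i, i - 1}. f j)"
          by (subst sum.union_disjoint[symmetric]) (auto intro: sum.cong)
        thus ?thesis using \<open>i - 1 \<noteq> i\<close> by simp
      qed
      moreover have "T (lower v h) j = T h j" if "j \<in> UNIV - {i, i - 1}" for j
      proof -
        have "nbr j u \<noteq> v" "nbr (j + 1) u \<noteq> v" using that by (auto simp: i)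
        thus ?thesis by (simp add: T_def low)
      qed
      hence "(\<Sum>j\<in>UNIV - {i, i - 1}. T (lower v h) j) = (\<Sum>j\<in>UNIV - {i, i - 1}. T h j)"
        by (rule sum.cong[OF refl])
      moreover have "T h i = b i" "T (lower v h) i = 1 - b i"
        using opp[of i "i + 1"] nbr_commute[of i "i + 1" v]
        by (auto simp: T_def b_def i low)
      moreover have "T h (i - 1) = b (i - 1)" "T (lower v h) (i - 1) = 1 - b (i - 1)"
        using opp[of "i - 1" i] by (auto simp: T_def b_def i low)
      ultimately show ?thesis using D unfolding S by simp
    next
      case False
      hence "nbr j u \<noteq> v" for j by (metis nbr_nbr)
      hence "T (lower v h) j = T h j" for j by (simp add: T_def low)
      hence "morse_divisor h p = morse_divisor (lower v h) p" using D by simp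
      thus ?thesis using False unfolding S by simp
    qed
  next
    case (Center i w)
    have S: "(\<Sum>j\<in>UNIV. (2 * b j - 1) * of_bool (p = face_center j v) +
        (1 - b (j - 1) - b j) * of_bool (p = Vertex (nbr j v))) =
        (2 * b i - 1) * of_bool (p = face_center i v)"
      (is "?L = _")
    proof -
      have "?L = (\<Sum>j\<in>UNIV. if j = i then (2 * b i - 1) * of_bool (p = face_center i v) else 0)"
        by (rule sum.cong) (auto simp: Center face_center_def)
      thus ?thesis by simp
    qed
    show ?thesis
    proof (cases "w i \<and> w (i + 1)")
      case False
      hence "p \<noteq> face_center i v" by (auto simp: Center face_center_def)
      thus ?thesis unfolding S using False
        by (auto simp: Center morse_divisor_Center[OF assms(1)] morse_divisor_Center[OF h'])
    next
      case True
      hence w: "p = face_center i w" by (simp add: Center face_center_idem)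
      show ?thesis
      proof (cases "v \<in> four_cycle i w")
        case True
        hence p: "p = face_center i v" using w face_center_four_cycle by simp
        have "bow_tie h i v \<longleftrightarrow> h (nbr i (nbr (i + 1) v)) = h v"
          by (simp add: bow_tie_iff[OF assms(1)] below)
        moreover have "bow_tie (lower v h) i v \<longleftrightarrow> h (nbr i (nbr (i + 1) v)) = h v - 2"
          by (simp add: bow_tie_iff[OF h'] below low)
        ultimately show ?thesis
          unfolding S unfolding p using opp[of i "i + 1"]
          by (auto simp: morse_divisor_face_center[OF assms(1)] morse_divisor_face_center[OF h'] b_def)
      next
        case False
        hence "p \<noteq> face_center i v" by (metis w face_center_eq_iff)
        thus ?thesis unfolding S unfolding w using bow_tie_lower_far[OF False]
          by (simp add: morse_divisor_face_center[OF assms(1)] morse_divisor_face_center[OF h'])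
      qed
    qed
  qed
qed

text \<open>Lowering global maxima ends in a height with two values only.\<close>
lemma height_induct [consumes 1, case_names flat lower]:
  assumes "height_function h"
    and flat: "\<And>h. height_function h \<Longrightarrow> (\<And>v i j. h (nbr i v) = h (nbr j v)) \<Longrightarrow> P h"
    and lower: "\<And>h v. height_function h \<Longrightarrow> is_local_max h v \<Longrightarrow> P (lower v h) \<Longrightarrow> P h"
  shows "P h"
proof -
  define m where "m = Min (range h)"
  have "\<forall>v. h v \<ge> m" by (auto simp: m_def)
  with assms(1) show ?thesis
  proof (induction "nat (\<Sum>v\<in>UNIV. h v - m)" arbitrary: h rule: less_induct)
    case less
    define M where "M = Max (range h)"
    have le: "h v \<le> M" for v by (auto simp: M_def)
    have "M \<in> range h" unfolding M_def by (rule Max_in) auto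
    then obtain v where v: "h v = M" by auto
    show ?case
    proof (cases "M \<ge> m + 2")
      case True
      have max: "is_local_max h v"
        unfolding is_local_max_iff
      proof
        fix j show "h (nbr j v) < h v"
          using less.prems(1)[unfolded height_function_iff, rule_format, of j v] le[of "nbr j v"] v by linarith
      qed
      have ge: "\<forall>u. lower v h u \<ge> m" using less.prems(2) True v by (simp add: lower_def)
      have "(\<Sum>u\<in>UNIV. lower v h u - m) < (\<Sum>u\<in>UNIV. h u - m)"
        by (rule sum_strict_mono_ex1) (auto simp: lower_def)
      moreover have "0 \<le> (\<Sum>u\<in>UNIV. lower v h u - m)" by (rule sum_nonneg) (use ge in simp)
      ultimately have "nat (\<Sum>u\<in>UNIV. lower v h u - m) < nat (\<Sum>u\<in>UNIV. h u - m)" by linarith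
      from less.hyps[OF this height_function_lower[OF less.prems(1) max] ge]
      show ?thesis by (rule lower[OF less.prems(1) max])
    next
      case False
      have "h (nbr i u) = h (nbr j u)" for u i j
        using less.prems(1)[unfolded height_function_iff, rule_format, of i u]
          less.prems(1)[unfolded height_function_iff, rule_format, of j u]
          less.prems(2)[rule_format, of u] less.prems(2)[rule_format, of "nbr i u"]
          less.prems(2)[rule_format, of "nbr j u"] le[of u] le[of "nbr i u"] le[of "nbr j u"] False
        by linarith
      thus ?thesis by (rule flat[OF less.prems(1)])
    qed
  qed
qed

section \<open>Images of Morse divisors in an abelian group\<close>

lemma finite_support_sum:
  fixes D :: "'j \<Rightarrow> 'p \<Rightarrow> int"
  assumes "finite A" "\<And>j. j \<in> A \<Longrightarrow> finite {p. D j p \<noteq> 0}"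
  shows "finite {p. (\<Sum>j\<in>A. D j p) \<noteq> 0}"
proof (rule finite_subset)
  show "{p. (\<Sum>j\<in>A. D j p) \<noteq> 0} \<subseteq> (\<Union>j\<in>A. {p. D j p \<noteq> 0})"
    by (auto intro: ccontr sum.neutral)
  show "finite (\<Union>j\<in>A. {p. D j p \<noteq> 0})" using assms by simp
qed

lemma (in comm_group) finprod_involution:
  assumes "finite S" "f \<in> S \<rightarrow> carrier G"
    "\<And>p. p \<in> S \<Longrightarrow> \<pi> p \<in> S" "\<And>p. p \<in> S \<Longrightarrow> \<pi> (\<pi> p) = p" "\<And>p. p \<in> S \<Longrightarrow> \<pi> p \<noteq> p"
    "\<And>p. p \<in> S \<Longrightarrow> f (\<pi> p) = inv (f p)"
  shows "finprod G f S = \<one>"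
  using assms
proof (induction S rule: finite_psubset_induct)
  case (psubset S)
  show ?case
  proof (cases "S = {}")
    case False
    then obtain p where p: "p \<in> S" by blast
    define T where "T = S - {p, \<pi> p}"
    have S: "S = insert p (insert (\<pi> p) T)" using p psubset.prems(2) by (auto simp: T_def)
    have T: "T \<subset> S" "finite T" using p psubset.hyps by (auto simp: T_def)
    have in_T: "\<pi> q \<in> T" if "q \<in> T" for q
      using that psubset.prems(2,3) p unfolding T_def by (metis Diff_iff insertCI insertE singletonD)
    have "finprod G f T = \<one>"
      by (rule psubset.IH[OF T(1)]) (use psubset.prems in_T T in auto)
    moreover have "f p \<in> carrier G" "f (\<pi> p) \<in> carrier G" "f \<in> T \<rightarrow> carrier G"
      using psubset.prems(1,2) p T by auto
    moreover have "p \<notin> insert (\<pi> p) T" "\<pi> p \<notin> T" using psubset.prems(4)[OF p] by (auto simp: T_def)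
    ultimately show ?thesis
      unfolding S using T(2) psubset.prems(5)[OF p] by simp
  qed simp
qed

definition (in comm_group) divisor_image :: "('p \<Rightarrow> 'a) \<Rightarrow> ('p \<Rightarrow> int) \<Rightarrow> 'a" where
  "divisor_image N D = (\<Otimes>p\<in>{p. D p \<noteq> 0}. N p [^] D p)"

context comm_group
begin

lemma divisor_image_superset:
  assumes "\<And>p. N p \<in> carrier G" "finite S" "{p. D p \<noteq> 0} \<subseteq> S"
  shows "divisor_image N D = (\<Otimes>p\<in>S. N p [^] D p)"
  unfolding divisor_image_def
  by (rule finprod_mono_neutral_cong_left) (use assms in auto)

lemma divisor_image_closed: "(\<And>p. N p \<in> carrier G) \<Longrightarrow> divisor_image N D \<in> carrier G"
  unfolding divisor_image_def by (intro finprod_closed) auto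

lemma divisor_image_add:
  assumes "\<And>p. N p \<in> carrier G" "finite {p. D p \<noteq> 0}" "finite {p. D' p \<noteq> 0}"
  shows "divisor_image N (\<lambda>p. D p + D' p) = divisor_image N D \<otimes> divisor_image N D'"
proof -
  define S where "S = {p. D p \<noteq> 0} \<union> {p. D' p \<noteq> 0}"
  have S: "finite S" using assms(2,3) by (simp add: S_def)
  have "divisor_image N (\<lambda>p. D p + D' p) = (\<Otimes>p\<in>S. N p [^] (D p + D' p))"
    by (rule divisor_image_superset) (use assms(1) S in \<open>auto simp: S_def\<close>)
  also have "\<dots> = (\<Otimes>p\<in>S. N p [^] D p \<otimes> N p [^] D' p)"
    by (rule finprod_cong) (use assms(1) in \<open>auto simp: int_pow_mult simp_implies_def\<close>)
  also have "\<dots> = (\<Otimes>p\<in>S. N p [^] D p) \<otimes> (\<Otimes>p\<in>S. N p [^] D' p)"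
    by (rule finprod_multf) (use assms(1) in auto)
  also have "(\<Otimes>p\<in>S. N p [^] D p) = divisor_image N D"
    by (rule divisor_image_superset[symmetric]) (use assms(1) S in \<open>auto simp: S_def\<close>)
  also have "(\<Otimes>p\<in>S. N p [^] D' p) = divisor_image N D'"
    by (rule divisor_image_superset[symmetric]) (use assms(1) S in \<open>auto simp: S_def\<close>)
  finally show ?thesis .
qed

lemma divisor_image_single:
  assumes "\<And>p. N p \<in> carrier G"
  shows "divisor_image N (\<lambda>p. n * of_bool (p = q)) = N q [^] n"
proof -
  have "divisor_image N (\<lambda>p. n * of_bool (p = q)) = (\<Otimes>p\<in>{q}. N p [^] (n * of_bool (p = q)))"
    by (rule divisor_image_superset) (use assms in auto)
  thus ?thesis using assms by simp
qed

lemma divisor_image_sum: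
  assumes "\<And>p. N p \<in> carrier G" "finite A" "\<And>j. j \<in> A \<Longrightarrow> finite {p. D j p \<noteq> 0}"
  shows "divisor_image N (\<lambda>p. \<Sum>j\<in>A. D j p) = (\<Otimes>j\<in>A. divisor_image N (D j))"
  using assms(2,3)
proof (induction A rule: finite_induct)
  case empty
  show ?case by (simp add: divisor_image_def)
next
  case (insert i A)
  have fin: "finite {p. (\<Sum>j\<in>A. D j p) \<noteq> 0}"
    by (rule finite_support_sum) (use insert in simp_all)
  have "divisor_image N (\<lambda>p. \<Sum>j\<in>insert i A. D j p) = divisor_image N (\<lambda>p. D i p + (\<Sum>j\<in>A. D j p))"
    using insert(1,2) by simp
  also have "\<dots> = divisor_image N (D i) \<otimes> divisor_image N (\<lambda>p. \<Sum>j\<in>A. D j p)"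
    by (rule divisor_image_add[OF assms(1) _ fin]) (use insert.prems in simp)
  also have "divisor_image N (\<lambda>p. \<Sum>j\<in>A. D j p) = (\<Otimes>j\<in>A. divisor_image N (D j))"
    by (rule insert.IH) (use insert.prems in simp)
  also have "divisor_image N (D i) \<otimes> \<dots> = (\<Otimes>j\<in>insert i A. divisor_image N (D j))"
    using insert(1,2) divisor_image_closed[of N, OF assms(1)] by simp
  finally show ?case .
qed

end

lemma UNIV_color_from: "(UNIV :: color set) = {c, c + 1, c + 2, c + 3, c + 4}"
proof -
  have "j \<in> {c, c + 1, c + 2, c + 3, c + 4}" for j
    using color_cases[of "j - c"] by (auto simp: algebra_simps)
  thus ?thesis by blast
qed

text \<open>\<open>N\<close> is the map to the group and \<open>c\<close> the only color whose face centers are not sent to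
  2-torsion points; \<open>e i\<close> is the sign by which reflection along \<open>i\<close> acts on
  \<open>N (f\<^sub>c\<^sub>,\<^sub>c\<^sub>+\<^sub>1(v)) - N (v\<^sub>c)\<close>.\<close>
locale rainbow_map = comm_group G for G :: "('a, 'b) monoid_scheme" (structure) +
  fixes N :: "mesh_vertex \<Rightarrow> 'a" and c :: color and e :: "color \<Rightarrow> int"
  assumes N_closed [simp]: "N p \<in> carrier G"
    and center_square: "j \<noteq> c \<Longrightarrow> N (face_center j v) \<otimes> N (face_center j v) = \<one>"
    and center_prod: "N (face_center (c + 1) v) \<otimes> (N (face_center (c + 2) v) \<otimes>
      (N (face_center (c + 3) v) \<otimes> N (face_center (c + 4) v))) = \<one>"
    and nbr_next: "j \<noteq> c \<Longrightarrow> N (Vertex (nbr (j + 1) v)) = inv N (Vertex (nbr j v))"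
    and nbr_special: "N (Vertex (nbr (c + 1) v)) = N (Vertex (nbr c v))"
    and center_flip: "N (face_center j (nbr (j + 2) v)) = inv N (face_center j v)"
    and generator_nbr: "N (face_center c (nbr i v)) \<otimes> inv N (Vertex (nbr c (nbr i v))) =
      (N (face_center c v) \<otimes> inv N (Vertex (nbr c v))) [^] e i"
    and sign: "e i = 1 \<or> e i = -1"
    and sign_special: "e c = -1" "e (c + 1) = -1" "e (c + 3) = -1"
begin

definition generator :: "vertex \<Rightarrow> 'a" where
  "generator v = N (face_center c v) \<otimes> inv N (Vertex (nbr c v))"

definition vertex_sign :: "vertex \<Rightarrow> int" where
  "vertex_sign v = (\<Prod>i\<in>UNIV. if v i then 1 else e i)"

text \<open>The type of a face is 0 for a bow-tie and \<open>1\<close> or \<open>-1\<close> for a diamond, depending on which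
  diagonal is level; \<open>index\<close> takes the representative \<open>w\<close> of every face that is used in
  \<^const>\<open>Center\<close>.\<close>
definition face_type :: "(vertex \<Rightarrow> int) \<Rightarrow> vertex \<Rightarrow> int" where
  "face_type h w = of_bool (h (nbr c (nbr (c + 1) w)) = h w) - of_bool (h (nbr c w) = h (nbr (c + 1) w))"

definition index :: "(vertex \<Rightarrow> int) \<Rightarrow> int" where
  "index h = (\<Sum>w\<in>{w. w c \<and> w (c + 1)}. vertex_sign w * face_type h w)"

lemma generator_closed [simp]: "generator v \<in> carrier G"
  by (simp add: generator_def)

lemma vertex_sign_top [simp]: "vertex_sign top_vertex = 1"
  by (simp add: vertex_sign_def top_vertex_def)

lemma sign_square: "e i * e i = 1"
  using sign[of i] by auto

lemma vertex_sign_nbr: "vertex_sign (nbr i v) = e i * vertex_sign v"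
proof -
  have *: "vertex_sign u = (if u i then 1 else e i) * (\<Prod>j\<in>UNIV - {i}. if u j then 1 else e j)" for u
    unfolding vertex_sign_def by (rule prod.remove) auto
  have "(\<Prod>j\<in>UNIV - {i}. if nbr i v j then 1 else e j) = (\<Prod>j\<in>UNIV - {i}. if v j then 1 else e j)"
    by (rule prod.cong) (auto simp: nbr_def)
  moreover have "(if nbr i v i then 1 else e i) = e i * (if v i then 1 else e i)"
    using sign_square by (simp add: nbr_def)
  ultimately show ?thesis unfolding *[of v] *[of "nbr i v"] by simp
qed

lemma vertex_sign_cases: "vertex_sign v = 1 \<or> vertex_sign v = -1"
proof (induction v rule: vertex_induct)
  case (nbr v j)
  thus ?case using sign[of j] by (auto simp: vertex_sign_nbr)
qed simp

lemma generator_eq: "generator v = generator top_vertex [^] vertex_sign v"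
proof (induction v rule: vertex_induct)
  case (nbr v j)
  have "generator (nbr j v) = generator v [^] e j"
    unfolding generator_def by (rule generator_nbr)
  thus ?case by (simp add: nbr int_pow_pow vertex_sign_nbr mult.commute)
qed simp

lemma divisor_image_lower:
  assumes "height_function h" "is_local_max h v"
  defines "s \<equiv> (if h (nbr c (nbr (c + 1) v)) = h v - 2 then 1 else -1)"
  shows "divisor_image N (morse_divisor (lower v h)) =
    divisor_image N (morse_divisor h) \<otimes> generator v [^] (s :: int)"
proof -
  define b where "b j = (of_bool (h (nbr j (nbr (j + 1) v)) = h v - 2) :: int)" for j
  define E where "E j p = (2 * b j - 1) * of_bool (p = face_center j v) +
    (1 - b (j - 1) - b j) * of_bool (p = Vertex (nbr j v))" for j p
  have finE: "finite {p. E j p \<noteq> 0}" for j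
    by (rule finite_subset[of _ "{face_center j v, Vertex (nbr j v)}"]) (auto simp: E_def split: if_splits)
  have E: "divisor_image N (E j) = N (face_center j v) [^] (2 * b j - 1) \<otimes> N (Vertex (nbr j v)) [^] (1 - b (j - 1) - b j)" for j
    unfolding E_def by (subst divisor_image_add) (simp_all add: divisor_image_single)
  have "morse_divisor (lower v h) = (\<lambda>p. morse_divisor h p + (\<Sum>j\<in>UNIV. E j p))"
    using morse_divisor_lower[OF assms(1,2)] unfolding E_def b_def by blast
  hence "divisor_image N (morse_divisor (lower v h)) =
      divisor_image N (morse_divisor h) \<otimes> divisor_image N (\<lambda>p. \<Sum>j\<in>UNIV. E j p)"
    using finite_support_sum[of UNIV E] finE
    by (simp add: divisor_image_add finite_morse_divisor_support)
  also have "divisor_image N (\<lambda>p. \<Sum>j\<in>UNIV. E j p) = (\<Otimes>j\<in>UNIV. divisor_image N (E j))"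
    by (rule divisor_image_sum) (simp_all add: finE)
  also have "\<dots> = generator v [^] s"
  proof -
    define F where "F i = N (face_center (c + i) v)" for i
    define U where "U = N (Vertex (nbr c v))"
    have cl [simp]: "F i \<in> carrier G" "U \<in> carrier G" for i by (simp_all add: F_def U_def)
    have ne: "c + 1 \<noteq> c" "c + 2 \<noteq> c" "c + 3 \<noteq> c" "c + 4 \<noteq> c" by simp_all
    have U: "N (Vertex (nbr (c + 1) v)) = U" "N (Vertex (nbr (c + 2) v)) = inv U"
      "N (Vertex (nbr (c + 3) v)) = U" "N (Vertex (nbr (c + 4) v)) = inv U"
      using nbr_special[of v] nbr_next[OF ne(1), of v] nbr_next[OF ne(2), of v] nbr_next[OF ne(3), of v]
      by (simp_all add: U_def add.assoc)
    have F: "N (face_center (c + i) v) [^] (2 * b (c + i) - 1) = F i" if "c + i \<noteq> c" for i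
    proof -
      have "inv (F i) = F i" using center_square[OF that, of v] by (simp add: F_def inv_equality)
      moreover have "b (c + i) = 0 \<or> b (c + i) = 1" by (simp add: b_def)
      ultimately show ?thesis
        unfolding F_def[symmetric] by (auto simp: int_pow_neg[of _ 1, simplified])
    qed
    have shift: "c - 1 = c + 4" "c + 1 - 1 = c" "c + 2 - 1 = c + 1" "c + 3 - 1 = c + 2" "c + 4 - 1 = c + 3"
      by (simp_all add: algebra_simps)
    have s: "s = 2 * b c - 1" by (simp add: s_def b_def)
    have inv_pow: "inv U [^] n = U [^] - n" for n :: int by (simp add: int_pow_inv int_pow_neg)
    have regroup: "a0 \<otimes> u0 \<otimes> (a1 \<otimes> u1 \<otimes> (a2 \<otimes> u2 \<otimes> (a3 \<otimes> u3 \<otimes> (a4 \<otimes> u4)))) =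
        a0 \<otimes> (a1 \<otimes> (a2 \<otimes> (a3 \<otimes> a4))) \<otimes> (u0 \<otimes> (u1 \<otimes> (u2 \<otimes> (u3 \<otimes> u4))))"
      if "a0 \<in> carrier G" "a1 \<in> carrier G" "a2 \<in> carrier G" "a3 \<in> carrier G" "a4 \<in> carrier G"
        "u0 \<in> carrier G" "u1 \<in> carrier G" "u2 \<in> carrier G" "u3 \<in> carrier G" "u4 \<in> carrier G"
      for a0 a1 a2 a3 a4 u0 u1 u2 u3 u4
      using that by (simp add: m_ac)
    have "(\<Otimes>j\<in>UNIV. divisor_image N (E j)) = divisor_image N (E c) \<otimes> (divisor_image N (E (c + 1)) \<otimes>
        (divisor_image N (E (c + 2)) \<otimes> (divisor_image N (E (c + 3)) \<otimes> divisor_image N (E (c + 4)))))"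
      unfolding UNIV_color_from[of c] by (simp add: divisor_image_closed)
    also have "\<dots> = F 0 [^] s \<otimes> (F 1 \<otimes> (F 2 \<otimes> (F 3 \<otimes> F 4))) \<otimes> U [^] - s"
      unfolding E F[OF ne(1)] F[OF ne(2)] F[OF ne(3)] F[OF ne(4)] U shift U_def[symmetric]
      by (subst regroup) (simp_all add: inv_pow s F_def flip: int_pow_mult)
    also have "\<dots> = F 0 [^] s \<otimes> inv U [^] s"
      using center_prod[of v] by (simp add: F_def inv_pow)
    also have "\<dots> = generator v [^] s"
      by (simp add: generator_def F_def U_def int_pow_distrib)
    finally show ?thesis .
  qed
  finally show ?thesis .
qed

lemma face_type_nbr: "face_type h (nbr c u) = - face_type h u" "face_type h (nbr (c + 1) u) = - face_type h u"
  unfolding face_type_def nbr_nbr nbr_commute[of "c + 1" c] by simp_all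

lemma index_lower:
  assumes "height_function h" "is_local_max h v"
  shows "index (lower v h) = index h + vertex_sign v * (if h (nbr c (nbr (c + 1) v)) = h v - 2 then 1 else -1)"
proof -
  define w where "w = v(c := True, c + 1 := True)"
  define W where "W = {w :: vertex. w c \<and> w (c + 1)}"
  have w: "w \<in> W" by (simp add: w_def W_def)
  have wv: "face_center c w = face_center c v" by (simp add: face_center_def w_def)
  have sum: "index f = vertex_sign w * face_type f w + (\<Sum>u\<in>W - {w}. vertex_sign u * face_type f u)" for f
    unfolding index_def W_def[symmetric] by (rule sum.remove) (use w in simp_all)
  have same: "vertex_sign w * face_type f w = vertex_sign v * face_type f v" for f
  proof -
    have "w \<in> four_cycle c v" using wv by (simp add: face_center_eq_iff)
    thus ?thesis unfolding four_cycle_def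
      by (elim insertE emptyE) (simp_all add: vertex_sign_nbr face_type_nbr sign_special)
  qed
  have "(\<Sum>u\<in>W - {w}. vertex_sign u * face_type (lower v h) u) = (\<Sum>u\<in>W - {w}. vertex_sign u * face_type h u)"
  proof (rule sum.cong)
    fix u assume u: "u \<in> W - {w}"
    hence "face_center c u = Center c u" by (simp add: W_def face_center_idem)
    moreover have "face_center c v = Center c w" by (simp add: w_def face_center_def)
    ultimately have "face_center c v \<noteq> face_center c u" using u by auto
    hence "v \<notin> four_cycle c u" by (simp add: face_center_eq_iff)
    hence "u \<noteq> v" "nbr c u \<noteq> v" "nbr (c + 1) u \<noteq> v" "nbr c (nbr (c + 1) u) \<noteq> v"
      unfolding four_cycle_def by blast+
    thus "vertex_sign u * face_type (lower v h) u = vertex_sign u * face_type h u"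
      by (simp add: face_type_def lower_def)
  qed simp
  hence "index (lower v h) - index h = vertex_sign v * (face_type (lower v h) v - face_type h v)"
    unfolding sum same by (simp add: algebra_simps)
  also have "face_type (lower v h) v - face_type h v = (if h (nbr c (nbr (c + 1) v)) = h v - 2 then 1 else -1)"
  proof -
    have "face_type (lower v h) v = of_bool (h (nbr c (nbr (c + 1) v)) = h v - 2) - 1"
      "face_type h v = of_bool (h (nbr c (nbr (c + 1) v)) = h v) - 1"
      by (simp_all add: face_type_def lower_def height_local_max[OF assms])
    thus ?thesis using height_opposite[OF assms, of c "c + 1"] by (elim disjE) simp_all
  qed
  finally show ?thesis by simp
qed

lemma divisor_image_flat:
  assumes "height_function h" "\<And>v i j. h (nbr i v) = h (nbr j v)"
  shows "divisor_image N (morse_divisor h) = \<one>"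
proof -
  define \<pi> where "\<pi> p = (case p of Vertex v \<Rightarrow> Vertex (nbr (c + 1) (nbr (c + 2) v))
    | Center j w \<Rightarrow> Center j (nbr (j + 2) w))" for p
  have V: "morse_divisor h (Vertex v) = -1" for v
    using morse_divisor_Vertex_sum[OF assms(1), of v] assms(2)[of _ v] by simp
  have bt: "bow_tie h j v" for j v
    unfolding bow_tie_iff[OF assms(1)] using assms(2)[of j "nbr (j + 1) v" "j + 1"] assms(2)[of _ v] by simp
  hence C: "morse_divisor h (Center j w) = of_bool (w j \<and> w (j + 1))" for j w
    by (simp add: morse_divisor_Center[OF assms(1)])
  have far: "j + 2 \<noteq> j" "j + 2 \<noteq> j + 1" for j :: color by simp_all
  have pi: "morse_divisor h (\<pi> p) = morse_divisor h p" for p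
    using far by (cases p) (simp_all add: \<pi>_def V C nbr_def)
  have N: "N (\<pi> p) = inv N p" if "morse_divisor h p \<noteq> 0" for p
  proof (cases p)
    case (Vertex v)
    have "c + 1 \<noteq> c" by simp
    from nbr_next[OF this, of "nbr (c + 1) v"] show ?thesis
      by (simp add: Vertex \<pi>_def nbr_commute[of "c + 1"] add.assoc)
  next
    case (Center j w)
    with that have w: "w j" "w (j + 1)" by (simp_all add: C)
    hence "nbr (j + 2) w j" "nbr (j + 2) w (j + 1)" using far by (simp_all add: nbr_def)
    from center_flip[of j w] w this show ?thesis by (simp add: Center \<pi>_def face_center_idem)
  qed
  show ?thesis
    unfolding divisor_image_def
  proof (rule finprod_involution[where \<pi> = \<pi>])
    fix p assume p: "p \<in> {p. morse_divisor h p \<noteq> 0}"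
    show "\<pi> p \<in> {p. morse_divisor h p \<noteq> 0}" using p by (simp add: pi)
    show "\<pi> (\<pi> p) = p"
      by (cases p) (simp_all add: \<pi>_def nbr_commute[of "c + 2"])
    show "\<pi> p \<noteq> p"
      by (cases p) (simp_all add: \<pi>_def)
    show "N (\<pi> p) [^] morse_divisor h (\<pi> p) = inv (N p [^] morse_divisor h p)"
      using p by (simp add: pi N int_pow_inv)
  qed (auto simp: finite_morse_divisor_support)
qed

lemma index_flat:
  assumes "\<And>v i j. h (nbr i v) = h (nbr j v)"
  shows "index h = 0"
proof -
  have "h (nbr c (nbr (c + 1) w)) = h w" for w
    using assms[of c "nbr (c + 1) w" "c + 1"] by simp
  moreover have "h (nbr c w) = h (nbr (c + 1) w)" for w by (rule assms)
  ultimately have "face_type h w = 0" for w by (simp add: face_type_def)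
  thus ?thesis by (simp add: index_def)
qed

lemma divisor_image_eq_index:
  assumes "height_function h"
  shows "divisor_image N (morse_divisor h) = generator top_vertex [^] index h"
  using assms
proof (induction h rule: height_induct)
  case (flat h)
  thus ?case by (simp add: divisor_image_flat index_flat)
next
  case (lower h v)
  define s :: int where "s = (if h (nbr c (nbr (c + 1) v)) = h v - 2 then 1 else -1)"
  have "divisor_image N (morse_divisor h) \<otimes> generator v [^] s =
    generator top_vertex [^] (index h + vertex_sign v * s)"
    using lower.IH unfolding divisor_image_lower[OF lower(1,2)] index_lower[OF lower(1,2)] s_def .
  also have "\<dots> = generator top_vertex [^] index h \<otimes> generator v [^] s"
    by (simp add: generator_eq[of v] int_pow_mult int_pow_pow)
  finally show ?case by (simp add: divisor_image_closed)
qed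

lemma abs_index_le: "\<bar>index h\<bar> \<le> 8"
proof -
  define W where "W = {w :: vertex. w c \<and> w (c + 1)}"
  have "inj_on (\<lambda>w. {i. w i} \<inter> {c + 2, c + 3, c + 4}) W"
  proof (rule inj_onI)
    fix u w assume "u \<in> W" "w \<in> W" and eq: "{i. u i} \<inter> {c + 2, c + 3, c + 4} = {i. w i} \<inter> {c + 2, c + 3, c + 4}"
    hence "u i = w i" if "i \<in> {c, c + 1, c + 2, c + 3, c + 4}" for i
      using that by (auto simp: W_def)
    thus "u = w" using UNIV_color_from[of c] by auto
  qed
  moreover have "(\<lambda>w. {i. w i} \<inter> {c + 2, c + 3, c + 4}) ` W \<subseteq> Pow {c + 2, c + 3, c + 4}" by blast
  ultimately have "card W \<le> card (Pow {c + 2, c + 3, c + 4})" by (rule card_inj_on_le) simp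
  hence "card W \<le> 8" by (simp add: card_Pow)
  have "\<bar>index h\<bar> \<le> (\<Sum>w\<in>W. \<bar>vertex_sign w * face_type h w\<bar>)"
    unfolding index_def W_def by (rule sum_abs)
  also have "\<dots> \<le> (\<Sum>w\<in>W. 1)"
  proof (rule sum_mono)
    fix w show "\<bar>vertex_sign w * face_type h w\<bar> \<le> 1"
      using vertex_sign_cases[of w] by (auto simp: face_type_def)
  qed
  also have "\<dots> \<le> 8" using \<open>card W \<le> 8\<close> by simp
  finally show ?thesis .
qed

lemma h_fe_nbr: "h_fe (nbr i v) = (if v i then h_fe v - 1 else h_fe v + 1)"
proof -
  have *: "h_fe u = of_bool (u i) + (\<Sum>j\<in>UNIV - {i}. of_bool (u j))" for u
    unfolding h_fe_def by (rule sum.remove) auto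
  have "(\<Sum>j\<in>UNIV - {i}. of_bool (nbr i v j)) = (\<Sum>j\<in>UNIV - {i}. of_bool (v j) :: int)"
    by (rule sum.cong) (auto simp: nbr_def)
  thus ?thesis unfolding *[of v] *[of "nbr i v"] by (simp add: nbr_def)
qed

lemma height_function_h_fe: "height_function h_fe"
  by (simp add: height_function_iff h_fe_nbr)

lemma is_local_max_h_fe: "is_local_max h_fe top_vertex"
  by (simp add: is_local_max_iff h_fe_nbr top_vertex_def)

lemma index_h_fe: "index h_fe = 0"
proof -
  define W where "W = {w :: vertex. w c \<and> w (c + 1)}"
  have "face_type h_fe w = -1" if "w \<in> W" for w
    using that by (simp add: face_type_def h_fe_nbr W_def) (simp add: nbr_def)
  hence 1: "index h_fe = (\<Sum>w\<in>W. - vertex_sign w)"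
    unfolding index_def W_def[symmetric] by (intro sum.cong) simp_all
  have far: "c + 3 \<noteq> c" "c + 3 \<noteq> c + 1" by simp_all
  have "(\<Sum>w\<in>W. - vertex_sign w) = (\<Sum>w\<in>W. vertex_sign w)"
    by (rule sum.reindex_bij_witness[where i = "nbr (c + 3)" and j = "nbr (c + 3)"])
      (use far in \<open>simp_all add: W_def vertex_sign_nbr sign_special, simp_all add: nbr_def\<close>)
  thus ?thesis using 1 by (simp add: sum_negf)
qed

lemma height_function_h_1: "height_function h_1"
  unfolding h_1_def by (rule height_function_lower[OF height_function_h_fe is_local_max_h_fe])

lemma divisor_image_h_1: "divisor_image N (morse_divisor h_1) = generator top_vertex"
proof -
  have "index h_1 = 1"
    unfolding h_1_def index_lower[OF height_function_h_fe is_local_max_h_fe] index_h_fe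
    by (simp add: h_fe_nbr) (simp add: nbr_def top_vertex_def)
  thus ?thesis by (simp add: divisor_image_eq_index[OF height_function_h_1])
qed

lemma index_move:
  assumes "height_function h" "height_function h'" "differ_by_move h h'"
  shows "\<bar>index h - index h'\<bar> = 1"
proof -
  have same: "index h' = index h" if "same_height h h'" for h h'
    using that by (auto simp: same_height_def index_def face_type_def)
  have main: "\<bar>index h - index (lower v h)\<bar> = 1" if "height_function h" "is_local_max h v" for h v
    using vertex_sign_cases[of v] by (auto simp: index_lower[OF that])
  from assms(3) obtain v where "is_local_max h v \<and> same_height (lower v h) h' \<or>
      is_local_min h v \<and> same_height (raise v h) h'" unfolding differ_by_move_def by blast
  thus ?thesis
  proof (elim disjE conjE)
    assume "is_local_max h v" "same_height (lower v h) h'"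
    thus ?thesis using main[OF assms(1)] same by simp
  next
    assume v: "is_local_min h v" "same_height (raise v h) h'"
    have "h (nbr j v) = h v + 1" for j
      using v(1) assms(1) unfolding is_local_min_iff height_function_iff by (smt (verit))
    hence max: "is_local_max (raise v h) v" by (simp add: is_local_max_iff raise_def)
    have "lower v (raise v h) = h" by (simp add: lower_def raise_def)
    moreover from v(2) have "height_function (raise v h)"
      using assms(2) unfolding same_height_def height_function_iff by auto
    ultimately show ?thesis using main[OF _ max] same[OF v(2)] by simp
  qed
qed

lemma divisor_image_multiple:
  assumes "height_function h"
  shows "\<exists>a::int. -8 \<le> a \<and> a \<le> 8 \<and>
    divisor_image N (morse_divisor h) = divisor_image N (morse_divisor h_1) [^] a"
  using abs_index_le[of h] divisor_image_eq_index[OF assms]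
  unfolding divisor_image_h_1 by (intro exI[of _ "index h"]) auto

lemma divisor_image_move:
  assumes "height_function h" "height_function h'" "differ_by_move h h'"
  shows "\<exists>a a'::int. divisor_image N (morse_divisor h) = divisor_image N (morse_divisor h_1) [^] a \<and>
    divisor_image N (morse_divisor h') = divisor_image N (morse_divisor h_1) [^] a' \<and> \<bar>a - a'\<bar> = 1"
  using index_move[OF assms] divisor_image_eq_index[OF assms(1)] divisor_image_eq_index[OF assms(2)]
  unfolding divisor_image_h_1 by blast

end


section \<open>The points of the elliptic curves\<close>

fun ec_conj :: "complex \<Rightarrow> ec_point \<Rightarrow> ec_point" where
  "ec_conj s Infinity = Infinity"
| "ec_conj s (Affine x y) = Affine (cnj x) (s * cnj y)"

definition curve_param :: "5 \<Rightarrow> real" where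
  "curve_param k = (if k = 1 \<or> k = 4 then gold + 1 else if k = 2 \<or> k = 5 then gold else - gold)"

lemma ell_curve_param: "ell_curve k = ec_group (complex_of_real (curve_param k))"
  by (simp add: ell_curve_def curve_param_def)

lemma curve_param_nontrivial:
  "complex_of_real (curve_param k) \<noteq> 0" "complex_of_real (curve_param k) \<noteq> 1"
  unfolding of_real_eq_0_iff of_real_eq_1_iff using gold_gt_1 by (auto simp: curve_param_def)

lemma ec_conj_add:
  assumes "s = 1 \<or> s = -1"
  shows "ec_conj s (ec_add (complex_of_real l) P Q) = ec_add (complex_of_real l) (ec_conj s P) (ec_conj s Q)"
proof (cases "P = Infinity \<or> Q = Infinity")
  case False
  then obtain x y x' y' where PQ: "P = Affine x y" "Q = Affine x' y'" by (metis ec_point.exhaust)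
  have s: "s * s = 1" "cnj s = s" "inverse s = s" using assms by auto
  have eq: "s * cnj y = - (s * cnj y') \<longleftrightarrow> y = - y'"
  proof -
    have "s \<noteq> 0" using s(1) by force
    have "s * cnj y = - (s * cnj y') \<longleftrightarrow> s * cnj y = s * cnj (- y')"
      by (simp only: complex_cnj_minus mult_minus_right)
    also have "\<dots> \<longleftrightarrow> cnj y = cnj (- y')" by (simp only: mult_cancel_left \<open>s \<noteq> 0\<close> simp_thms)
    finally show ?thesis unfolding complex_cnj_cancel_iff .
  qed
  define m where "m = (if x = x' then (3 * x\<^sup>2 - 2 * (1 + complex_of_real l) * x + complex_of_real l) / (2 * y)
    else (y' - y) / (x' - x))"
  define z where "z = m\<^sup>2 + (1 + complex_of_real l) - x - x'"
  have m: "(if x = x' then (3 * (cnj x)\<^sup>2 - 2 * (1 + complex_of_real l) * cnj x + complex_of_real l) / (2 * (s * cnj y))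
    else (s * cnj y' - s * cnj y) / (cnj x' - cnj x)) = s * cnj m"
  proof (cases "x = x'")
    case True
    have "a / (2 * (s * b)) = s * (a / (2 * b))" for a b
    proof -
      have "inverse (2 * (s * b)) = s * inverse (2 * b)" by (simp add: s(3))
      thus ?thesis by (simp only: divide_inverse mult_ac)
    qed
    thus ?thesis using True by (simp add: m_def)
  next
    case False
    have "s * cnj y' - s * cnj y = s * (cnj y' - cnj y)" by (simp only: right_diff_distrib)
    thus ?thesis using False by (simp add: m_def)
  qed
  have z: "(s * cnj m)\<^sup>2 + (1 + complex_of_real l) - cnj x - cnj x' = cnj z"
  proof -
    have "(s * cnj m)\<^sup>2 = (s * s) * (cnj m)\<^sup>2" by (simp only: power2_eq_square mult_ac)
    thus ?thesis by (simp add: s(1) z_def)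
  qed
  show ?thesis
  proof (cases "x = x' \<and> y = - y'")
    case True
    thus ?thesis by (simp add: PQ)
  next
    case False
    have "ec_add (complex_of_real l) P Q = Affine z (m * (x - z) - y)"
      using False unfolding PQ ec_add.simps Let_def m_def[symmetric] z_def[symmetric] by (simp only: if_False)
    moreover have "ec_add (complex_of_real l) (ec_conj s P) (ec_conj s Q) =
        Affine (cnj z) (s * cnj m * (cnj x - cnj z) - s * cnj y)"
      using False unfolding PQ ec_add.simps ec_conj.simps Let_def complex_cnj_cancel_iff eq m z by (simp only: if_False)
    ultimately show ?thesis by (simp add: algebra_simps)
  qed
qed auto

lemma ec_neg_conj: "ec_neg (ec_conj s P) = ec_conj (- s) P"
  by (cases P) simp_all

lemma ec_conj_neg: "ec_conj s (ec_neg P) = ec_neg (ec_conj s P)"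
  by (cases P) simp_all

lemma ec_conj_commute:
  assumes "s = 1 \<or> s = -1" "t = 1 \<or> t = -1"
  shows "ec_conj s (ec_conj t P) = ec_conj t (ec_conj s P)"
  using assms by (cases P) auto

lemma ec_inv:
  assumes "P \<in> carrier (ec_group l)" "l \<noteq> 0" "l \<noteq> 1"
  shows "inv\<^bsub>ec_group l\<^esub> P = ec_neg P"
proof -
  interpret comm_group "ec_group l" by (rule comm_group_ec_group[OF assms(2,3)])
  show ?thesis
    by (rule inv_equality) (use assms(1) in \<open>cases P; auto\<close>)+
qed

text \<open>The ordinates of all \<open>nu k\<close> with \<open>k \<noteq> 1\<close> have a factor \<open>\<i>\<close>, which conjugation negates.\<close>
definition reflection_sign :: "5 \<Rightarrow> color \<Rightarrow> complex" where
  "reflection_sign k j = (if k = 1 then 1 else -1) * (\<Prod>i\<in>UNIV - {k}. refl_sign i j)"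

lemma nu_reflect: "nu k (reflect j p) = ec_conj (reflection_sign k j) (nu k p)"
proof (cases p rule: proj_cases)
  case (1 x)
  have sq: "(refl_sign i j * a)\<^sup>2 = a\<^sup>2" for i a
    by (simp add: power_mult_distrib) (simp add: power2_eq_square)
  have quot: "a * X * (b * Y) * (c * Z) / (d * W) ^ 3 = a * b * c * d * (X * Y * Z / W ^ 3)"
    if "d * d = 1" for a b c d X Y Z W :: complex
  proof -
    have "d \<noteq> 0" using that by auto
    have "inverse d = d" using that \<open>d \<noteq> 0\<close> by (metis inverse_unique)
    hence "inverse ((d * W) ^ 3) = d * inverse (W ^ 3)"
      using that by (simp add: power3_eq_cube mult_ac)
    thus ?thesis by (simp add: divide_inverse mult_ac)
  qed
  have nu: "nu k (reflect j p) = nu_coords k (\<chi> i. refl_sign i j * cnj (x $ i))"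
    using 1 by (simp add: reflect_proj nu_proj reflect_vec_nonzero)
  have p: "nu k p = nu_coords k x" using 1 by (simp add: nu_proj)
  have prod: "(\<Prod>i\<in>UNIV - {1}. f i) = f 2 * f 3 * f 4 * f 5"
    "(\<Prod>i\<in>UNIV - {2}. f i) = f 3 * f 4 * f 5 * f 1"
    "(\<Prod>i\<in>UNIV - {3}. f i) = f 1 * f 4 * f 5 * f 2"
    "(\<Prod>i\<in>UNIV - {4}. f i) = f 1 * f 2 * f 5 * f 3"
    "(\<Prod>i\<in>UNIV - {5}. f i) = f 1 * f 2 * f 3 * f 4" for f :: "5 \<Rightarrow> complex"
    unfolding UNIV_color by (simp_all add: insert_Diff_if mult_ac)
  show ?thesis unfolding nu p
    using color_cases[of k]
    by (elim disjE) (simp_all add: nu_coords_def reflection_sign_def prod sq quot)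
qed

lemma reflection_sign_table:
  "reflection_sign 1 = (\<lambda>j. if j = 1 \<or> j = 3 then 1 else -1)"
  "reflection_sign 2 = (\<lambda>j. if j = 1 \<or> j = 3 \<or> j = 5 then 1 else -1)"
  "reflection_sign 3 = (\<lambda>j. if j = 1 \<or> j = 2 \<or> j = 4 then 1 else -1)"
  "reflection_sign 4 = (\<lambda>j. if j = 1 \<or> j = 4 then 1 else -1)"
  "reflection_sign 5 = (\<lambda>j. if j = 1 \<or> j = 3 \<or> j = 4 then 1 else -1)"
  unfolding fun_eq_iff forall_color reflection_sign_def UNIV_color
  by (simp_all add: insert_Diff_if refl_sign_def)

lemma reflection_sign_cases: "reflection_sign k j = 1 \<or> reflection_sign k j = -1"
  using color_cases[of k] by (elim disjE) (simp_all add: reflection_sign_table)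

lemma reflection_sign_next:
  "j \<noteq> k + 3 \<Longrightarrow> reflection_sign k (j + 1) = - reflection_sign k j"
  "reflection_sign k (k + 3 + 1) = reflection_sign k (k + 3)"
  using color_cases[of k] color_cases[of j]
  by (elim disjE; simp add: reflection_sign_table)+

lemma vector_5_nonzero: "vector [1, a, b, c, d] \<noteq> (0 :: complex ^ 5)" "vector [0, 1, b, c, d] \<noteq> (0 :: complex ^ 5)"
  using nz_vec1[of "vector [1, a, b, c, d]" 1] nz_vec1[of "vector [0, 1, b, c, d]" 2] by auto

lemma csqrt_gold_1: "csqrt_real (gold + 1) = cgold"
  using gold_square gold_gt_1 by (metis real_sqrt_abs abs_of_pos less_trans zero_less_one)

lemma csqrt_gold_m1: "csqrt_real (gold - 1) * csqrt_real gold = 1"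
proof -
  have "(gold - 1) * gold = 1" using gold_square by (simp add: algebra_simps power2_eq_square)
  thus ?thesis by (metis of_real_1 of_real_mult real_sqrt_mult real_sqrt_one)
qed

lemma gold_simps:
  defines "s \<equiv> csqrt_real gold" and "r \<equiv> csqrt_real (gold - 1)"
  shows "s\<^sup>2 = cgold"
    "r\<^sup>2 = cgold - 1"
    "s \<noteq> 0"
    "r \<noteq> 0"
    "(- (2 * cgold) - 1) / cgold = - cgold - 1"
    "(- (2 * cgold) - 1) / (- cgold - 1) = cgold"
    "(2 * cgold + 1) * (cgold - 1) / cgold = cgold"
    "(2 * cgold + 1) * cgold / (- cgold - 1) = - cgold - 1"
    "(cgold + 1) / cgold = cgold"
    "cgold / (1 - cgold) = - cgold - 1"
    "(- cgold - 1) / cgold = - cgold"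
    "\<i> * (s * (\<i> * cgold)) = - (cgold * s)"
    "\<i> * (r * (\<i> * s)) = -1"
    "\<i> * (\<i> * cgold * s) = - (cgold * s)"
    "(cgold + 1) * cgold = 2 * cgold + 1"
    "\<i> * cgold * (\<i> * s * \<i>) / r ^ 3 = - (\<i> * (2 * cgold + 1))"
proof -
  have S: "s\<^sup>2 = cgold" "r\<^sup>2 = cgold - 1" "r * s = 1" "cgold\<^sup>2 = cgold + 1"
    using gold_gt_1 csqrt_gold_m1 cgold_square by (simp_all add: s_def r_def)
  hence ne: "s \<noteq> 0" "r \<noteq> 0" "cgold \<noteq> 0" by auto
  hence ne': "gold \<noteq> 0" "cgold + 1 \<noteq> 0" "- cgold - 1 \<noteq> 0" "1 - cgold \<noteq> 0" "cgold - 1 \<noteq> 0"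
    using gold_gt_1 by (auto simp: complex_eq_iff)
  have div: "a / b = q" if "a = q * b" "b \<noteq> 0" for a b q :: complex using that by simp
  have i: "\<i>\<^sup>2 = -1" by simp
  show "s\<^sup>2 = cgold" "r\<^sup>2 = cgold - 1" "s \<noteq> 0" "r \<noteq> 0" using S ne by simp_all
  show "(- (2 * cgold) - 1) / cgold = - cgold - 1" "(- (2 * cgold) - 1) / (- cgold - 1) = cgold"
    "(2 * cgold + 1) * (cgold - 1) / cgold = cgold" "(2 * cgold + 1) * cgold / (- cgold - 1) = - cgold - 1"
    "(cgold + 1) / cgold = cgold" "cgold / (1 - cgold) = - cgold - 1" "(- cgold - 1) / cgold = - cgold"
    by (rule div, use S(4) in algebra, use ne(3) ne' in simp)+
  show "\<i> * (s * (\<i> * cgold)) = - (cgold * s)" using i by algebra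
  show "\<i> * (r * (\<i> * s)) = -1" using S(3) i by algebra
  show "\<i> * (\<i> * cgold * s) = - (cgold * s)" using i by algebra
  show "(cgold + 1) * cgold = 2 * cgold + 1" using S(4) by algebra
  have r3: "r ^ 3 = (cgold - 1) * r" by (simp add: power3_eq_cube flip: S(2)) (simp add: power2_eq_square)
  have "cgold * r = s * (r * s)" by (simp only: S(1)[symmetric] power2_eq_square mult_ac)
  hence gr: "cgold * r = s" by (simp add: S(3))
  have gs: "(2 * cgold + 1) * ((cgold - 1) * r) = cgold * s" using S(4) gr by algebra
  show "\<i> * cgold * (\<i> * s * \<i>) / r ^ 3 = - (\<i> * (2 * cgold + 1))"
  proof (rule div)
    show "\<i> * cgold * (\<i> * s * \<i>) = - (\<i> * (2 * cgold + 1)) * r ^ 3"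
      unfolding r3 using i gs by algebra
  qed (use ne in simp)
qed

lemma imaginary_cube: "\<i> ^ 3 = - \<i>"
  by (simp add: power3_eq_cube)

lemma gold_nontrivial: "gold \<noteq> 0" "gold \<noteq> 1" "cgold + 1 \<noteq> 0" "- cgold - 1 \<noteq> 0" "1 - cgold \<noteq> 0"
  using gold_gt_1 by (auto simp: complex_eq_iff)

lemma nu_top_centers:
  "nu 1 (top_center_position 1) = Affine 1 0"
  "nu 1 (top_center_position 2) = Affine (cgold + 1) 0"
  "nu 1 (top_center_position 3) = Infinity"
  "nu 1 (top_center_position 4) = Affine (- cgold) (\<i> * (2 * cgold + 1))"
  "nu 1 (top_center_position 5) = Affine 0 0"
  "nu 2 (top_center_position 1) = Affine cgold 0"
  "nu 2 (top_center_position 2) = Affine 1 0"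
  "nu 2 (top_center_position 3) = Affine 0 0"
  "nu 2 (top_center_position 4) = Infinity"
  "nu 2 (top_center_position 5) = Affine (cgold + 1) (- cgold * csqrt_real gold)"
  "nu 3 (top_center_position 1) = Affine (cgold + 1) (2 * cgold + 1)"
  "nu 3 (top_center_position 2) = Affine 1 0"
  "nu 3 (top_center_position 3) = Affine 0 0"
  "nu 3 (top_center_position 4) = Affine (- cgold) 0"
  "nu 3 (top_center_position 5) = Infinity"
  "nu 4 (top_center_position 1) = Infinity"
  "nu 4 (top_center_position 2) = Affine (- cgold) (\<i> * (2 * cgold + 1))"
  "nu 4 (top_center_position 3) = Affine 0 0"
  "nu 4 (top_center_position 4) = Affine 1 0"
  "nu 4 (top_center_position 5) = Affine (cgold + 1) 0"
  "nu 5 (top_center_position 1) = Affine 0 0"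
  "nu 5 (top_center_position 2) = Infinity"
  "nu 5 (top_center_position 3) = Affine (cgold + 1) (- cgold * csqrt_real gold)"
  "nu 5 (top_center_position 4) = Affine cgold 0"
  "nu 5 (top_center_position 5) = Affine 1 0"
  by (simp_all add: top_center_position_def nu_proj vector_5_nonzero nu_coords_def csqrt_gold_1
      imaginary_cube power_mult_distrib gold_nontrivial gold_simps cgold_square del: csqrt_real_square)

lemma nu_top:
  "nu 1 top_position = Affine (- (zeta ^ 4) - zeta\<^sup>2) (\<i> * cgold\<^sup>2 * zeta ^ 3)"
  "nu 2 top_position = Affine (zeta ^ 4 * cgold + cgold + 1) (- (zeta ^ 3) * csqrt_real gold)"
  "nu 3 top_position = Affine (zeta + zeta ^ 3) (cgold\<^sup>2 * zeta ^ 3)"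
  "nu 4 top_position = Affine (- (zeta ^ 4) - zeta\<^sup>2) (\<i> * cgold\<^sup>2 * zeta ^ 3)"
  "nu 5 top_position = Affine (zeta ^ 4 * cgold + cgold + 1) (- (zeta ^ 3) * csqrt_real gold)"
proof -
  define s z g where szg: "s = csqrt_real gold" "z = zeta" "g = cgold"
  have S: "s\<^sup>2 = g" "g\<^sup>2 = g + 1" "g = z - z ^ 4" "z ^ 5 = -1" "z ^ 4 - z ^ 3 + z\<^sup>2 - z + 1 = 0"
    using gold_gt_1 cgold_square cgold_zeta zeta_power_5 zeta_cyclotomic by (simp_all add: szg)
  have ne: "z \<noteq> 0" "s \<noteq> 0" "g \<noteq> 0" using S(4) S(1,2) by auto
  have p: "z ^ (n + 5) = - (z ^ n)" for n by (simp add: power_add S(4))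
  have red: "z ^ 6 = - z" "z ^ 8 = - (z ^ 3)" "z ^ 9 = - (z ^ 4)"
    using p[of 1] p[of 3] p[of 4] by simp_all
  have div: "a / b = q" if "a = q * b" "b \<noteq> 0" for a b q :: complex using that by simp
  have top: "top_position = proj (vector [1, z\<^sup>2 * s, - (z ^ 4), - (\<i> * z), - (z ^ 3) * s])"
    by (simp add: top_position_def red szg(1,2)[symmetric])
  have i: "\<i>\<^sup>2 = -1" by simp
  have "nu 1 top_position = Affine (- (2 * g + 1) * (1 / (- (z ^ 3) * s)\<^sup>2) - g)
      ((2 * g + 1) * (z\<^sup>2 * s * (- (z ^ 4)) * (- (\<i> * z)) / (- (z ^ 3) * s) ^ 3))"
    using ne by (simp add: top nu_proj vector_5_nonzero nu_coords_def szg(3)[symmetric])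
  also have "1 / (- (z ^ 3) * s)\<^sup>2 = z ^ 4 * (g - 1)"
    by (rule div) (use S ne in \<open>algebra, simp\<close>)
  also have "z\<^sup>2 * s * (- (z ^ 4)) * (- (\<i> * z)) / (- (z ^ 3) * s) ^ 3 = \<i> * z ^ 3 * (g - 1)"
    by (rule div) (use S ne in \<open>algebra, simp\<close>)
  also have "- (2 * g + 1) * (z ^ 4 * (g - 1)) - g = - (z ^ 4) - z\<^sup>2" using S by algebra
  also have "(2 * g + 1) * (\<i> * z ^ 3 * (g - 1)) = \<i> * g\<^sup>2 * z ^ 3" using S by algebra
  finally show "nu 1 top_position = Affine (- (zeta ^ 4) - zeta\<^sup>2) (\<i> * cgold\<^sup>2 * zeta ^ 3)" by (simp add: szg)
  have "nu 2 top_position = Affine ((z\<^sup>2 * s)\<^sup>2 + g + 1) (\<i> * (- (z ^ 4) * (- (\<i> * z)) * (- (z ^ 3) * s)))"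
    by (simp add: top nu_proj vector_5_nonzero nu_coords_def szg(3)[symmetric])
  also have "(z\<^sup>2 * s)\<^sup>2 + g + 1 = z ^ 4 * g + g + 1" using S by algebra
  also have "\<i> * (- (z ^ 4) * (- (\<i> * z)) * (- (z ^ 3) * s)) = - (z ^ 3) * s" using S i by algebra
  finally show "nu 2 top_position = Affine (zeta ^ 4 * cgold + cgold + 1) (- (zeta ^ 3) * csqrt_real gold)" by (simp add: szg)
  have "nu 3 top_position = Affine ((2 * g + 1) * ((- (z ^ 4))\<^sup>2 / (z\<^sup>2 * s)\<^sup>2) + g + 1)
      (\<i> * (2 * g + 1) * (- (\<i> * z) * (- (z ^ 3) * s) / (z\<^sup>2 * s) ^ 3))"
    using ne by (simp add: top nu_proj vector_5_nonzero nu_coords_def szg(3)[symmetric])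
  also have "(- (z ^ 4))\<^sup>2 / (z\<^sup>2 * s)\<^sup>2 = z ^ 4 * (g - 1)"
    by (rule div) (use S ne in \<open>algebra, simp\<close>)
  also have "- (\<i> * z) * (- (z ^ 3) * s) / (z\<^sup>2 * s) ^ 3 = - \<i> * z ^ 3 * (g - 1)"
    by (rule div) (use S ne in \<open>algebra, simp\<close>)
  also have "(2 * g + 1) * (z ^ 4 * (g - 1)) + g + 1 = z + z ^ 3" using S by algebra
  also have "\<i> * (2 * g + 1) * (- \<i> * z ^ 3 * (g - 1)) = g\<^sup>2 * z ^ 3" using S i by algebra
  finally show "nu 3 top_position = Affine (zeta + zeta ^ 3) (cgold\<^sup>2 * zeta ^ 3)" by (simp add: szg)
  have "nu 4 top_position = Affine ((g + 1) * ((- (\<i> * z))\<^sup>2 / (- (z ^ 4))\<^sup>2) - g)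
      (\<i> * g * (z\<^sup>2 * s * (- (z ^ 3) * s) / (- (z ^ 4)) ^ 3))"
    using ne by (simp add: top nu_proj vector_5_nonzero nu_coords_def szg(3)[symmetric])
  also have "(- (\<i> * z))\<^sup>2 / (- (z ^ 4))\<^sup>2 = - (z ^ 4)"
    by (rule div) (use S i ne in \<open>algebra, simp\<close>)
  also have "z\<^sup>2 * s * (- (z ^ 3) * s) / (- (z ^ 4)) ^ 3 = g * z ^ 3"
    by (rule div) (use S ne in \<open>algebra, simp\<close>)
  also have "(g + 1) * (- (z ^ 4)) - g = - (z ^ 4) - z\<^sup>2" using S by algebra
  also have "\<i> * g * (g * z ^ 3) = \<i> * g\<^sup>2 * z ^ 3" by algebra
  finally show "nu 4 top_position = Affine (- (zeta ^ 4) - zeta\<^sup>2) (\<i> * cgold\<^sup>2 * zeta ^ 3)" by (simp add: szg)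
  have "nu 5 top_position = Affine (- ((- (z ^ 3) * s)\<^sup>2 / (- (\<i> * z))\<^sup>2) + g + 1)
      (\<i> * (z\<^sup>2 * s * (- (z ^ 4)) / (- (\<i> * z)) ^ 3))"
    using ne by (simp add: top nu_proj vector_5_nonzero nu_coords_def szg(3)[symmetric])
  also have "(- (z ^ 3) * s)\<^sup>2 / (- (\<i> * z))\<^sup>2 = - (z ^ 4) * g"
    by (rule div) (use S i ne in \<open>algebra, simp\<close>)
  also have "z\<^sup>2 * s * (- (z ^ 4)) / (- (\<i> * z)) ^ 3 = \<i> * z ^ 3 * s"
    by (rule div) (use S i ne in \<open>algebra, simp\<close>)
  also have "- (- (z ^ 4) * g) + g + 1 = z ^ 4 * g + g + 1" by algebra
  also have "\<i> * (\<i> * z ^ 3 * s) = - (z ^ 3) * s" using i by algebra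
  finally show "nu 5 top_position = Affine (zeta ^ 4 * cgold + cgold + 1) (- (zeta ^ 3) * csqrt_real gold)" by (simp add: szg)
qed

lemma color_numeral: "(6 :: 5) = 1" "(7 :: 5) = 2" "(8 :: 5) = 3" "(9 :: 5) = 4" "(10 :: 5) = 5"
    "(11 :: 5) = 1" "(12 :: 5) = 2"
  by simp_all

lemma ec_add_abscissa:
  assumes "x \<noteq> x'" "(y' - y)\<^sup>2 = (X - (1 + l) + x + x') * (x' - x)\<^sup>2"
  obtains Y where "ec_add l (Affine x y) (Affine x' y') = Affine X Y"
proof -
  have "((y' - y) / (x' - x))\<^sup>2 = X - (1 + l) + x + x'"
    using assms by (simp add: power_divide)
  thus ?thesis using that assms(1) by (simp add: Let_def)
qed

lemma ec_conj_fixed: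
  assumes "Affine (complex_of_real X) Y \<in> carrier (ec_group (complex_of_real l))"
    "s = 1 \<and> X * (X - 1) * (X - l) \<ge> 0 \<or> s = -1 \<and> X * (X - 1) * (X - l) \<le> 0"
  shows "ec_conj s (Affine (complex_of_real X) Y) = Affine (complex_of_real X) Y"
proof -
  define r where "r = X * (X - 1) * (X - l)"
  have Y: "Y\<^sup>2 = complex_of_real r" using assms(1) by (simp add: r_def)
  have "s * cnj Y = Y"
    using assms(2) unfolding r_def[symmetric]
  proof (elim disjE conjE)
    assume "s = 1" "r \<ge> 0"
    hence "Y\<^sup>2 = (complex_of_real (sqrt r))\<^sup>2" using Y by simp
    hence "Y = complex_of_real (sqrt r) \<or> Y = - complex_of_real (sqrt r)" by (simp only: power2_eq_iff)
    thus ?thesis using \<open>s = 1\<close> by auto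
  next
    assume "s = -1" "r \<le> 0"
    hence "Y\<^sup>2 = (\<i> * complex_of_real (sqrt (- r)))\<^sup>2" using Y by (simp add: power_mult_distrib)
    hence "Y = \<i> * complex_of_real (sqrt (- r)) \<or> Y = - (\<i> * complex_of_real (sqrt (- r)))"
      by (simp only: power2_eq_iff)
    thus ?thesis using \<open>s = -1\<close> by auto
  qed
  thus ?thesis by simp
qed

lemma nu_position_closed: "nu k (position p) \<in> carrier (ell_curve k)"
  by (rule nu_in_E) (rule X_alg_position)

lemma nu_vertex_nbr:
  "nu k (position (Vertex (nbr j v))) = ec_conj (reflection_sign k j) (nu k (position (Vertex v)))"
  by (simp only: position_nbr nu_reflect)

lemma nu_center_nbr:
  "nu k (position (face_center m (nbr j v))) = ec_conj (reflection_sign k j) (nu k (position (face_center m v)))"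
  by (simp only: position_face_center nu_reflect)

lemma nu_two_torsion_centers:
  obtains t1 t2 t3 :: real where
    "\<And>v. nu k (position (face_center (k + 3 + 1) v)) = Affine (complex_of_real t1) 0"
    "\<And>v. nu k (position (face_center (k + 3 + 2) v)) = Affine (complex_of_real t2) 0"
    "\<And>v. nu k (position (face_center (k + 3 + 3) v)) = Affine (complex_of_real t3) 0"
    "\<And>v. nu k (position (face_center (k + 3 + 4) v)) = Infinity"
    "t1 + t2 + t3 = 1 + curve_param k" "t2 \<noteq> t3"
proof -
  have aff: "nu k (position (face_center j v)) = Affine (complex_of_real t) 0"
    if "nu k (top_center_position j) = Affine (complex_of_real t) 0" for j t v
    by (induction v rule: vertex_induct) (simp_all add: position_top nu_center_nbr that del: position.simps)
  have inf: "nu k (position (face_center j v)) = Infinity"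
    if "nu k (top_center_position j) = Infinity" for j v
    by (induction v rule: vertex_induct) (simp_all add: position_top nu_center_nbr that del: position.simps)
  note intro = that[OF aff aff aff inf]
  consider "k = 1" | "k = 2" | "k = 3" | "k = 4" | "k = 5" using color_cases[of k] by blast
  thus thesis
  proof cases
    case 1
    show thesis by (rule intro[of 0 1 "gold + 1"])
        (use gold_gt_1 in \<open>simp_all add: 1 nu_top_centers curve_param_def color_numeral\<close>)
  next
    case 2
    show thesis by (rule intro[of gold 1 0])
        (use gold_gt_1 in \<open>simp_all add: 2 nu_top_centers curve_param_def color_numeral\<close>)
  next
    case 3
    show thesis by (rule intro[of 1 0 "- gold"])
        (use gold_gt_1 in \<open>simp_all add: 3 nu_top_centers curve_param_def color_numeral\<close>)
  next
    case 4
    show thesis by (rule intro[of 0 1 "gold + 1"])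
        (use gold_gt_1 in \<open>simp_all add: 4 nu_top_centers curve_param_def color_numeral\<close>)
  next
    case 5
    show thesis by (rule intro[of gold 1 0])
        (use gold_gt_1 in \<open>simp_all add: 5 nu_top_centers curve_param_def color_numeral\<close>)
  qed
qed

text \<open>The sign by which complex conjugation acts on the generator.\<close>
definition conj_sign :: "5 \<Rightarrow> complex" where
  "conj_sign k = (if k = 1 \<or> k = 4 then 1 else -1)"

lemma zeta_cnj:
  defines "w \<equiv> cnj zeta"
  shows "w ^ 4 - w ^ 3 + w\<^sup>2 - w + 1 = 0" "cgold = w - w ^ 4"
proof -
  have "cnj (zeta ^ 4 - zeta ^ 3 + zeta\<^sup>2 - zeta + 1) = 0" unfolding zeta_cyclotomic by simp
  thus "w ^ 4 - w ^ 3 + w\<^sup>2 - w + 1 = 0" by (simp add: w_def)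
  have "cgold = cnj (zeta - zeta ^ 4)" unfolding cgold_zeta[symmetric] by simp
  thus "cgold = w - w ^ 4" by (simp add: w_def)
qed

lemma generator_conj:
  fixes k :: 5
  defines "P \<equiv> ec_add (complex_of_real (curve_param k)) (nu k (top_center_position (k + 3)))
    (ec_neg (ec_conj (reflection_sign k (k + 3)) (nu k top_position)))"
  assumes "P \<in> carrier (ell_curve k)"
  shows "ec_conj (conj_sign k) P = P"
proof -
  define w g where wg: "w = cnj zeta" "g = cgold"
  have W: "w ^ 4 - w ^ 3 + w\<^sup>2 - w + 1 = 0" "g = w - w ^ 4" "g\<^sup>2 = g + 1"
    using zeta_cnj cgold_square by (simp_all add: wg)
  have i: "\<i>\<^sup>2 = -1" by simp
  have fixed: ?thesis
    if "P = Affine (complex_of_real X) Y" "conj_sign k = 1 \<and> X * (X - 1) * (X - curve_param k) \<ge> 0 \<or>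
      conj_sign k = -1 \<and> X * (X - 1) * (X - curve_param k) \<le> 0" for X Y
    using ec_conj_fixed[OF _ that(2)] assms(2) unfolding that(1) ell_curve_param by blast
  have neq: "a \<noteq> b" if "(b - a) * c = 1" for a b c :: complex using that by auto
  consider "k = 1 \<or> k = 4" | "k = 2 \<or> k = 5" | "k = 3" using color_cases[of k] by blast
  thus ?thesis
  proof cases
    case 1
    have "P = ec_add (g + 1) (Affine (- g) (\<i> * (2 * g + 1))) (Affine (- (w ^ 4) - w\<^sup>2) (- (\<i> * g\<^sup>2 * w ^ 3)))"
      using 1 by (elim disjE) (simp_all add: P_def nu_top nu_top_centers reflection_sign_table curve_param_def color_numeral wg del: ec_add.simps)
    moreover have "(- (w ^ 4) - w\<^sup>2 - (- g)) * (- 1 + 2 * w - w\<^sup>2) = 1" using W by algebra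
    hence "- g \<noteq> - (w ^ 4) - w\<^sup>2" by (rule neq)
    moreover have "(- (\<i> * g\<^sup>2 * w ^ 3) - \<i> * (2 * g + 1))\<^sup>2 =
        (complex_of_real (3 * gold + 2) - (1 + (g + 1)) + - g + (- (w ^ 4) - w\<^sup>2)) * (- (w ^ 4) - w\<^sup>2 - - g)\<^sup>2"
    proof -
      have "complex_of_real (3 * gold + 2) = 3 * g + 2" by (simp add: wg)
      thus ?thesis using W i by algebra
    qed
    ultimately obtain Y where Y: "P = Affine (complex_of_real (3 * gold + 2)) Y"
      by (metis ec_add_abscissa)
    show ?thesis
      by (rule fixed[OF Y]) (use 1 gold_gt_1 in \<open>auto simp: conj_sign_def curve_param_def\<close>)
  next
    case 2
    define s where "s = csqrt_real gold"
    have s: "s\<^sup>2 = g" using gold_gt_1 by (simp add: s_def wg)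
    have "P = ec_add g (Affine (g + 1) (- g * s)) (Affine (w ^ 4 * g + g + 1) (w ^ 3 * s))"
      using 2 by (elim disjE) (simp_all add: P_def nu_top nu_top_centers reflection_sign_table curve_param_def color_numeral wg s_def del: ec_add.simps)
    moreover have "w \<noteq> 0" using W(1) by auto
    hence "g + 1 \<noteq> w ^ 4 * g + g + 1" using gold_gt_1 by (auto simp: wg)
    moreover have "(w ^ 3 * s - - g * s)\<^sup>2 =
        (complex_of_real (- gold - 1) - (1 + g) + (g + 1) + (w ^ 4 * g + g + 1)) * (w ^ 4 * g + g + 1 - (g + 1))\<^sup>2"
    proof -
      have "complex_of_real (- gold - 1) = - g - 1" by (simp add: wg)
      moreover have "(w ^ 3 * s - - g * s)\<^sup>2 = g * (w ^ 3 + g)\<^sup>2" unfolding s[symmetric] by algebra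
      moreover have "g * (w ^ 3 + g)\<^sup>2 = (- g - 1 - (1 + g) + (g + 1) + (w ^ 4 * g + g + 1)) * (w ^ 4 * g + g + 1 - (g + 1))\<^sup>2"
        using W by algebra
      ultimately show ?thesis by simp
    qed
    ultimately obtain Y where Y: "P = Affine (complex_of_real (- gold - 1)) Y"
      by (metis ec_add_abscissa)
    show ?thesis
    proof (rule fixed[OF Y])
      have "(- gold - 1) * (- gold - 1 - 1) * (- gold - 1 - gold) \<le> 0"
        using gold_gt_1 by (intro mult_nonneg_nonpos mult_nonpos_nonpos) auto
      thus "conj_sign k = 1 \<and> 0 \<le> (- gold - 1) * (- gold - 1 - 1) * (- gold - 1 - curve_param k) \<or>
          conj_sign k = - 1 \<and> (- gold - 1) * (- gold - 1 - 1) * (- gold - 1 - curve_param k) \<le> 0"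
        using 2 by (auto simp: conj_sign_def curve_param_def)
    qed
  next
    case 3
    have "P = ec_add (- g) (Affine (g + 1) (2 * g + 1)) (Affine (w + w ^ 3) (- (g\<^sup>2 * w ^ 3)))"
      using 3 by (simp add: P_def nu_top nu_top_centers reflection_sign_table curve_param_def color_numeral wg del: ec_add.simps)
    moreover have "(w + w ^ 3 - (g + 1)) * (1 - 2 * w + w\<^sup>2) = 1" using W by algebra
    hence "g + 1 \<noteq> w + w ^ 3" by (rule neq)
    moreover have "(- (g\<^sup>2 * w ^ 3) - (2 * g + 1))\<^sup>2 =
        (complex_of_real (- 1 - 3 * gold) - (1 + - g) + (g + 1) + (w + w ^ 3)) * (w + w ^ 3 - (g + 1))\<^sup>2"
    proof -
      have "complex_of_real (- 1 - 3 * gold) = - 1 - 3 * g" by (simp add: wg)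
      thus ?thesis using W by algebra
    qed
    ultimately obtain Y where Y: "P = Affine (complex_of_real (- 1 - 3 * gold)) Y"
      by (metis ec_add_abscissa)
    show ?thesis
    proof (rule fixed[OF Y])
      have "(- 1 - 3 * gold) * (- 1 - 3 * gold - 1) * (- 1 - 3 * gold - - gold) \<le> 0"
        using gold_gt_1 by (intro mult_nonneg_nonpos mult_nonpos_nonpos) auto
      thus "conj_sign k = 1 \<and> 0 \<le> (- 1 - 3 * gold) * (- 1 - 3 * gold - 1) * (- 1 - 3 * gold - curve_param k) \<or>
          conj_sign k = - 1 \<and> (- 1 - 3 * gold) * (- 1 - 3 * gold - 1) * (- 1 - 3 * gold - curve_param k) \<le> 0"
        using 3 by (auto simp: conj_sign_def curve_param_def)
    qed
  qed
qed

lemma rainbow_map_nu: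
  "rainbow_map (ell_curve k) (\<lambda>p. nu k (position p)) (k + 3)
    (\<lambda>i. if reflection_sign k i = conj_sign k then 1 else -1)"
proof -
  define l where "l = complex_of_real (curve_param k)"
  have G: "ell_curve k = ec_group l" by (simp add: ell_curve_param l_def)
  have l: "l \<noteq> 0" "l \<noteq> 1" using curve_param_nontrivial by (simp_all add: l_def)
  interpret comm_group "ec_group l" using l by (rule comm_group_ec_group)
  define N where "N p = nu k (position p)" for p
  define s where "s = reflection_sign k"
  have cl: "N p \<in> carrier (ec_group l)" for p
    using nu_position_closed[of k p] by (simp add: N_def G)
  have inv: "inv\<^bsub>ec_group l\<^esub> P = ec_neg P" if "P \<in> carrier (ec_group l)" for P
    using ec_inv[OF that l] .
  have V: "N (Vertex (nbr j v)) = ec_conj (s j) (N (Vertex v))" for j v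
    unfolding N_def s_def by (rule nu_vertex_nbr)
  have C: "N (face_center m (nbr j v)) = ec_conj (s j) (N (face_center m v))" for m j v
    unfolding N_def s_def by (rule nu_center_nbr)
  have s: "s j = 1 \<or> s j = -1" for j unfolding s_def by (rule reflection_sign_cases)
  obtain t1 t2 t3 where t: "\<And>v. N (face_center (k + 3 + 1) v) = Affine (complex_of_real t1) 0"
    "\<And>v. N (face_center (k + 3 + 2) v) = Affine (complex_of_real t2) 0"
    "\<And>v. N (face_center (k + 3 + 3) v) = Affine (complex_of_real t3) 0"
    "\<And>v. N (face_center (k + 3 + 4) v) = Infinity"
    "t1 + t2 + t3 = 1 + curve_param k" "t2 \<noteq> t3"
    using nu_two_torsion_centers[of k] unfolding N_def by metis
  have tors: "N (face_center j v) = Infinity \<or> (\<exists>x. N (face_center j v) = Affine x 0)"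
    if "j \<noteq> k + 3" for j v
    using that UNIV_color_from[of "k + 3"] t(1-4) by (metis UNIV_I empty_iff insert_iff)
  define R where "R v = N (face_center (k + 3) v) \<otimes>\<^bsub>ec_group l\<^esub> inv\<^bsub>ec_group l\<^esub> N (Vertex (nbr (k + 3) v))" for v
  have Rcl: "R v \<in> carrier (ec_group l)" for v unfolding R_def by (intro m_closed inv_closed cl)
  have R: "R v = ec_add l (N (face_center (k + 3) v)) (ec_neg (N (Vertex (nbr (k + 3) v))))" for v
    by (simp add: R_def inv cl)
  have Rnbr: "R (nbr i v) = ec_conj (s i) (R v)" for i v
    unfolding R C nbr_commute[of "k + 3" i] V[of i] ec_conj_neg[symmetric]
    unfolding l_def by (rule ec_conj_add[OF s, symmetric])
  have cs: "conj_sign k = 1 \<or> conj_sign k = -1" by (simp add: conj_sign_def)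
  have Rconj: "ec_conj (conj_sign k) (R v) = R v" for v
  proof (induction v rule: vertex_induct)
    case top
    have "R top_vertex = ec_add l (nu k (top_center_position (k + 3)))
        (ec_neg (ec_conj (reflection_sign k (k + 3)) (nu k top_position)))"
      unfolding R V by (simp only: N_def s_def position_top)
    thus ?case using generator_conj[of k] Rcl[of top_vertex] by (simp add: G l_def)
  next
    case (nbr v j)
    thus ?case by (simp add: Rnbr ec_conj_commute[OF cs s])
  qed
  have flip: "ec_conj (s (k + 3 + 2)) (N (face_center (k + 3) v)) = ec_neg (N (face_center (k + 3) v))" for v
  proof (induction v rule: vertex_induct)
    case top
    show ?case
      using color_cases[of k] unfolding N_def s_def position_top
      by (elim disjE) (simp_all add: color_numeral nu_top_centers reflection_sign_table)
  next
    case (nbr v j)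
    have "ec_conj (s (k + 3 + 2)) (ec_conj (s j) (N (face_center (k + 3) v))) =
        ec_conj (s j) (ec_conj (s (k + 3 + 2)) (N (face_center (k + 3) v)))"
      by (rule ec_conj_commute[OF s s])
    thus ?case unfolding C nbr ec_conj_neg .
  qed
  have "rainbow_map (ec_group l) N (k + 3) (\<lambda>i. if s i = conj_sign k then 1 else -1)"
  proof (unfold_locales)
    fix p show "N p \<in> carrier (ec_group l)" by (rule cl)
  next
    fix j :: color and v assume "j \<noteq> k + 3"
    from tors[OF this, of v]
    show "N (face_center j v) \<otimes>\<^bsub>ec_group l\<^esub> N (face_center j v) = \<one>\<^bsub>ec_group l\<^esub>" by auto
  next
    fix v
    have "complex_of_real t2 \<noteq> complex_of_real t3" using t(6) by simp
    moreover have "complex_of_real t1 = 1 + l - complex_of_real t2 - complex_of_real t3"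
    proof -
      have "t1 = 1 + curve_param k - t2 - t3" using t(5) by simp
      thus ?thesis by (simp add: l_def)
    qed
    ultimately have "ec_add l (Affine t2 0) (Affine t3 0) = Affine t1 0" by (simp add: Let_def)
    thus "N (face_center (k + 3 + 1) v) \<otimes>\<^bsub>ec_group l\<^esub> (N (face_center (k + 3 + 2) v) \<otimes>\<^bsub>ec_group l\<^esub>
      (N (face_center (k + 3 + 3) v) \<otimes>\<^bsub>ec_group l\<^esub> N (face_center (k + 3 + 4) v))) = \<one>\<^bsub>ec_group l\<^esub>"
      unfolding t(1-4) by simp
  next
    fix j :: color and v assume "j \<noteq> k + 3"
    from reflection_sign_next(1)[OF this]
    show "N (Vertex (nbr (j + 1) v)) = inv\<^bsub>ec_group l\<^esub> N (Vertex (nbr j v))"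
      unfolding inv[OF cl] by (simp add: V ec_neg_conj s_def)
  next
    fix v
    show "N (Vertex (nbr (k + 3 + 1) v)) = N (Vertex (nbr (k + 3) v))"
      unfolding V s_def reflection_sign_next(2) ..
  next
    fix j :: color and v
    show "N (face_center j (nbr (j + 2) v)) = inv\<^bsub>ec_group l\<^esub> N (face_center j v)"
    proof (cases "j = k + 3")
      case True
      thus ?thesis using flip[of v] unfolding inv[OF cl] C by simp
    next
      case False
      have "j = k + 3 + 1 \<or> j = k + 3 + 2 \<or> j = k + 3 + 3 \<or> j = k + 3 + 4"
        using False UNIV_color_from[of "k + 3"] by (metis UNIV_I empty_iff insert_iff)
      thus ?thesis unfolding inv[OF cl] by (elim disjE) (simp_all only: t(1-4) ec_neg.simps minus_zero)
    qed
  next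
    fix i :: color and v
    have "R (nbr i v) = R v [^]\<^bsub>ec_group l\<^esub> (if s i = conj_sign k then 1 else -1 :: int)"
    proof (cases "s i = conj_sign k")
      case True
      thus ?thesis using Rconj Rcl by (simp add: Rnbr)
    next
      case False
      hence "s i = - conj_sign k" using s[of i] cs by auto
      hence "R (nbr i v) = ec_neg (R v)" using Rconj[of v] by (simp add: Rnbr ec_neg_conj[symmetric])
      moreover have "R v [^]\<^bsub>ec_group l\<^esub> (-1 :: int) = inv\<^bsub>ec_group l\<^esub> R v"
        using int_pow_neg[OF Rcl[of v], of 1] Rcl by simp
      ultimately show ?thesis using False by (simp add: inv Rcl)
    qed
    thus "N (face_center (k + 3) (nbr i v)) \<otimes>\<^bsub>ec_group l\<^esub> inv\<^bsub>ec_group l\<^esub> N (Vertex (nbr (k + 3) (nbr i v))) =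
      (N (face_center (k + 3) v) \<otimes>\<^bsub>ec_group l\<^esub> inv\<^bsub>ec_group l\<^esub> N (Vertex (nbr (k + 3) v))) [^]\<^bsub>ec_group l\<^esub>
        (if s i = conj_sign k then 1 else -1 :: int)"
      unfolding R_def .
  next
    show "(if s (k + 3) = conj_sign k then 1 else -1 :: int) = -1"
      "(if s (k + 3 + 1) = conj_sign k then 1 else -1 :: int) = -1"
      "(if s (k + 3 + 3) = conj_sign k then 1 else -1 :: int) = -1"
      using color_cases[of k] unfolding s_def
      by (elim disjE; simp add: color_numeral reflection_sign_table conj_sign_def)+
  qed auto
  thus ?thesis unfolding G N_def s_def .
qed

theorem mainTheorem1:
  fixes k :: 5
  shows "(\<forall>h. height_function h \<longrightarrow>
            (\<exists>a::int. -8 \<le> a \<and> a \<le> 8 \<and> nu_height k h = nu_height k h_1 [^]\<^bsub>ell_curve k\<^esub> a)) \<and>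
         (\<forall>h h'. height_function h \<longrightarrow> height_function h' \<longrightarrow> differ_by_move h h' \<longrightarrow>
            (\<exists>a a'::int. nu_height k h = nu_height k h_1 [^]\<^bsub>ell_curve k\<^esub> a \<and>
               nu_height k h' = nu_height k h_1 [^]\<^bsub>ell_curve k\<^esub> a' \<and> \<bar>a - a'\<bar> = 1))"
proof -
  interpret rainbow_map "ell_curve k" "\<lambda>p. nu k (position p)" "k + 3"
    "\<lambda>i. if reflection_sign k i = conj_sign k then 1 else -1"
    by (rule rainbow_map_nu)
  have "nu_height k h = divisor_image (\<lambda>p. nu k (position p)) (morse_divisor h)" for h
    unfolding nu_height_def nu_divisor_def divisor_image_def ..
  thus ?thesis using divisor_image_multiple divisor_image_move by simp
qed

end
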